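(* Let $k$ be a field of characteristic $2$, let $C=C_c$ be an elliptic curve over $k$ in split $\mu_4$-normal form $$(X_0+X_2)^2=c^2X_1X_3,\qquad (X_1+X_3)^2=c^2X_0X_2,\qquad \mathrm{O}=(c:1:0:1),$$ with rational point $S=(s_0:s_1:s_2:s_3)\in C(k)$. The Kummer-oriented curve $\mathscr{K}(\Delta_S)$ in $\mathscr{K}^2=\mathbb{P}^1\times\mathbb{P}^1$, with coordinate functions $((U_0:U_1),(V_0:V_1))$, is given by the equation $$s_0(U_0V_1+U_1V_0)^2+s_2(U_0V_0+U_1V_1)^2=c(s_1+s_3)U_0U_1V_0V_1.$$ If $S$ is not a $2$-torsion point, the morphism $\lambda:C\to\mathscr{K}(\Delta_S)$, $Q\mapsto(\overline{Q},\overline{Q-S})$, is an isomorphism, and is defined by $$\pi_1\circ\lambda(X_0:X_1:X_2:X_3)=\begin{cases}(cX_0:X_1+X_3),\\(X_1+X_3:cX_2),\end{cases}$$ $$\pi_2\circ\lambda(X_0:X_1:X_2:X_3)=\begin{cases}(s_0X_0+s_2X_2:s_3X_1+s_1X_3),\\(s_1X_1+s_3X_3:s_2X_0+s_0X_2),\end{cases}$$ with inverse $\lambda^{-1}((U_0:U_1),(V_0:V_1))$ equal to $(W_0:W_1:W_2:W_3)$, where $(W_0,W_1,W_2,W_3)$ is either of $$\begin{aligned}&\big((s_1+s_3)U_0^2V_0,\ (s_0U_0^2+s_2U_1^2)V_1+cs_1U_0U_1V_0,\ (s_1+s_3)U_1^2V_0,\ (s_0U_0^2+s_2U_1^2)V_1+cs_3U_0U_1V_0\big),\\&\big((s_1+s_3)U_0^2V_1,\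 (s_2U_0^2+s_0U_1^2)V_0+cs_3U_0U_1V_1,\ (s_1+s_3)U_1^2V_1,\ (s_2U_0^2+s_0U_1^2)V_0+cs_1U_0U_1V_1\big).\end{aligned}$$
   Context: $\mathscr{K}=C/\{[\pm1]\}$ is identified with $\mathbb{P}^1$ via the covering $C\to\mathbb{P}^1$, $(X_0:X_1:X_2:X_3)\mapsto(cX_0:X_1+X_3)=(X_1+X_3:cX_2)$; $\overline{Q}$ denotes the image of $Q\in C$ in $\mathscr{K}$. Here $[-1](X_0:X_1:X_2:X_3)=(X_0:X_3:X_2:X_1)$. For $S\in C(k)$, $\Delta_S=\{(Q,R)\in C\times C\mid Q-R=S\}$, and $\mathscr{K}(\Delta_S)$ is the image of $\Delta_S$ in $\mathscr{K}\times\mathscr{K}$ (the Kummer-oriented curve). The maps $\pi_1,\pi_2$ are the two projections of $\mathscr{K}^2=\mathbb{P}^1\times\mathbb{P}^1$. A morphism given by several tuples means: each tuple defines the morphism on the open complement of the common zeros of its entries, the tuples agree on overlaps, and these open sets cover the curve. *)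

theory Defs
  imports
    "HOL-Analysis.Finite_Cartesian_Product"
    "HOL-Library.Numeral_Type"
    "HOL-Algebra.Algebraic_Closure_Type"
begin

no_notation fps_nth (infixl "$" 75)

text \<open>
  A field \<open>k\<close> is a type \<open>'k :: field\<close>, and a variety over \<open>k\<close> is
  represented by the set of its points over \<^typ>\<open>'k::field alg_closure\<close>; the curve and its group
  law are defined over any field and are used over the algebraic closure. The numeral types
  \<open>2\<close> and \<open>4\<close> have elements \<open>0, 1\<close> and \<open>0, 1, 2, 3\<close>, so that vector components carry the
  customary indices starting at 0.
\<close>

subsection \<open>Projective space\<close>

definition proj_rel :: "'a::field ^ 'n::finite \<Rightarrow> 'a ^ 'n \<Rightarrow> bool" where
  "proj_rel x y \<longleftrightarrow> x \<noteq> 0 \<and> (\<exists>a. a \<noteq> 0 \<and> y = a *s x)"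

lemma part_equivp_proj_rel: "part_equivp (proj_rel :: 'a::field ^ 'n::finite \<Rightarrow> _)"
proof (rule part_equivpI)
  have "proj_rel z z" if "z \<noteq> 0" for z :: "'a ^ 'n"
    unfolding proj_rel_def using that by (intro conjI exI[of _ 1]) simp_all
  moreover have "(\<chi> i. 1) \<noteq> (0 :: 'a ^ 'n)" by (simp add: vec_eq_iff)
  ultimately show "\<exists>x. proj_rel x (x :: 'a ^ 'n)" by blast
  show "symp (proj_rel :: 'a ^ 'n \<Rightarrow> _)"
  proof (rule sympI)
    fix x y :: "'a ^ 'n" assume "proj_rel x y"
    then obtain a where a: "x \<noteq> 0" "a \<noteq> 0" "y = a *s x" by (auto simp: proj_rel_def)
    then have "x = inverse a *s y" by (simp add: vec_eq_iff)
    moreover have "y \<noteq> 0" using a by (auto simp: vec_eq_iff)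
    ultimately show "proj_rel y x" using a unfolding proj_rel_def
      by (metis nonzero_imp_inverse_nonzero)
  qed
  show "transp (proj_rel :: 'a ^ 'n \<Rightarrow> _)"
  proof (rule transpI)
    fix x y z :: "'a ^ 'n" assume "proj_rel x y" "proj_rel y z"
    then obtain a b where "x \<noteq> 0" "a \<noteq> 0" "b \<noteq> 0" "y = a *s x" "z = b *s y"
      by (auto simp: proj_rel_def)
    then show "proj_rel x z"
      by (auto simp: proj_rel_def vec_eq_iff mult.assoc intro!: exI[of _ "b * a"])
  qed
qed

quotient_type (overloaded) ('a, 'n) proj = "('a::field, 'n::finite) vec" / partial: proj_rel
  by (rule part_equivp_proj_rel)

text \<open>\<open>pt x\<close> is the point with homogeneous coordinates \<open>x\<close>; it is only meaningful for \<open>x \<noteq> 0\<close>.\<close>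

abbreviation pt :: "'a::field ^ 'n::finite \<Rightarrow> ('a, 'n) proj" where
  "pt \<equiv> abs_proj"

lemma pt_eq_iff:
  assumes "x \<noteq> 0" "y \<noteq> 0"
  shows "pt x = pt y \<longleftrightarrow> (\<exists>a. a \<noteq> 0 \<and> y = a *s x)"
proof -
  have refl: "proj_rel z z" if "z \<noteq> 0" for z :: "'a ^ 'b"
    unfolding proj_rel_def using that by (intro conjI exI[of _ 1]) simp_all
  have "pt x = pt y \<longleftrightarrow> proj_rel x y"
    using Quotient_rel[OF Quotient_proj, of x y] refl[OF assms(1)] refl[OF assms(2)] by blast
  then show ?thesis using assms by (simp add: proj_rel_def)
qed

definition vec2 :: "'a \<Rightarrow> 'a \<Rightarrow> 'a ^ 2" where
  "vec2 a b = (\<chi> i. if i = 0 then a else b)"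

definition vec4 :: "'a \<Rightarrow> 'a \<Rightarrow> 'a \<Rightarrow> 'a \<Rightarrow> 'a ^ 4" where
  "vec4 a b c d = (\<chi> i. if i = 0 then a else if i = 1 then b else if i = 2 then c else d)"

lemma vec2_nth [simp]: "vec2 a b $ 0 = a" "vec2 a b $ 1 = b"
  by (simp_all add: vec2_def)

lemma vec4_nth [simp]:
  "vec4 a b c d $ 0 = a" "vec4 a b c d $ 1 = b" "vec4 a b c d $ 2 = c" "vec4 a b c d $ 3 = d"
  by (simp_all add: vec4_def)

definition ac_vec :: "'k::field ^ 'n::finite \<Rightarrow> 'k alg_closure ^ 'n" where
  "ac_vec x = (\<chi> i. to_ac (x $ i))"


subsection \<open>Forms and morphisms\<close>

text \<open>
  A form of degree \<open>d\<close> is given by its family \<open>F\<close> of coefficients, indexed by the exponent vectors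
  \<open>m\<close> of total degree \<open>d\<close>. It is evaluated in an algebra over the ring of coefficients
  with structure map \<open>h\<close>. Bihomogeneous forms of bidegree \<open>(d, e)\<close> are treated likewise.
\<close>

lemma finite_exponents: "finite {m :: 'n::finite \<Rightarrow> nat. (\<Sum>i\<in>UNIV. m i) = d}"
proof (rule finite_subset)
  show "{m :: 'n \<Rightarrow> nat. (\<Sum>i\<in>UNIV. m i) = d} \<subseteq> (\<Pi>\<^sub>E i\<in>UNIV. {..d})"
  proof
    fix m :: "'n \<Rightarrow> nat" assume "m \<in> {m. (\<Sum>i\<in>UNIV. m i) = d}"
    then have "m i \<le> d" for i using member_le_sum[of i UNIV m] by simp
    then show "m \<in> (\<Pi>\<^sub>E i\<in>UNIV. {..d})" by (simp add: PiE_UNIV_domain)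
  qed
  show "finite (\<Pi>\<^sub>E i\<in>(UNIV :: 'n set). {..d})" by (rule finite_PiE) simp_all
qed

definition form_eval ::
    "('a \<Rightarrow> 'b::comm_ring_1) \<Rightarrow> nat \<Rightarrow> (('n::finite \<Rightarrow> nat) \<Rightarrow> 'a) \<Rightarrow> 'b ^ 'n \<Rightarrow> 'b" where
  "form_eval h d F x = (\<Sum>m | (\<Sum>i\<in>UNIV. m i) = d. h (F m) * (\<Prod>i\<in>UNIV. x $ i ^ m i))"

definition biform_eval ::
    "('a \<Rightarrow> 'b::comm_ring_1) \<Rightarrow> nat \<Rightarrow> nat \<Rightarrow> (('n::finite \<Rightarrow> nat) \<Rightarrow> ('m::finite \<Rightarrow> nat) \<Rightarrow> 'a)
      \<Rightarrow> 'b ^ 'n \<Rightarrow> 'b ^ 'm \<Rightarrow> 'b" where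
  "biform_eval h d e F x y =
    (\<Sum>m | (\<Sum>i\<in>UNIV. m i) = d. \<Sum>m' | (\<Sum>i\<in>UNIV. m' i) = e.
      h (F m m') * (\<Prod>i\<in>UNIV. x $ i ^ m i) * (\<Prod>i\<in>UNIV. y $ i ^ m' i))"

text \<open>
  A map from a subset \<open>A\<close> of a projective space, respectively of a product of two projective spaces,
  to a projective space is given by a set \<open>T\<close> of tuples: each tuple defines the map off its common
  zeros, and these open sets cover \<open>A\<close>. Agreement of the tuples on overlaps is implied.
\<close>

definition given_by :: "('a::field, 'n::finite) proj set \<Rightarrow> (('a, 'n) proj \<Rightarrow> ('a, 'm::finite) proj)
    \<Rightarrow> ('a ^ 'n \<Rightarrow> 'a ^ 'm) set \<Rightarrow> bool" where
  "given_by A f T \<longleftrightarrow>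
    (\<forall>x. x \<noteq> 0 \<and> pt x \<in> A \<longrightarrow>
      (\<exists>t\<in>T. t x \<noteq> 0) \<and> (\<forall>t\<in>T. t x \<noteq> 0 \<longrightarrow> f (pt x) = pt (t x)))"

definition bi_given_by :: "(('a::field, 'n::finite) proj \<times> ('a, 'm::finite) proj) set
    \<Rightarrow> (('a, 'n) proj \<times> ('a, 'm) proj \<Rightarrow> ('a, 'l::finite) proj)
    \<Rightarrow> ('a ^ 'n \<Rightarrow> 'a ^ 'm \<Rightarrow> 'a ^ 'l) set \<Rightarrow> bool" where
  "bi_given_by Y g T \<longleftrightarrow>
    (\<forall>u v. u \<noteq> 0 \<and> v \<noteq> 0 \<and> (pt u, pt v) \<in> Y \<longrightarrow>
      (\<exists>t\<in>T. t u v \<noteq> 0) \<and> (\<forall>t\<in>T. t u v \<noteq> 0 \<longrightarrow> g (pt u, pt v) = pt (t u v)))"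

text \<open>Morphisms over \<open>k\<close>: given by tuples of forms of equal degree with coefficients in \<open>k\<close>.\<close>

definition form_tuple :: "('k::field alg_closure ^ 'n::finite \<Rightarrow> 'k alg_closure ^ 'm::finite) \<Rightarrow> bool"
  where "form_tuple t \<longleftrightarrow> (\<exists>d F. t = (\<lambda>x. \<chi> j. form_eval to_ac d (F j) x))"

definition biform_tuple :: "('k::field alg_closure ^ 'n::finite \<Rightarrow> 'k alg_closure ^ 'm::finite
    \<Rightarrow> 'k alg_closure ^ 'l::finite) \<Rightarrow> bool"
  where "biform_tuple t \<longleftrightarrow> (\<exists>d e F. t = (\<lambda>u v. \<chi> j. biform_eval to_ac d e (F j) u v))"

definition is_morphism :: "('k::field alg_closure, 'n::finite) proj set
    \<Rightarrow> (('k alg_closure, 'n) proj \<Rightarrow> ('k alg_closure, 'm::finite) proj) \<Rightarrow> bool" where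
  "is_morphism A f \<longleftrightarrow> (\<exists>T. (\<forall>t\<in>T. form_tuple t) \<and> given_by A f T)"

definition is_bi_morphism :: "(('k::field alg_closure, 'n::finite) proj
      \<times> ('k alg_closure, 'm::finite) proj) set
    \<Rightarrow> (('k alg_closure, 'n) proj \<times> ('k alg_closure, 'm) proj \<Rightarrow> ('k alg_closure, 'l::finite) proj)
    \<Rightarrow> bool" where
  "is_bi_morphism Y g \<longleftrightarrow> (\<exists>T. (\<forall>t\<in>T. biform_tuple t) \<and> bi_given_by Y g T)"

text \<open>
  A map into a product is a morphism iff its components are. Isomorphisms from a subvariety \<open>A\<close> of a
  projective space to a subvariety \<open>Y\<close> of a product of two projective spaces:
\<close>

definition is_isomorphism :: "('k::field alg_closure, 'l::finite) proj set
    \<Rightarrow> (('k alg_closure, 'n::finite) proj \<times> ('k alg_closure, 'm::finite) proj) set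
    \<Rightarrow> (('k alg_closure, 'l) proj \<Rightarrow> ('k alg_closure, 'n) proj \<times> ('k alg_closure, 'm) proj) \<Rightarrow> bool"
  where
  "is_isomorphism A Y f \<longleftrightarrow>
    bij_betw f A Y \<and> is_morphism A (fst \<circ> f) \<and> is_morphism A (snd \<circ> f) \<and>
    is_bi_morphism Y (inv_into A f)"


subsection \<open>The curve\<close>

definition mu4_eqs :: "'a::comm_ring_1 \<Rightarrow> 'a ^ 4 \<Rightarrow> bool" where
  "mu4_eqs c x \<longleftrightarrow>
    (x $ 0 + x $ 2)\<^sup>2 = c\<^sup>2 * x $ 1 * x $ 3 \<and> (x $ 1 + x $ 3)\<^sup>2 = c\<^sup>2 * x $ 0 * x $ 2"

definition mu4_curve :: "'a::field \<Rightarrow> ('a, 4) proj set" where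
  "mu4_curve c = {pt x | x. x \<noteq> 0 \<and> mu4_eqs c x}"

definition mu4_O :: "'a::field \<Rightarrow> ('a, 4) proj" where
  "mu4_O c = pt (vec4 c 1 0 1)"

text \<open>
  Jacobian criterion; the two vectors are the gradients of \<open>(X\<^sub>0 + X\<^sub>2)\<^sup>2 - c\<^sup>2 X\<^sub>1 X\<^sub>3\<close> and
  \<open>(X\<^sub>1 + X\<^sub>3)\<^sup>2 - c\<^sup>2 X\<^sub>0 X\<^sub>2\<close>. A nonsingular intersection of two quadrics in \<open>P\<^sup>3\<close> is a curve
  of genus 1. To be used over an algebraically closed field.
\<close>

definition mu4_nonsingular :: "'a::field \<Rightarrow> bool" where
  "mu4_nonsingular c \<longleftrightarrow>
    (\<forall>x. x \<noteq> 0 \<and> mu4_eqs c x \<longrightarrow>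
      (\<forall>a b. a *s vec4 (2 * (x $ 0 + x $ 2)) (- c\<^sup>2 * x $ 3) (2 * (x $ 0 + x $ 2)) (- c\<^sup>2 * x $ 1)
           + b *s vec4 (- c\<^sup>2 * x $ 2) (2 * (x $ 1 + x $ 3)) (- c\<^sup>2 * x $ 0) (2 * (x $ 1 + x $ 3)) = 0
         \<longrightarrow> a = 0 \<and> b = 0))"


subsection \<open>Group law\<close>

text \<open>
  The group law is the one of the elliptic curve \<open>(C, O)\<close> over an algebraically closed field:
  \<open>P + Q\<close> is the unique point \<open>R\<close> such that \<open>(P) + (Q)\<close> is linearly equivalent to
  \<open>(R) + (O)\<close>. The order of vanishing of a form at a point \<open>P\<close> is the order of the power series
  obtained by substituting a formal parametrization of the curve at \<open>P\<close>, that is, a power series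
  point of the cone which reduces to \<open>P\<close> and has nonzero tangent vector in projective space.
  At a nonsingular point this does not depend on the parametrization.
\<close>

definition fps_vec_nth :: "'a::zero fps ^ 'n::finite \<Rightarrow> nat \<Rightarrow> 'a ^ 'n" where
  "fps_vec_nth x j = (\<chi> i. fps_nth (x $ i) j)"

definition local_param :: "'a::field \<Rightarrow> ('a, 4) proj \<Rightarrow> 'a fps ^ 4 \<Rightarrow> bool" where
  "local_param c P x \<longleftrightarrow>
    mu4_eqs (fps_const c) x \<and> fps_vec_nth x 0 \<noteq> 0 \<and> pt (fps_vec_nth x 0) = P \<and>
    (\<forall>a. fps_vec_nth x 1 \<noteq> a *s fps_vec_nth x 0)"

definition form_ord :: "'a::field \<Rightarrow> nat \<Rightarrow> ((4 \<Rightarrow> nat) \<Rightarrow> 'a) \<Rightarrow> ('a, 4) proj \<Rightarrow> nat" where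
  "form_ord c d F P = subdegree (form_eval fps_const d F (SOME x. local_param c P x))"

definition form_nonzero_on :: "'a::field \<Rightarrow> nat \<Rightarrow> ((4 \<Rightarrow> nat) \<Rightarrow> 'a) \<Rightarrow> bool" where
  "form_nonzero_on c d F \<longleftrightarrow> (\<exists>x. x \<noteq> 0 \<and> mu4_eqs c x \<and> form_eval id d F x \<noteq> 0)"

text \<open>The divisor \<open>D\<close> is that of the rational function \<open>F / G\<close>.\<close>

definition principal :: "'a::field \<Rightarrow> (('a, 4) proj \<Rightarrow> int) \<Rightarrow> bool" where
  "principal c D \<longleftrightarrow>
    (\<exists>d F G. form_nonzero_on c d F \<and> form_nonzero_on c d G \<and>
      (\<forall>P\<in>mu4_curve c. D P = int (form_ord c d F P) - int (form_ord c d G P)))"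

definition pt_div :: "('a::field, 4) proj \<Rightarrow> ('a, 4) proj \<Rightarrow> int" where
  "pt_div P R = of_bool (R = P)"

definition mu4_add :: "'a::field \<Rightarrow> ('a, 4) proj \<Rightarrow> ('a, 4) proj \<Rightarrow> ('a, 4) proj" where
  "mu4_add c P Q = (THE R. R \<in> mu4_curve c \<and>
    principal c (\<lambda>T. pt_div P T + pt_div Q T - (pt_div R T + pt_div (mu4_O c) T)))"

definition mu4_neg :: "'a::field \<Rightarrow> ('a, 4) proj \<Rightarrow> ('a, 4) proj" where
  "mu4_neg c P = (THE R. R \<in> mu4_curve c \<and> mu4_add c P R = mu4_O c)"

definition mu4_diff :: "'a::field \<Rightarrow> ('a, 4) proj \<Rightarrow> ('a, 4) proj \<Rightarrow> ('a, 4) proj" where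
  "mu4_diff c P Q = mu4_add c P (mu4_neg c Q)"

definition two_torsion :: "'a::field \<Rightarrow> ('a, 4) proj \<Rightarrow> bool" where
  "two_torsion c P \<longleftrightarrow> mu4_add c P P = mu4_O c"


subsection \<open>The Kummer curve\<close>

text \<open>On the curve the two tuples below agree wherever both are nonzero.\<close>

definition kummer :: "'a::field \<Rightarrow> ('a, 4) proj \<Rightarrow> ('a, 2) proj" where
  "kummer c Q = (let x = rep_proj Q; u = vec2 (c * x $ 0) (x $ 1 + x $ 3) in
    pt (if u \<noteq> 0 then u else vec2 (x $ 1 + x $ 3) (c * x $ 2)))"

definition Delta :: "'a::field \<Rightarrow> ('a, 4) proj \<Rightarrow> (('a, 4) proj \<times> ('a, 4) proj) set" where
  "Delta c S = {(Q, R). Q \<in> mu4_curve c \<and> R \<in> mu4_curve c \<and> mu4_diff c Q R = S}"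

definition kummer_oriented_curve ::
    "'a::field \<Rightarrow> ('a, 4) proj \<Rightarrow> (('a, 2) proj \<times> ('a, 2) proj) set" where
  "kummer_oriented_curve c S = map_prod (kummer c) (kummer c) ` Delta c S"

definition kummer_lambda ::
    "'a::field \<Rightarrow> ('a, 4) proj \<Rightarrow> ('a, 4) proj \<Rightarrow> ('a, 2) proj \<times> ('a, 2) proj" where
  "kummer_lambda c S Q = (kummer c Q, kummer c (mu4_diff c Q S))"

end

theory Submission
  imports Defs
begin

text \<open>
  Every point of the curve is \<open>(a\<^sup>2 : y : b\<^sup>2 : y + c a b)\<close> with
  \<open>y\<^sup>2 = c a b y + (a + b)\<^sup>4 / c\<^sup>2\<close>, where \<open>(a : b)\<close> is its Kummer coordinate. A form of degree \<open>e\<close>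
  thus restricts to \<open>A(a, b) + y B(a, b)\<close> with binary forms of degrees \<open>2 e\<close> and \<open>2 e - 2\<close>, and its
  product with its pullback under \<open>[-1]\<close> is a binary form, the norm.

  The group law is unique for lack of functions with few poles: suppose that \<open>F / G\<close> has divisor
  \<open>(P) + (Q) - 2 (O)\<close>. Multiplying by the pullback of \<open>G\<close> turns the denominator into a polynomial
  in \<open>u = a / b\<close>. All its roots can be cancelled, and the order at \<open>O\<close> then bounds the weight of the
  numerator by \<open>1\<close>, which leaves no room for \<open>y\<close>. So \<open>F / G\<close> is linear in \<open>u\<close>, whence \<open>Q = -P\<close>.
  Existence, and a formula for the Kummer coordinate of \<open>Q - S\<close>, come from the plane sections
  through \<open>O\<close>.

  For fixed \<open>U\<close>, the equation of the Kummer-oriented curve is a quadratic form in \<open>V\<close> whose zeros are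
  the Kummer coordinates of \<open>Q - S\<close> and \<open>-Q - S\<close>, where \<open>U\<close> is that of \<open>\<plusminus>Q\<close>; and the tuples
  for the inverse return multiples of the coordinates of \<open>Q\<close>.
\<close>

section \<open>Forms\<close>

text \<open>Sums are defined by linear equivalence, so a coordinate formula applies only once every
  class is known to contain exactly one point. Both halves rest on the double cover given by the
  Kummer coordinate, which in characteristic 2 is ramified at just two points, \<open>u = 0\<close>
  and O. There the values of \<open>A + y B\<close> no longer separate \<open>A\<close> from
  \<open>B\<close>; the linear coefficient of the expansion does this instead. That is why removing
  a root at \<open>u = 0\<close>, or one unit of weight at O, costs two orders of vanishing, and why
  the charts at these points prescribe \<open>y\<close> rather than \<open>u\<close>. Two kinds of
  plane sections suffice: fibres of the cover, and parabolas \<open>y = u^2 / c + b u + e\<close>.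
  The leading coefficient \<open>1 / c\<close> is forced: it cancels the degree 4 term of the norm
  and leaves a cubic in \<open>u\<close> with three intersection points. The chord through Q and -S
  meets the curve again at -(Q - S), which has the Kummer coordinate of Q - S, so symmetric
  functions of the roots already give the formula. It is expressed by two tuples because either one
  can vanish.\<close>

locale coeff_hom =
  fixes h :: "'a::comm_ring_1 \<Rightarrow> 'b::comm_ring_1"
  assumes hom_0: "h 0 = 0" and hom_1: "h 1 = 1"
    and hom_add: "h (a + b) = h a + h b" and hom_mult: "h (a * b) = h a * h b"
begin

lemma hom_sum: "h (sum f A) = (\<Sum>x\<in>A. h (f x))"
  by (induction A rule: infinite_finite_induct) (simp_all add: hom_0 hom_add)

end

text \<open>Three structure maps occur: \<open>id\<close> for values at points,
  \<open>fps_const\<close> for expansions along a parametrization, \<open>to_ac\<close> for tuples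
  with coefficients in the base field.\<close>

lemma coeff_hom_id: "coeff_hom id"
  by unfold_locales simp_all

lemma coeff_hom_fps_const: "coeff_hom (fps_const :: 'a::comm_ring_1 \<Rightarrow> 'a fps)"
  by unfold_locales simp_all

lemma coeff_hom_to_ac: "coeff_hom (to_ac :: 'a::field \<Rightarrow> 'a alg_closure)"
  by unfold_locales simp_all

text \<open>The exponents are restricted to the two degrees because a family of coefficients is
  arbitrary outside its degree.\<close>

definition form_mult :: "nat \<Rightarrow> nat \<Rightarrow> (('n::finite \<Rightarrow> nat) \<Rightarrow> 'a::comm_ring_1) \<Rightarrow>
    (('n \<Rightarrow> nat) \<Rightarrow> 'a) \<Rightarrow> ('n \<Rightarrow> nat) \<Rightarrow> 'a" where
  "form_mult d e F G k =
    (\<Sum>(m, m') \<in> {m. (\<Sum>i\<in>UNIV. m i) = d} \<times> {m. (\<Sum>i\<in>UNIV. m i) = e}.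
      if (\<lambda>i. m i + m' i) = k then F m * G m' else 0)"

definition linear_form :: "'a::comm_ring_1 ^ 'n::finite \<Rightarrow> ('n \<Rightarrow> nat) \<Rightarrow> 'a" where
  "linear_form a m = (\<Sum>i\<in>UNIV. if m = (\<lambda>j. of_bool (j = i)) then a $ i else 0)"

context coeff_hom
begin

lemma form_eval_mult:
  fixes x :: "'b ^ 'n::finite"
  shows "form_eval h (d + e) (form_mult d e F G) x = form_eval h d F x * form_eval h e G x"
proof -
  let ?M = "\<lambda>d. {m :: 'n \<Rightarrow> nat. (\<Sum>i\<in>UNIV. m i) = d}"
  let ?x = "\<lambda>m. \<Prod>i\<in>UNIV. x $ i ^ m i"
  have fin: "finite (?M d)" for d by (rule finite_exponents)
  have "form_eval h (d + e) (form_mult d e F G) x =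
      (\<Sum>k\<in>?M (d + e). \<Sum>(m, m')\<in>?M d \<times> ?M e.
        if (\<lambda>i. m i + m' i) = k then h (F m) * h (G m') * ?x k else 0)"
    unfolding form_eval_def form_mult_def hom_sum sum_distrib_right
    by (intro sum.cong refl) (auto simp: hom_0 hom_mult)
  also have "\<dots> = (\<Sum>(m, m')\<in>?M d \<times> ?M e. \<Sum>k\<in>?M (d + e).
        if (\<lambda>i. m i + m' i) = k then h (F m) * h (G m') * ?x k else 0)"
    by (subst sum.swap) (simp add: case_prod_beta)
  \<comment> \<open>A pair of exponents contributes to exactly one \<open>k\<close>, namely its sum,
    which has degree \<open>d + e\<close>.\<close>
  also have "\<dots> = (\<Sum>(m, m')\<in>?M d \<times> ?M e. h (F m) * h (G m') * (?x m * ?x m'))"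
    by (intro sum.cong refl)
      (auto simp: sum.delta'[OF fin] sum.distrib power_add prod.distrib)
  also have "\<dots> = form_eval h d F x * form_eval h e G x"
    unfolding form_eval_def sum_product sum.cartesian_product
    by (intro sum.cong refl) (auto simp: mult_ac)
  finally show ?thesis .
qed

lemma form_eval_linear:
  fixes x :: "'b ^ 'n::finite"
  shows "form_eval h 1 (linear_form a) x = (\<Sum>i\<in>UNIV. h (a $ i) * x $ i)"
proof -
  let ?e = "\<lambda>i j :: 'n. of_bool (j = i) :: nat"
  have e1: "(\<Sum>j\<in>UNIV. ?e i j) = 1" for i by (simp add: of_bool_def)
  have prod_e: "(\<Prod>j\<in>UNIV. x $ j ^ ?e i j) = x $ i" for i
  proof -
    have "(\<Prod>j\<in>UNIV. x $ j ^ ?e i j) = (\<Prod>j\<in>UNIV. if j = i then x $ j else 1)"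
      by (intro prod.cong) auto
    then show ?thesis by simp
  qed
  have "form_eval h 1 (linear_form a) x = (\<Sum>m | (\<Sum>i\<in>UNIV. m i) = 1. \<Sum>i\<in>UNIV.
      if ?e i = m then h (a $ i) * (\<Prod>j\<in>UNIV. x $ j ^ m j) else 0)"
    unfolding form_eval_def linear_form_def hom_sum sum_distrib_right
    by (intro sum.cong refl) (auto simp: hom_0)
  also have "\<dots> = (\<Sum>i\<in>UNIV. h (a $ i) * (\<Prod>j\<in>UNIV. x $ j ^ ?e i j))"
    by (subst sum.swap) (simp only: sum.delta'[OF finite_exponents] e1 mem_Collect_eq simp_thms if_True)
  finally show ?thesis by (simp only: prod_e)
qed

lemma form_eval_add:
  "form_eval h d (\<lambda>m. F m + G m) x = form_eval h d F x + form_eval h d G x"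
  unfolding form_eval_def by (simp add: hom_add distrib_right sum.distrib)

lemma biform_eval_mult:
  "biform_eval h d e (\<lambda>m m'. F m * G m') x y = form_eval h d F x * form_eval h e G y"
  unfolding biform_eval_def form_eval_def sum_product
  by (intro sum.cong refl) (simp add: hom_mult mult_ac)

lemma biform_eval_add:
  "biform_eval h d e (\<lambda>m m'. F m m' + G m m') x y = biform_eval h d e F x y + biform_eval h d e G x y"
  unfolding biform_eval_def by (simp add: hom_add distrib_right sum.distrib)

end

lemma form_eval_scale:
  fixes x :: "'b::comm_ring_1 ^ 'n::finite"
  shows "form_eval h d F (g *s x) = g ^ d * form_eval h d F x"
  unfolding form_eval_def sum_distrib_left
  by (intro sum.cong refl) (auto simp: power_mult_distrib prod.distrib power_sum mult_ac)

lemma UNIV_4: "(UNIV :: 4 set) = {0, 1, 2, 3}"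
proof (rule sym, rule card_subset_eq)
  show "card {0, 1, 2, 3 :: 4} = card (UNIV :: 4 set)" by simp
qed simp_all

lemma sum_4: "(\<Sum>i\<in>(UNIV :: 4 set). f i) = f 0 + f 1 + f 2 + f 3"
  unfolding UNIV_4 by (simp add: ac_simps)

lemma UNIV_2: "(UNIV :: 2 set) = {0, 1}"
proof (rule sym, rule card_subset_eq)
  show "card {0, 1 :: 2} = card (UNIV :: 2 set)" by simp
qed simp_all

lemma sum_2: "(\<Sum>i\<in>(UNIV :: 2 set). f i) = f 0 + f 1"
  unfolding UNIV_2 by simp

lemma vec4_eq_iff:
  "(x :: 'a ^ 4) = y \<longleftrightarrow> x $ 0 = y $ 0 \<and> x $ 1 = y $ 1 \<and> x $ 2 = y $ 2 \<and> x $ 3 = y $ 3"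
  using UNIV_4 unfolding vec_eq_iff by (metis UNIV_I empty_iff insert_iff)

lemma vec2_eq_iff: "(x :: 'a ^ 2) = y \<longleftrightarrow> x $ 0 = y $ 0 \<and> x $ 1 = y $ 1"
  using UNIV_2 unfolding vec_eq_iff by (metis UNIV_I empty_iff insert_iff)

section \<open>Polynomials evaluated at power series\<close>

definition aev :: "'a::field poly \<Rightarrow> 'a fps \<Rightarrow> 'a fps" where
  "aev p u = poly (map_poly fps_const p) u"

lemma aev_0 [simp]: "aev 0 u = 0"
  by (simp add: aev_def)

lemma aev_pCons [simp]: "aev (pCons a p) u = fps_const a + u * aev p u"
  by (simp add: aev_def map_poly_pCons)

lemma aev_add [simp]: "aev (p + q) u = aev p u + aev q u"
proof (induction p arbitrary: q)
  case (pCons a p q)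
  then show ?case by (cases q) (simp add: algebra_simps flip: fps_const_add)
qed simp

lemma aev_smult [simp]: "aev (smult a p) u = fps_const a * aev p u"
  by (induction p) (simp_all add: algebra_simps flip: fps_const_mult)

lemma aev_mult [simp]: "aev (p * q) u = aev p u * aev q u"
  by (induction p) (simp_all add: algebra_simps)

lemma aev_1 [simp]: "aev 1 u = 1"
  by (simp add: one_pCons)

lemma aev_power [simp]: "aev (p ^ n) u = aev p u ^ n"
  by (induction n) simp_all

lemma aev_nth_0 [simp]: "fps_nth (aev p u) 0 = poly p (fps_nth u 0)"
  by (induction p) simp_all

text \<open>Once \<open>[:- a, 1:] ^ order a p\<close> is split off, the cofactor does not vanish at
  \<open>a\<close>, so its value at \<open>u\<close> is a unit among power series.\<close>

lemma aev_subdegree: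
  fixes u :: "'a::field fps"
  assumes "p \<noteq> 0" "u \<noteq> fps_const a" "fps_nth u 0 = a"
  shows "aev p u \<noteq> 0" "subdegree (aev p u) = order a p * subdegree (u - fps_const a)"
proof -
  obtain q where q: "p = [:- a, 1:] ^ order a p * q" "\<not> [:- a, 1:] dvd q"
    using order_decomp[OF assms(1)] by blast
  have "fps_nth (aev q u) 0 \<noteq> 0" using q(2) assms(3) by (simp add: poly_eq_0_iff_dvd)
  then have nz: "aev q u \<noteq> 0" "subdegree (aev q u) = 0" by (metis fps_zero_nth, rule subdegree_eq_0)
  have "aev p u = aev ([:- a, 1:] ^ order a p * q) u" using q(1) by simp
  then have eq: "aev p u = (u - fps_const a) ^ order a p * aev q u"
    by (simp flip: fps_const_neg)
  show "aev p u \<noteq> 0" using eq nz assms(2) by simp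
  show "subdegree (aev p u) = order a p * subdegree (u - fps_const a)"
    using eq nz assms(2) by simp
qed

text \<open>Homogenization of \<open>p\<close> in degree \<open>n\<close>. With \<open>a\<close> and
  \<open>b\<close> kept apart it covers the affine part (\<open>b = 1\<close>) as well as a
  neighbourhood of O (\<open>a = 1\<close>).\<close>

definition hev :: "nat \<Rightarrow> 'a::field poly \<Rightarrow> 'a fps \<Rightarrow> 'a fps \<Rightarrow> 'a fps" where
  "hev n p a b = (\<Sum>i\<le>n. fps_const (coeff p i) * a ^ i * b ^ (n - i))"

lemma hev_0 [simp]: "hev n 0 a b = 0"
  by (simp add: hev_def)

lemma hev_0_pCons [simp]: "hev 0 (pCons k p) a b = fps_const k"
  by (simp add: hev_def)

lemma hev_Suc_pCons: "hev (Suc n) (pCons k p) a b = fps_const k * b ^ Suc n + a * hev n p a b"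
  unfolding hev_def sum.atMost_Suc_shift by (simp add: sum_distrib_left mult_ac)

lemma hev_add [simp]: "hev n (p + q) a b = hev n p a b + hev n q a b"
  by (simp add: hev_def distrib_right sum.distrib flip: fps_const_add)

lemma hev_smult [simp]: "hev n (smult k p) a b = fps_const k * hev n p a b"
  by (simp add: hev_def sum_distrib_left mult_ac flip: fps_const_mult)

lemma hev_raise: "degree p \<le> n \<Longrightarrow> hev (k + n) p a b = b ^ k * hev n p a b"
proof (induction k)
  case (Suc k)
  have "coeff p (Suc (k + n)) = 0" using Suc.prems by (intro coeff_eq_0) simp
  then have "hev (Suc k + n) p a b = b * hev (k + n) p a b"
    by (auto simp add: hev_def sum_distrib_left Suc_diff_le intro!: sum.cong)
  then show ?case using Suc by simp
qed simp

text \<open>The induction peels off the constant coefficient of \<open>p\<close>, which comes with a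
  power of \<open>b\<close>; \<open>hev_raise\<close> absorbs that power.\<close>

lemma hev_mult:
  assumes "degree p \<le> m" "degree q \<le> n"
  shows "hev (m + n) (p * q) a b = hev m p a b * hev n q a b"
  using assms(1)
proof (induction m arbitrary: p)
  case 0
  then obtain k where "p = [:k:]" by (metis le_zero_eq degree_eq_zeroE)
  then show ?case by simp
next
  case (Suc m)
  obtain k p' where p: "p = pCons k p'" by (cases p)
  then have "degree p' \<le> m" using Suc.prems by (auto split: if_splits)
  then have IH: "hev (m + n) (p' * q) a b = hev m p' a b * hev n q a b" by (rule Suc.IH)
  have "hev (Suc m + n) (p * q) a b
      = fps_const k * hev (Suc m + n) q a b + a * hev (m + n) (p' * q) a b"
    using hev_Suc_pCons[of "m + n" 0 "p' * q" a b] by (simp add: p)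
  also have "\<dots> = hev (Suc m) p a b * hev n q a b"
    unfolding IH hev_raise[OF assms(2)] p hev_Suc_pCons by (simp add: algebra_simps)
  finally show ?case .
qed

lemma hev_eq_aev: "degree p \<le> n \<Longrightarrow> hev n p u 1 = aev p u"
proof (induction n arbitrary: p)
  case 0
  then obtain k where "p = [:k:]" by (metis le_zero_eq degree_eq_zeroE)
  then show ?case by simp
next
  case (Suc n)
  obtain k p' where p: "p = pCons k p'" by (cases p)
  then have "degree p' \<le> n" using Suc.prems by (auto split: if_splits)
  then show ?case using Suc.IH by (simp add: p hev_Suc_pCons)
qed

text \<open>All terms but the leading one contain \<open>w\<close>, which vanishes to order at least
  two.\<close>

lemma hev_nth_infinity:
  assumes "fps_nth w 0 = 0" "fps_nth w 1 = 0"
  shows "fps_nth (hev n p 1 w) 0 = coeff p n" "fps_nth (hev n p 1 w) 1 = 0"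
proof -
  have *: "hev n p 1 w = fps_const (coeff p n) + w * (\<Sum>i<n. fps_const (coeff p i) * w ^ (n - Suc i))"
    unfolding hev_def sum_distrib_left
    by (subst lessThan_Suc_atMost[symmetric], subst sum.lessThan_Suc)
      (auto simp: Suc_diff_Suc mult_ac simp flip: power_Suc intro!: sum.cong)
  show "fps_nth (hev n p 1 w) 0 = coeff p n" using assms by (simp add: *)
  show "fps_nth (hev n p 1 w) 1 = 0" using assms by (simp add: * fps_mult_nth)
qed

section \<open>Weighted forms on the curve\<close>

text \<open>
  The pair \<open>(A, B)\<close> stands for the form \<open>A(a, b) + y B(a, b)\<close> of weight \<open>n\<close>, the weights of \<open>a, b, y\<close>
  being \<open>1, 1, 2\<close>. For \<open>n < 2\<close> the subtraction in the definition is truncated, but then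
  \<open>wf_pair\<close> forces \<open>B = 0\<close>.
\<close>

definition wev :: "nat \<Rightarrow> 'a::field poly \<Rightarrow> 'a poly \<Rightarrow> 'a fps \<Rightarrow> 'a fps \<Rightarrow> 'a fps \<Rightarrow> 'a fps" where
  "wev n A B a b y = hev n A a b + y * hev (n - 2) B a b"

definition wf_pair :: "nat \<Rightarrow> 'a::field poly \<Rightarrow> 'a poly \<Rightarrow> bool" where
  "wf_pair n A B \<longleftrightarrow> degree A \<le> n \<and> (B = 0 \<or> degree B + 2 \<le> n)"

text \<open>Stated for any ring, so that the field, its polynomials and its power series share one
  set of rules.\<close>

lemma char2_simps:
  assumes "(2 :: 'r::comm_ring_1) = 0"
  shows "- x = (x :: 'r)" "x - y = x + (y :: 'r)" "x + x = (0 :: 'r)" "x + (x + y) = (y :: 'r)"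
    "numeral (Num.Bit0 n) = (0 :: 'r)" "numeral (Num.Bit1 n) = (1 :: 'r)"
proof -
  show dbl: "x + x = 0" for x :: 'r using assms by (metis mult_2 mult_zero_left)
  show *: "- x = x" for x :: 'r using dbl[of x] by (simp add: minus_unique)
  show "x - y = x + y" using *[of y] by (metis diff_conv_add_uminus)
  show "x + (x + y) = y" using dbl[of x] by (simp flip: add.assoc)
  show n: "numeral (Num.Bit0 n) = (0 :: 'r)" for n by (simp only: numeral_Bit0 dbl)
  show "numeral (Num.Bit1 n) = (1 :: 'r)" by (simp only: numeral_Bit1 dbl add_0)
qed

locale mu4 =
  fixes c :: "'a::alg_closed_field"
  assumes two: "(2 :: 'a) = 0" and c0: "c \<noteq> 0"
begin

definition d :: 'a where "d = inverse (c\<^sup>2)"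

lemma c_d: "c\<^sup>2 * d = 1" "d \<noteq> 0"
  using c0 by (simp_all add: d_def)

lemma two_fps: "(2 :: 'a fps) = 0"
  using two by (simp add: numeral_fps_const)

lemma two_poly: "(2 :: 'a poly) = 0"
  using two by (simp add: numeral_poly)

lemmas ch2 = char2_simps[OF two]
lemmas ch2_fps = char2_simps[OF two_fps]
lemmas ch2_poly = char2_simps[OF two_poly]

text \<open>For \<open>cv a b y\<close> the equation \<open>(X1 + X3)^2 = c^2 X0 X2\<close> is
  automatic, as \<open>X1 + X3 = c a b\<close>. The other equation becomes this one.\<close>

definition on_curve :: "'a fps \<Rightarrow> 'a fps \<Rightarrow> 'a fps \<Rightarrow> bool" where
  "on_curve a b y \<longleftrightarrow> y\<^sup>2 = fps_const c * a * b * y + fps_const d * (a ^ 4 + b ^ 4)"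

definition cv :: "'a fps \<Rightarrow> 'a fps \<Rightarrow> 'a fps \<Rightarrow> 'a fps ^ 4" where
  "cv a b y = vec4 (a\<^sup>2) y (b\<^sup>2) (y + fps_const c * a * b)"

abbreviation cX :: "'a poly" where "cX \<equiv> [:0, c:]"
abbreviation dR :: "'a poly" where "dR \<equiv> [:d, 0, 0, 0, d:]"

lemma hev_cX [simp]: "hev 2 cX a b = fps_const c * a * b"
  by (simp add: numeral_2_eq_2 hev_Suc_pCons mult_ac)

lemma hev_dR [simp]: "hev 4 dR a b = fps_const d * (a ^ 4 + b ^ 4)"
  by (simp add: numeral_eq_Suc hev_Suc_pCons algebra_simps)

text \<open>Expand \<open>(A + y B) (C + y D)\<close> and replace \<open>y^2\<close> by means of the
  curve equation.\<close>

lemma wev_mult: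
  assumes "wf_pair m A B" "wf_pair n C D"
  shows "on_curve a b y \<Longrightarrow> wev m A B a b y * wev n C D a b y
      = wev (m + n) (A * C + dR * (B * D)) (A * D + B * C + cX * (B * D)) a b y" (is "_ \<Longrightarrow> ?t")
    and "wf_pair (m + n) (A * C + dR * (B * D)) (A * D + B * C + cX * (B * D))" (is ?w)
proof -
  have deg: "degree A \<le> m" "degree C \<le> n" using assms by (auto simp: wf_pair_def)
  have AC: "hev (m + n) (A * C) a b = hev m A a b * hev n C a b" by (intro hev_mult deg)
  have dAC: "degree (A * C) \<le> m + n" using deg degree_mult_le[of A C] by linarith
  \<comment> \<open>The exponent \<open>n - 2\<close> is a true difference unless
    \<open>D = 0\<close>; hence the case distinctions here and below.\<close>
  have AD: "hev (m + n - 2) (A * D) a b = hev m A a b * hev (n - 2) D a b \<and>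
      (A * D = 0 \<or> degree (A * D) + 2 \<le> m + n)"
  proof (cases "D = 0")
    case False
    then have "degree D + 2 \<le> n" using assms by (auto simp: wf_pair_def)
    moreover have "m + n - 2 = m + (n - 2)" using calculation by simp
    ultimately show ?thesis using hev_mult[OF deg(1), of D "n - 2"] degree_mult_le[of A D] deg
      by auto
  qed auto
  have BC: "hev (m + n - 2) (B * C) a b = hev (m - 2) B a b * hev n C a b \<and>
      (B * C = 0 \<or> degree (B * C) + 2 \<le> m + n)"
  proof (cases "B = 0")
    case False
    then have "degree B + 2 \<le> m" using assms by (auto simp: wf_pair_def)
    moreover have "m + n - 2 = (m - 2) + n" using calculation by simp
    ultimately show ?thesis using hev_mult[OF _ deg(2), of B "m - 2"] degree_mult_le[of B C] deg
      by auto
  qed auto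
  have BD: "hev (m + n - 2) (cX * (B * D)) a b
        = fps_const c * a * b * (hev (m - 2) B a b * hev (n - 2) D a b) \<and>
      hev (m + n) (dR * (B * D)) a b
        = fps_const d * (a ^ 4 + b ^ 4) * (hev (m - 2) B a b * hev (n - 2) D a b) \<and>
      (cX * (B * D) = 0 \<or> degree (cX * (B * D)) + 2 \<le> m + n) \<and> degree (dR * (B * D)) \<le> m + n"
  proof (cases "B * D = 0")
    case False
    then have le: "degree B + 2 \<le> m" "degree D + 2 \<le> n" using assms by (auto simp: wf_pair_def)
    have e: "m + n - 2 = 2 + ((m - 2) + (n - 2))" "m + n = 4 + ((m - 2) + (n - 2))"
      using le by simp_all
    have dBD: "degree (B * D) \<le> (m - 2) + (n - 2)" using le degree_mult_le[of B D] by linarith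
    have h: "hev ((m - 2) + (n - 2)) (B * D) a b = hev (m - 2) B a b * hev (n - 2) D a b"
      using le by (intro hev_mult) simp_all
    have dc: "degree cX \<le> 2" "degree dR \<le> 4" using c0 c_d by simp_all
    have "hev (m + n - 2) (cX * (B * D)) a b = hev 2 cX a b * hev ((m - 2) + (n - 2)) (B * D) a b"
      unfolding e(1) by (intro hev_mult dc dBD)
    moreover have "hev (m + n) (dR * (B * D)) a b
        = hev 4 dR a b * hev ((m - 2) + (n - 2)) (B * D) a b"
      by (subst e(2), intro hev_mult dc dBD)
    moreover have "degree (cX * (B * D)) \<le> 1 + degree (B * D)"
      using degree_mult_le[of cX "B * D"] by simp
    moreover have "degree (dR * (B * D)) \<le> 4 + degree (B * D)"
      using degree_mult_le[of dR "B * D"] dc by linarith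
    ultimately show ?thesis unfolding h hev_cX hev_dR using dBD le by auto
  qed (auto simp del: mult_pCons_left)
  show ?t if "on_curve a b y"
  proof -
    have y: "y * y = fps_const c * a * b * y + fps_const d * (a ^ 4 + b ^ 4)"
      using that by (simp add: on_curve_def power2_eq_square)
    have "wev m A B a b y * wev n C D a b y = hev m A a b * hev n C a b
        + y * (hev m A a b * hev (n - 2) D a b + hev (m - 2) B a b * hev n C a b)
        + y * y * (hev (m - 2) B a b * hev (n - 2) D a b)"
      unfolding wev_def by (simp add: algebra_simps)
    also have "\<dots> = wev (m + n) (A * C + dR * (B * D)) (A * D + B * C + cX * (B * D)) a b y"
      unfolding y wev_def hev_add AC using AD BC BD
      by (simp add: algebra_simps del: mult_pCons_left)
    finally show ?thesis .
  qed
  show ?w unfolding wf_pair_def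
    using dAC AD BC BD
    by (smt (verit, best) add.right_neutral add_0 degree_add_le diff_diff_left le_diff_conv2 diff_add_inverse2 le_add2 add_leD2 Nat.le_diff_conv2)
qed


text \<open>Hiding the pair behind an existential quantifier gives closure under sums and products
  without carrying explicit polynomials along.\<close>

definition weighted :: "nat \<Rightarrow> ('a fps \<Rightarrow> 'a fps \<Rightarrow> 'a fps \<Rightarrow> 'a fps) \<Rightarrow> bool" where
  "weighted n f \<longleftrightarrow>
    (\<exists>A B. wf_pair n A B \<and> (\<forall>a b y. on_curve a b y \<longrightarrow> f a b y = wev n A B a b y))"

lemma weighted_mult:
  assumes "weighted m f" "weighted n g"
  shows "weighted (m + n) (\<lambda>a b y. f a b y * g a b y)"
proof -
  obtain A B C D where *: "wf_pair m A B" "wf_pair n C D"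
    "\<And>a b y. on_curve a b y \<Longrightarrow> f a b y = wev m A B a b y"
    "\<And>a b y. on_curve a b y \<Longrightarrow> g a b y = wev n C D a b y"
    using assms unfolding weighted_def by blast
  show ?thesis unfolding weighted_def
    by (intro exI conjI, rule wev_mult(2)[OF *(1,2)]) (simp add: *(3,4) wev_mult(1)[OF *(1,2)])
qed

lemma weighted_add:
  assumes "weighted n f" "weighted n g"
  shows "weighted n (\<lambda>a b y. f a b y + g a b y)"
proof -
  obtain A B C D where *: "wf_pair n A B" "wf_pair n C D"
    "\<And>a b y. on_curve a b y \<Longrightarrow> f a b y = wev n A B a b y"
    "\<And>a b y. on_curve a b y \<Longrightarrow> g a b y = wev n C D a b y"
    using assms unfolding weighted_def by blast
  have "degree (A + C) \<le> n" using *(1,2) by (intro degree_add_le) (auto simp: wf_pair_def)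
  moreover have "B + D = 0 \<or> degree (B + D) + 2 \<le> n"
  proof (cases "B = 0 \<or> D = 0")
    case False
    then have "2 \<le> n" "degree B \<le> n - 2" "degree D \<le> n - 2" using *(1,2) by (auto simp: wf_pair_def)
    then show ?thesis using degree_add_le[of B "n - 2" D] by linarith
  qed (use *(1,2) in \<open>auto simp: wf_pair_def\<close>)
  ultimately have "wf_pair n (A + C) (B + D)" by (simp add: wf_pair_def)
  moreover have "wev n (A + C) (B + D) a b y = wev n A B a b y + wev n C D a b y" for a b y
    by (simp add: wev_def algebra_simps)
  ultimately show ?thesis unfolding weighted_def using *(3,4)
    by (intro exI[of _ "A + C"] exI[of _ "B + D"]) simp
qed

lemma weighted_const: "weighted 0 (\<lambda>a b y. fps_const k)"
  unfolding weighted_def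
  by (rule exI[of _ "[:k:]"], rule exI[of _ 0]) (simp add: wf_pair_def wev_def)

lemma weighted_0: "weighted n (\<lambda>a b y. 0)"
  unfolding weighted_def
  by (rule exI[of _ 0], rule exI[of _ 0]) (simp add: wf_pair_def wev_def)

lemma weighted_power: "weighted n f \<Longrightarrow> weighted (k * n) (\<lambda>a b y. f a b y ^ k)"
proof (induction k)
  case 0
  then show ?case using weighted_const[of 1] by simp
next
  case (Suc k)
  then show ?case using weighted_mult[of n f "k * n" "\<lambda>a b y. f a b y ^ k"] by simp
qed

lemma weighted_sum:
  "(\<And>i. i \<in> I \<Longrightarrow> weighted n (f i)) \<Longrightarrow> weighted n (\<lambda>a b y. \<Sum>i\<in>I. f i a b y)"
  by (induction I rule: infinite_finite_induct) (simp_all add: weighted_0 weighted_add)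

lemma weighted_prod:
  "(\<And>i. i \<in> I \<Longrightarrow> weighted (n i) (f i)) \<Longrightarrow>
    weighted (\<Sum>i\<in>I. n i) (\<lambda>a b y. \<Prod>i\<in>I. f i a b y)"
proof (induction I rule: infinite_finite_induct)
  case (insert i I)
  then show ?case using weighted_mult[of "n i" "f i" "sum n I" "\<lambda>a b y. \<Prod>i\<in>I. f i a b y"]
    by simp
qed (use weighted_const[of 1] in simp_all)

lemma weighted_coord: "weighted 2 (\<lambda>a b y. cv a b y $ i)"
proof -
  have 0: "weighted 2 (\<lambda>a b y. a\<^sup>2)" unfolding weighted_def
    by (rule exI[of _ "[:0, 0, 1:]"], rule exI[of _ 0])
      (simp add: wf_pair_def wev_def numeral_2_eq_2 hev_Suc_pCons)
  have 1: "weighted 2 (\<lambda>a b y. y)" unfolding weighted_def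
    by (rule exI[of _ 0], rule exI[of _ 1]) (simp add: wf_pair_def wev_def one_pCons)
  have 2: "weighted 2 (\<lambda>a b y. b\<^sup>2)" unfolding weighted_def
    by (rule exI[of _ "[:1:]"], rule exI[of _ 0])
      (simp add: wf_pair_def wev_def numeral_2_eq_2 hev_Suc_pCons)
  have "weighted 2 (\<lambda>a b y. fps_const c * a * b)" unfolding weighted_def
    by (rule exI[of _ cX], rule exI[of _ 0]) (simp add: wf_pair_def wev_def c0)
  then have 3: "weighted 2 (\<lambda>a b y. y + fps_const c * a * b)" by (rule weighted_add[OF 1])
  have "i \<in> {0, 1, 2, 3}" using UNIV_4 by auto
  then show ?thesis using 0 1 2 3 by (auto simp: cv_def)
qed

text \<open>Every coordinate has weight 2, and weights add up in products.\<close>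

lemma form_weighted:
  obtains A B where "wf_pair (2 * e) A B"
    "\<And>a b y. on_curve a b y \<Longrightarrow> form_eval fps_const e F (cv a b y) = wev (2 * e) A B a b y"
proof -
  have "weighted (2 * e) (\<lambda>a b y. fps_const (F m) * (\<Prod>i\<in>UNIV. cv a b y $ i ^ m i))"
    if "(\<Sum>i\<in>UNIV. m i) = e" for m
  proof -
    have "weighted (\<Sum>i\<in>UNIV. m i * 2) (\<lambda>a b y. \<Prod>i\<in>UNIV. cv a b y $ i ^ m i)"
      by (intro weighted_prod weighted_power weighted_coord)
    then have "weighted (2 * e) (\<lambda>a b y. \<Prod>i\<in>UNIV. cv a b y $ i ^ m i)"
      using that by (simp add: mult.commute flip: sum_distrib_right)
    from weighted_mult[OF weighted_const this] show ?thesis by simp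
  qed
  then have "weighted (2 * e) (\<lambda>a b y. form_eval fps_const e F (cv a b y))"
    unfolding form_eval_def by (intro weighted_sum) auto
  then show ?thesis using that unfolding weighted_def by blast
qed

text \<open>The product of \<open>A + y B\<close> with its conjugate \<open>A + (y + c u) B\<close>,
  where \<open>y (y + c u)\<close> is the polynomial \<open>dR\<close> in \<open>u\<close>.\<close>

definition norm_poly :: "'a poly \<Rightarrow> 'a poly \<Rightarrow> 'a poly" where
  "norm_poly A B = A\<^sup>2 + cX * A * B + dR * B\<^sup>2"

text \<open>
  The equation of the curve over the line is irreducible because it is ramified at \<open>0\<close>: if a
  norm vanishes, then so do \<open>A\<close> and \<open>B\<close> at \<open>0\<close>, as one sees from its coefficients of degrees \<open>0\<close> and
  \<open>1\<close>.
\<close>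

lemma norm_poly_eq_0: "norm_poly A B = 0 \<longleftrightarrow> A = 0 \<and> B = 0"
proof
  show "norm_poly A B = 0 \<Longrightarrow> A = 0 \<and> B = 0"
  proof (induction "degree A + degree B" arbitrary: A B rule: less_induct)
    case less
    let ?f = "\<lambda>A B. A\<^sup>2 + [:0, c:] * A * B + [:d, 0, 0, 0, d:] * B\<^sup>2 :: 'a poly"
    have N: "?f A B = 0" using less.prems by (simp add: norm_poly_def)
    obtain a A1 where A1: "A = pCons a A1" by (cases A)
    obtain b B1 where B1: "B = pCons b B1" by (cases B)
    have "poly (?f A B) 0 = a\<^sup>2 + d * b\<^sup>2"
      unfolding A1 B1 by simp
    moreover have "coeff (?f A B) 1 = c * a * b"
      unfolding A1 B1 power2_eq_square by (simp add: two_poly)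
    ultimately have "(poly A 0)\<^sup>2 + d * (poly B 0)\<^sup>2 = 0" "c * poly A 0 * poly B 0 = 0"
      unfolding N by (simp_all add: A1 B1)
    \<comment> \<open>The product condition makes one of the two values zero, and the sum of squares
      then forces the other.\<close>
    then have 0: "poly A 0 = 0" "poly B 0 = 0" using c0 c_d(2) by auto
    from 0 have "[:0, 1:] dvd A" using poly_eq_0_iff_dvd[of A 0] by simp
    then obtain A' where A: "A = [:0, 1:] * A'" by (rule dvdE)
    from 0 have "[:0, 1:] dvd B" using poly_eq_0_iff_dvd[of B 0] by simp
    then obtain B' where B: "B = [:0, 1:] * B'" by (rule dvdE)
    \<comment> \<open>The norm is a quadratic form in the pair, so the common factor
      \<open>[:0, 1:]\<close> comes out squared and the induction can descend.\<close>
    have "(t * r)\<^sup>2 + x * (t * r) * (t * s) + z * (t * s)\<^sup>2 = t\<^sup>2 * (r\<^sup>2 + x * r * s + z * s\<^sup>2)"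
      for t r s x z :: "'a poly" by (simp add: power2_eq_square algebra_simps)
    then have "norm_poly A B = [:0, 1:]\<^sup>2 * norm_poly A' B'" unfolding A B norm_poly_def .
    then have "norm_poly A' B' = 0" using less.prems by simp
    have zero: "A' = 0 \<and> B' = 0" if "\<not> (A = 0 \<and> B = 0)"
    proof (rule less.hyps)
      have "degree A = (if A' = 0 then 0 else Suc (degree A'))"
        "degree B = (if B' = 0 then 0 else Suc (degree B'))"
        by (simp_all add: A B)
      then show "degree A' + degree B' < degree A + degree B"
        using that by (auto simp: A B split: if_splits)
    qed fact
    then show ?case by (auto simp: A B)
  qed
qed (auto simp: norm_poly_def)

text \<open>The pair \<open>(A + cX * B, B)\<close> is the pullback of \<open>(A, B)\<close> under \<open>[-1]\<close>, that is, under \<open>y \<mapsto> y + c a b\<close>.\<close>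

lemma norm_poly_mult:
  assumes "wf_pair n A B"
  shows "on_curve a b y \<Longrightarrow>
      wev n A B a b y * wev n (A + cX * B) B a b y = hev (n + n) (norm_poly A B) a b"
    "degree (norm_poly A B) \<le> n + n" "wf_pair n (A + cX * B) B"
proof -
  show wf: "wf_pair n (A + cX * B) B"
  proof (cases "B = 0")
    case False
    then have "degree (cX * B) \<le> n" using assms degree_mult_le[of cX B]
      by (auto simp: wf_pair_def split: if_splits)
    then show ?thesis using assms by (auto simp: wf_pair_def intro: degree_add_le)
  qed (use assms in simp)
  \<comment> \<open>The \<open>y\<close> component of the product cancels in characteristic
    2.\<close>
  have e: "A * (A + cX * B) + dR * (B * B) = norm_poly A B"
    "A * B + B * (A + cX * B) + cX * (B * B) = 0"
    by (simp_all add: norm_poly_def power2_eq_square algebra_simps ch2_poly del: mult_pCons_left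
        mult_pCons_right)
  show "wev n A B a b y * wev n (A + cX * B) B a b y = hev (n + n) (norm_poly A B) a b"
    if "on_curve a b y"
    using wev_mult(1)[OF assms wf that] unfolding e by (simp add: wev_def)
  show "degree (norm_poly A B) \<le> n + n"
    using wev_mult(2)[OF assms wf] unfolding e by (simp add: wf_pair_def)
qed

section \<open>Affine points and charts\<close>

definition aff :: "'a \<Rightarrow> 'a \<Rightarrow> ('a, 4) proj" where
  "aff u y = pt (vec4 (u\<^sup>2) y 1 (y + c * u))"

definition aff_eq :: "'a \<Rightarrow> 'a \<Rightarrow> bool" where
  "aff_eq u y \<longleftrightarrow> y\<^sup>2 = c * u * y + d * (u ^ 4 + 1)"

text \<open>
  Parametrizations at the point \<open>(u0, y0)\<close> of the affine part \<open>b = 1\<close>, respectively at \<open>O\<close>, where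
  \<open>a = 1\<close>. The two cases for \<open>u0\<close> reflect that the Kummer coordinate is ramified, with index \<open>2\<close>,
  precisely at \<open>u0 = 0\<close> and at \<open>O\<close>.
\<close>

definition achart :: "'a \<Rightarrow> 'a \<Rightarrow> 'a fps \<Rightarrow> 'a fps \<Rightarrow> bool" where
  "achart u0 y0 u y \<longleftrightarrow> on_curve u 1 y \<and> fps_nth u 0 = u0 \<and> fps_nth y 0 = y0 \<and>
    (if u0 = 0 then subdegree u = 2 \<and> fps_nth y 1 \<noteq> 0 else fps_nth u 1 \<noteq> 0)"

definition ochart :: "'a fps \<Rightarrow> 'a fps \<Rightarrow> bool" where
  "ochart w y \<longleftrightarrow> on_curve 1 w y \<and> fps_nth y 0 = inverse c \<and> subdegree w = 2 \<and> fps_nth y 1 \<noteq> 0"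

lemma achart_subdegree:
  assumes "achart u0 y0 u y"
  shows "u - fps_const u0 \<noteq> 0" "subdegree (u - fps_const u0) = (if u0 = 0 then 2 else 1)"
proof -
  show *: "subdegree (u - fps_const u0) = (if u0 = 0 then 2 else 1)"
  proof (cases "u0 = 0")
    case False
    then show ?thesis using assms by (auto simp: achart_def intro!: subdegreeI)
  qed (use assms in \<open>auto simp: achart_def\<close>)
  then show "u - fps_const u0 \<noteq> 0" by (metis subdegree_0 zero_neq_numeral zero_neq_one)
qed

lemma achart_aev:
  assumes "achart u0 y0 u y" "p \<noteq> 0"
  shows "aev p u \<noteq> 0" "subdegree (aev p u) = order u0 p * (if u0 = 0 then 2 else 1)"
proof -
  have "u \<noteq> fps_const u0" "fps_nth u 0 = u0" "subdegree (u - fps_const u0) = (if u0 = 0 then 2 else 1)"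
    using achart_subdegree[OF assms(1)] assms(1) by (auto simp: achart_def)
  then show "aev p u \<noteq> 0" "subdegree (aev p u) = order u0 p * (if u0 = 0 then 2 else 1)"
    using aev_subdegree[OF assms(2)] by auto
qed

definition paev :: "'a poly \<Rightarrow> 'a poly \<Rightarrow> 'a fps \<Rightarrow> 'a fps \<Rightarrow> 'a fps" where
  "paev A B u y = aev A u + y * aev B u"

lemma wev_eq_paev: "wf_pair n A B \<Longrightarrow> wev n A B u 1 y = paev A B u y"
  by (auto simp: wev_def paev_def wf_pair_def hev_eq_aev)

text \<open>Multiplication by the conjugate turns the value into the norm, a nonzero polynomial in
  the nonconstant series \<open>u\<close>.\<close>

lemma paev_nonzero:
  assumes "achart u0 y0 u y" "\<not> (A = 0 \<and> B = 0)"
  shows "paev A B u y \<noteq> 0"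
proof
  assume 0: "paev A B u y = 0"
  have wf: "wf_pair (degree A + degree B + 2) A B" by (simp add: wf_pair_def)
  note * = norm_poly_mult[OF wf]
  have "on_curve u 1 y" using assms(1) by (simp add: achart_def)
  from *(1)[OF this] have "aev (norm_poly A B) u = 0"
    unfolding hev_eq_aev[OF *(2)] wev_eq_paev[OF wf] 0 by simp
  then show False using achart_aev[OF assms(1)] norm_poly_eq_0 assms(2) by blast
qed

text \<open>Since \<open>w\<close> has order 2, the first two coefficients of the expansion see only
  the leading coefficients of \<open>A\<close> and \<open>B\<close>. The linear one isolates that of
  \<open>B\<close>, because \<open>y\<close> has a nonzero linear term; the constant one then yields
  that of \<open>A\<close>.\<close>

lemma ochart_step:
  assumes "ochart w y" "wf_pair (Suc n) A B"
    "fps_nth (wev (Suc n) A B 1 w y) 0 = 0" "fps_nth (wev (Suc n) A B 1 w y) 1 = 0"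
  shows "wf_pair n A B" "wev (Suc n) A B 1 w y = w * wev n A B 1 w y"
proof -
  have "subdegree w = 2" and y: "fps_nth y 1 \<noteq> 0"
    using assms(1) unfolding ochart_def by blast+
  then have w: "fps_nth w 0 = 0" "fps_nth w 1 = 0" by (auto intro: nth_less_subdegree_zero)
  have "fps_nth y 1 * coeff B (Suc n - 2) = 0"
    "coeff A (Suc n) + fps_nth y 0 * coeff B (Suc n - 2) = 0"
    using assms(3,4) hev_nth_infinity[OF w] by (simp_all add: wev_def fps_mult_nth)
  then have 0: "coeff B (Suc n - 2) = 0" "coeff A (Suc n) = 0" using y by simp_all
  have "A = 0" if "degree A = Suc n" using 0(2) that by (metis leading_coeff_0_iff)
  then have A: "degree A \<le> n" using assms(2) by (cases "degree A = Suc n") (auto simp: wf_pair_def)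
  have "B = 0" if "degree B = Suc n - 2" using 0(1) that by (metis leading_coeff_0_iff)
  then have B: "B = 0 \<or> degree B + 2 \<le> n"
    using assms(2) unfolding wf_pair_def by linarith
  show "wf_pair n A B" using A B by (simp add: wf_pair_def)
  have "hev (Suc n - 2) B 1 w = w * hev (n - 2) B 1 w"
  proof (cases "B = 0")
    case False
    then have "degree B \<le> n - 2" "Suc n - 2 = 1 + (n - 2)" using B by simp_all
    then show ?thesis using hev_raise[of B "n - 2" 1 1 w] by simp
  qed simp
  then show "wev (Suc n) A B 1 w y = w * wev n A B 1 w y"
    using hev_raise[OF A, of 1 1 w] by (simp add: wev_def algebra_simps)
qed

text \<open>If the expansion were zero, \<open>ochart_step\<close> could be repeated down to weight
  0, where only a nonzero constant is left.\<close>

lemma ochart_nonzero: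
  assumes "ochart w y" "wf_pair n A B" "\<not> (A = 0 \<and> B = 0)"
  shows "wev n A B 1 w y \<noteq> 0"
  using assms(2)
proof (induction n)
  case 0
  then obtain k where "A = [:k:]" "B = 0"
    by (metis add_is_0 degree_eq_zeroE le_zero_eq wf_pair_def zero_neq_numeral)
  then show ?case using assms(3) by (simp add: wev_def)
next
  case (Suc n)
  have "w \<noteq> 0" using assms(1) by (auto simp: ochart_def)
  then show ?case using ochart_step[OF assms(1) Suc.prems] Suc.IH by (metis fps_zero_nth mult_eq_0_iff)
qed

end

section \<open>Local parameters\<close>

text \<open>The map is a contraction for the adic metric: the iterates starting at 0 stabilize
  coefficient by coefficient.\<close>

lemma fps_fixpoint:
  fixes \<Phi> :: "'a::zero fps \<Rightarrow> 'a fps"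
  assumes contr: "\<And>n a b. (\<And>k. k < n \<Longrightarrow> fps_nth a k = fps_nth b k) \<Longrightarrow>
    fps_nth (\<Phi> a) n = fps_nth (\<Phi> b) n"
  obtains z where "\<Phi> z = z"
proof -
  define s where "s n = (\<Phi> ^^ n) 0" for n
  define z where "z = Abs_fps (\<lambda>k. fps_nth (s (Suc k)) k)"
  have s_Suc: "s (Suc n) = \<Phi> (s n)" for n by (simp add: s_def)
  have step: "\<forall>k<n. fps_nth (s n) k = fps_nth (s (Suc n)) k" for n
  proof (induction n)
    case (Suc n)
    show ?case
    proof (intro allI impI)
      fix k assume k: "k < Suc n"
      have "fps_nth (\<Phi> (s n)) k = fps_nth (\<Phi> (s (Suc n))) k"
        by (rule contr) (use Suc k in auto)
      then show "fps_nth (s (Suc n)) k = fps_nth (s (Suc (Suc n))) k" by (simp only: s_Suc)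
    qed
  qed simp
  have agree: "fps_nth (s n) k = fps_nth z k" if "k < n" for k n
    using that
  proof (induction n)
    case (Suc n)
    then show ?case using step[of n] by (cases "k = n") (auto simp: z_def)
  qed simp
  have "fps_nth (\<Phi> z) n = fps_nth z n" for n
  proof -
    have "fps_nth (\<Phi> z) n = fps_nth (\<Phi> (s n)) n" by (rule contr) (simp add: agree)
    then show ?thesis using agree[of n "Suc n"] by (simp add: s_Suc)
  qed
  then show thesis by (intro that fps_ext)
qed

lemma subdegree_2:
  assumes "subdegree f = 2"
  shows "fps_nth f 0 = 0" "fps_nth f 1 = 0"
  by (rule nth_less_subdegree_zero, simp add: assms)+

lemma fps_mult_agree:
  assumes "\<And>k. k \<le> n \<Longrightarrow> fps_nth a k = fps_nth a' k" "\<And>k. k \<le> n \<Longrightarrow> fps_nth b k = fps_nth b' k"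
  shows "k \<le> n \<Longrightarrow> fps_nth (a * b) k = fps_nth (a' * b') k"
  using assms by (auto simp: fps_mult_nth intro!: sum.cong)

lemma fps_power_agree:
  assumes "\<And>k. k \<le> n \<Longrightarrow> fps_nth a k = fps_nth a' k"
  shows "k \<le> n \<Longrightarrow> fps_nth (a ^ m) k = fps_nth ((a' :: 'a::comm_ring_1 fps) ^ m) k"
proof (induction m arbitrary: k)
  case (Suc m)
  then show ?case unfolding power_Suc using assms by (intro fps_mult_agree[of n]) auto
qed simp

text \<open>As \<open>r\<close> is a unit and \<open>j > 0\<close>, dividing by \<open>r\<close>
  makes the right-hand side a contraction in \<open>v\<close>. Both kinds of chart are solutions of
  such an equation.\<close>

lemma fps_solve:
  fixes r g h :: "'a::field fps"
  assumes "fps_nth r 0 \<noteq> 0" "0 < j"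
  obtains v where "r * v = g + fps_X ^ j * h * v ^ m"
proof -
  define \<Phi> where "\<Phi> v = inverse r * (g + fps_X ^ j * h * v ^ m)" for v
  obtain v where v: "\<Phi> v = v"
  proof (rule fps_fixpoint)
    fix n and a b :: "'a fps"
    assume *: "\<And>k. k < n \<Longrightarrow> fps_nth a k = fps_nth b k"
    have "fps_nth (fps_X ^ j * (h * a ^ m)) k = fps_nth (fps_X ^ j * (h * b ^ m)) k" if "k \<le> n" for k
    proof (cases "k < j")
      case False
      then have "k - j < n" using assms(2) that by linarith
      then have "fps_nth (h * a ^ m) (k - j) = fps_nth (h * b ^ m) (k - j)"
        by (intro fps_mult_agree[of "k - j"] fps_power_agree[of "k - j"]) (auto intro: *)
      then show ?thesis using False by (simp add: fps_X_power_mult_nth)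
    qed (simp add: fps_X_power_mult_nth)
    then show "fps_nth (\<Phi> a) n = fps_nth (\<Phi> b) n"
      unfolding \<Phi>_def by (intro fps_mult_agree[of n]) (auto simp: mult.assoc)
  qed
  have "r * v = r * inverse r * (g + fps_X ^ j * h * v ^ m)"
    by (subst v[symmetric]) (simp add: \<Phi>_def mult.assoc)
  also have "r * inverse r = 1" using assms(1) by (simp add: inverse_mult_eq_1')
  finally show thesis using that by simp
qed

context mu4
begin

lemma square_eq_iff: "(a::'a)\<^sup>2 = b\<^sup>2 \<longleftrightarrow> a = b"
proof
  assume "a\<^sup>2 = b\<^sup>2"
  then have "(a - b)\<^sup>2 = 0" by (simp add: power2_eq_square algebra_simps ch2)
  then show "a = b" by simp
qed simp

lemma d_eq: "d = (inverse c)\<^sup>2"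
  by (simp add: d_def power_inverse)

lemma aff_eq_0: "aff_eq 0 y \<longleftrightarrow> y = inverse c"
  by (simp add: aff_eq_def d_eq square_eq_iff)

lemma square_add: "(a + b)\<^sup>2 = a\<^sup>2 + (b::'a)\<^sup>2"
  by (simp add: power2_sum two)

lemma square_add_fps: "(a + b)\<^sup>2 = a\<^sup>2 + (b::'a fps)\<^sup>2"
  by (simp add: power2_sum two_fps)

lemma ch2_move: "(x::'a) = p + q \<longleftrightarrow> q = x + p"
  by (metis add.commute ch2(4))

lemma ch2_move_fps: "(x::'a fps) = p + q \<longleftrightarrow> q = x + p"
  by (metis add.commute ch2_fps(4))

lemma fourth_power: "(a::'b::monoid_mult) ^ 4 = (a\<^sup>2)\<^sup>2"
  by (simp flip: power_mult)

lemma square_nth: "fps_nth ((f::'a fps)\<^sup>2) 1 = 0" "fps_nth (f\<^sup>2) 2 = (fps_nth f 1)\<^sup>2"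
proof -
  show "fps_nth (f\<^sup>2) 1 = 0"
    by (simp add: power2_eq_square fps_mult_nth mult.commute ch2)
  have "fps_nth (f\<^sup>2) 2 = fps_nth f 0 * fps_nth f 2 + fps_nth f 1 * fps_nth f 1 + fps_nth f 2 * fps_nth f 0"
    by (simp add: power2_eq_square fps_mult_nth numeral_2_eq_2)
  also have "\<dots> = (fps_nth f 1)\<^sup>2 + 2 * (fps_nth f 0 * fps_nth f 2)"
    by (simp add: power2_eq_square)
  finally show "fps_nth (f\<^sup>2) 2 = (fps_nth f 1)\<^sup>2" by (simp add: two)
qed

text \<open>The coefficients of degrees 0, 1 and 2 of the curve equation. Squares have no linear
  term in characteristic 2, so degree 1 leaves only the contribution of
  \<open>u * y\<close>.\<close>

lemma on_curve_nth:
  assumes "on_curve u 1 y"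
  shows "aff_eq (fps_nth u 0) (fps_nth y 0)"
    "fps_nth u 0 * fps_nth y 1 = fps_nth u 1 * fps_nth y 0"
    "fps_nth u 0 = 0 \<Longrightarrow> fps_nth u 1 = 0 \<Longrightarrow> (fps_nth y 1)\<^sup>2 = c * fps_nth u 2 * fps_nth y 0"
proof -
  have e: "y\<^sup>2 = fps_const c * (u * y) + fps_const d * ((u\<^sup>2)\<^sup>2 + 1)"
    using assms unfolding on_curve_def fourth_power by (simp add: mult.assoc)
  have "fps_nth (y\<^sup>2) 0 = fps_nth (fps_const c * (u * y) + fps_const d * ((u\<^sup>2)\<^sup>2 + 1)) 0"
    unfolding e ..
  then show "aff_eq (fps_nth u 0) (fps_nth y 0)"
    unfolding aff_eq_def fourth_power by (simp add: power2_eq_square)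
  have "fps_nth (y\<^sup>2) 1 = fps_nth (fps_const c * (u * y) + fps_const d * ((u\<^sup>2)\<^sup>2 + 1)) 1"
    unfolding e ..
  then have "0 = c * fps_nth (u * y) 1"
    by (simp only: fps_add_nth fps_mult_left_const_nth square_nth) simp
  then have "fps_nth u 0 * fps_nth y 1 + fps_nth u 1 * fps_nth y 0 = 0"
    using c0 by (simp add: fps_mult_nth)
  then show "fps_nth u 0 * fps_nth y 1 = fps_nth u 1 * fps_nth y 0"
    by (metis add_eq_0_iff2 ch2(1))
  assume 0: "fps_nth u 0 = 0" "fps_nth u 1 = 0"
  have "fps_nth (y\<^sup>2) 2 = fps_nth (fps_const c * (u * y) + fps_const d * ((u\<^sup>2)\<^sup>2 + 1)) 2"
    unfolding e ..
  then have "(fps_nth y 1)\<^sup>2 = c * fps_nth (u * y) 2"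
    by (simp only: fps_add_nth fps_mult_left_const_nth square_nth) simp
  then show "(fps_nth y 1)\<^sup>2 = c * fps_nth u 2 * fps_nth y 0"
    using 0 by (simp add: fps_mult_nth numeral_2_eq_2)
qed

lemma achart_exists:
  assumes "aff_eq u0 y0"
  obtains u y where "achart u0 y0 u y"
proof (cases "u0 = 0")
  case True
  then have y0: "y0 = inverse c" using assms aff_eq_0 by simp
  define y where "y = fps_const y0 + fps_X"
  \<comment> \<open>With \<open>y\<close> prescribed and \<open>y0^2 = d\<close>, the curve equation
    reads \<open>c u y = fps_X^2 + d u^4\<close>. Substituting \<open>u = fps_X^2 * v\<close> and
    dividing by \<open>fps_X^2\<close> gives this equation.\<close>
  obtain v where v: "(fps_const c * y) * v = 1 + fps_X ^ 6 * fps_const d * v ^ 4"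
    by (rule fps_solve[of "fps_const c * y" 6 1 "fps_const d" 4]) (simp_all add: y_def y0 c0)
  define u where "u = fps_X\<^sup>2 * v"
  have "fps_nth ((fps_const c * y) * v) 0 = 1" unfolding v by simp
  then have v0: "fps_nth v 0 \<noteq> 0" by auto
  have "fps_const c * u * 1 * y = fps_X\<^sup>2 * ((fps_const c * y) * v)" by (simp add: u_def)
  also have "\<dots> = fps_X\<^sup>2 + fps_const d * (fps_X ^ 8 * v ^ 4)"
    unfolding v by (simp add: algebra_simps flip: power_add)
  also have "fps_X ^ 8 * v ^ 4 = u ^ 4" by (simp add: u_def power_mult_distrib flip: power_mult)
  finally have "fps_const c * u * 1 * y + fps_const d * (u ^ 4 + 1 ^ 4) = fps_X\<^sup>2 + fps_const d"
    by (simp add: algebra_simps ch2_fps)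
  also have "\<dots> = y\<^sup>2" unfolding y_def square_add_fps by (simp add: y0 d_eq fps_const_power)
  finally have "on_curve u 1 y" by (simp add: on_curve_def)
  moreover have "subdegree u = 2" unfolding u_def using v0
    by (subst subdegree_mult) (auto simp: fps_X_power_subdegree)
  moreover from this have "fps_nth u 0 = 0" by (rule subdegree_2)
  ultimately have "achart u0 y0 u y" using True by (simp add: achart_def y_def y0)
  then show ?thesis by (rule that)
next
  case False
  define u where "u = fps_const u0 + fps_X"
  \<comment> \<open>Here \<open>u\<close> is prescribed. Substituting
    \<open>y = y0 + fps_X * v\<close> gives \<open>c u fps_X v = f + (fps_X * v)^2\<close>, and
    \<open>f\<close> is divisible by \<open>fps_X\<close> because \<open>(u0, y0)\<close> satisfies
    the curve equation.\<close>
  define f where "f = fps_const (y0\<^sup>2) + fps_const c * u * fps_const y0 + fps_const d * (u ^ 4 + 1)"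
  have "fps_nth f 0 = y0\<^sup>2 + (c * u0 * y0 + d * (u0 ^ 4 + 1))"
    unfolding f_def u_def by (simp add: fps_power_zeroth)
  also have "\<dots> = 0" using assms unfolding aff_eq_def by (simp only: ch2)
  finally have "f = fps_X * fps_shift 1 f" by (intro fps_ext) (auto simp: fps_X_mult_nth)
  then obtain g where g: "f = fps_X * g" by blast
  obtain v where v: "(fps_const c * u) * v = g + fps_X ^ 1 * 1 * v ^ 2"
    by (rule fps_solve[of "fps_const c * u" 1 g 1 2]) (simp_all add: u_def c0 False)
  define y where "y = fps_const y0 + fps_X * v"
  have "fps_const c * u * 1 * y = fps_const c * u * fps_const y0 + fps_X * ((fps_const c * u) * v)"
    by (simp add: y_def algebra_simps)
  also have "\<dots> = fps_const c * u * fps_const y0 + f + (fps_X * v)\<^sup>2"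
    unfolding v g by (simp add: algebra_simps power2_eq_square)
  also have "\<dots> = fps_const (y0\<^sup>2) + (fps_X * v)\<^sup>2 + fps_const d * (u ^ 4 + 1)"
    unfolding f_def by (simp add: add_ac ch2_fps)
  also have "fps_const (y0\<^sup>2) + (fps_X * v)\<^sup>2 = y\<^sup>2"
    unfolding y_def square_add_fps by (simp add: fps_const_power)
  finally have "on_curve u 1 y" by (simp add: on_curve_def add.assoc ch2_fps)
  then have "achart u0 y0 u y" using False by (auto simp: achart_def y_def u_def)
  then show ?thesis by (rule that)
qed

lemma on_curve_swap: "on_curve a b y \<longleftrightarrow> on_curve b a y"
  by (simp add: on_curve_def mult_ac add_ac)

text \<open>Exchanging \<open>a\<close> and \<open>b\<close> is a symmetry of the curve that carries
  O to the affine point with \<open>u = 0\<close>.\<close>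

lemma ochart_iff: "ochart w y \<longleftrightarrow> achart 0 (inverse c) w y"
  unfolding ochart_def achart_def on_curve_swap[of 1 w] using subdegree_2(1)[of w] by metis

section \<open>Normal forms of points and of parametrizations\<close>

lemma mu4_eqs_cv:
  assumes "on_curve a b y"
  shows "mu4_eqs (fps_const c) (cv a b y)"
proof -
  have "(a\<^sup>2 + b\<^sup>2)\<^sup>2 = fps_const (c\<^sup>2 * d) * (a ^ 4 + b ^ 4)"
    unfolding fourth_power square_add_fps c_d(1) by simp
  also have "\<dots> = (fps_const c)\<^sup>2 * (y\<^sup>2 + fps_const c * a * b * y)"
    using assms unfolding on_curve_def ch2_move_fps[of "y\<^sup>2"]
    by (simp add: fps_const_power mult.assoc flip: fps_const_mult)
  finally show ?thesis
    by (simp add: mu4_eqs_def cv_def power_mult_distrib power2_eq_square algebra_simps ch2_fps)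
qed

lemma mu4_eqs_normal:
  assumes "mu4_eqs c x" "x $ 2 \<noteq> 0"
  obtains u y where "aff_eq u y" "x = x $ 2 *s vec4 (u\<^sup>2) y 1 (y + c * u)"
proof -
  define g where "g = x $ 2"
  define u where "u = (x $ 1 + x $ 3) / (c * g)"
  define y where "y = x $ 1 / g"
  have g: "g \<noteq> 0" using assms by (simp add: g_def)
  have eqs: "(x $ 0 + g)\<^sup>2 = c\<^sup>2 * x $ 1 * x $ 3" "(x $ 1 + x $ 3)\<^sup>2 = c\<^sup>2 * x $ 0 * g"
    using assms by (simp_all add: mu4_eqs_def g_def)
  have 1: "x $ 1 = g * y" using g by (simp add: y_def)
  have "x $ 1 + x $ 3 = c * g * u" using g c0 by (simp add: u_def)
  then have 3: "x $ 3 = g * (y + c * u)"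
    by (metis 1 ch2(4) distrib_left mult.assoc mult.left_commute add.commute)
  have "c\<^sup>2 * g * (g * u\<^sup>2) = c\<^sup>2 * g * x $ 0"
    using eqs(2) \<open>x $ 1 + x $ 3 = c * g * u\<close> by (simp add: power2_eq_square mult_ac)
  then have 0: "x $ 0 = g * u\<^sup>2" using g c0 by simp
  have "g\<^sup>2 * (u\<^sup>2 + 1)\<^sup>2 = g\<^sup>2 * (c\<^sup>2 * y * (y + c * u))"
    using eqs(1) unfolding 0 1 3 by (simp add: power2_eq_square algebra_simps)
  then have "(u\<^sup>2 + 1)\<^sup>2 = c\<^sup>2 * y * (y + c * u)" using g by simp
  then have "d * (u ^ 4 + 1) = (c\<^sup>2 * d) * (y * (y + c * u))"
    unfolding fourth_power square_add by (simp add: mult_ac)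
  then have "d * (u ^ 4 + 1) = y\<^sup>2 + c * u * y" unfolding c_d(1)
    by (simp add: power2_eq_square algebra_simps)
  then have "aff_eq u y" unfolding aff_eq_def by (rule ch2_move[THEN iffD2])
  then show ?thesis
    by (rule that) (simp add: vec4_eq_iff 0 1 3 flip: g_def)
qed

text \<open>O is the only point with \<open>X2 = 0\<close>: the equations then force
  \<open>X1 = X3\<close> and \<open>X0 = c X1\<close>.\<close>

lemma mu4_curve_cases:
  assumes "P \<in> mu4_curve c"
  obtains "P = mu4_O c" | u y where "aff_eq u y" "P = aff u y"
proof -
  obtain x where x: "P = pt x" "x \<noteq> 0" "mu4_eqs c x" using assms by (auto simp: mu4_curve_def)
  show thesis
  proof (cases "x $ 2 = 0")
    case True
    have "(x $ 0)\<^sup>2 = c\<^sup>2 * x $ 1 * x $ 3" "x $ 1 + x $ 3 = 0"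
      using x(3) True by (simp_all add: mu4_eqs_def)
    then have 3: "x $ 3 = x $ 1" by (metis add_eq_0_iff2 ch2(1))
    then have "(x $ 0)\<^sup>2 = (c * x $ 1)\<^sup>2"
      using \<open>(x $ 0)\<^sup>2 = _\<close> by (simp add: power2_eq_square mult_ac)
    then have eq: "x = x $ 1 *s vec4 c 1 0 1"
      using True 3 unfolding square_eq_iff by (simp add: vec4_eq_iff mult.commute)
    then have "x $ 1 \<noteq> 0" using x(2) by auto
    moreover have "vec4 c 1 0 1 \<noteq> 0" by (simp add: vec4_eq_iff)
    ultimately have "P = mu4_O c"
      unfolding x(1) mu4_O_def using eq pt_eq_iff[of "vec4 c 1 0 1" x] x(2) by metis
    then show ?thesis by (rule that)
  next
    case False
    then obtain u y where uy: "aff_eq u y" "x = x $ 2 *s vec4 (u\<^sup>2) y 1 (y + c * u)"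
      by (rule mu4_eqs_normal[OF x(3)])
    have "vec4 (u\<^sup>2) y 1 (y + c * u) \<noteq> 0" by (simp add: vec4_eq_iff)
    then have "P = aff u y" unfolding x(1) aff_def
      using uy(2) False x(2) pt_eq_iff[of "vec4 (u\<^sup>2) y 1 (y + c * u)" x] by metis
    then show ?thesis using uy(1) that by blast
  qed
qed

lemma mu4_eqs_aff: "aff_eq u y \<Longrightarrow> mu4_eqs c (vec4 (u\<^sup>2) y 1 (y + c * u))"
proof -
  assume "aff_eq u y"
  then have e: "d * (u ^ 4 + 1) = y\<^sup>2 + c * u * y" unfolding aff_eq_def by (rule ch2_move[THEN iffD1])
  have "(u\<^sup>2 + 1)\<^sup>2 = c\<^sup>2 * d * (u ^ 4 + 1)" unfolding c_d square_add fourth_power by simp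
  also have "\<dots> = c\<^sup>2 * (d * (u ^ 4 + 1))" by (simp only: mult.assoc)
  finally have "(u\<^sup>2 + 1)\<^sup>2 = c\<^sup>2 * y * (y + c * u)"
    unfolding e by (simp add: power2_eq_square algebra_simps)
  moreover have "(y + (y + c * u))\<^sup>2 = c\<^sup>2 * u\<^sup>2 * 1"
    by (simp only: ch2) (simp add: power_mult_distrib)
  ultimately show ?thesis by (simp add: mu4_eqs_def)
qed

lemma aff_in_curve: "aff_eq u y \<Longrightarrow> aff u y \<in> mu4_curve c"
  unfolding mu4_curve_def aff_def using mu4_eqs_aff[of u y] by (force simp: vec4_eq_iff)

lemma O_in_curve: "mu4_O c \<in> mu4_curve c"
  unfolding mu4_curve_def mu4_O_def
  by (rule CollectI, rule exI[of _ "vec4 c 1 0 1"]) (simp add: vec4_eq_iff mu4_eqs_def ch2)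

lemma aff_inj: "aff u y = aff u' y' \<longleftrightarrow> u = u' \<and> y = y'"
proof
  assume "aff u y = aff u' y'"
  then obtain a where "vec4 (u'\<^sup>2) y' 1 (y' + c * u') = a *s vec4 (u\<^sup>2) y 1 (y + c * u)"
    unfolding aff_def by (subst (asm) pt_eq_iff) (auto simp: vec4_eq_iff)
  then have "u'\<^sup>2 = u\<^sup>2 \<and> y' = y" by (auto simp: vec4_eq_iff)
  then show "u = u' \<and> y = y'" by (auto simp: square_eq_iff)
qed simp

lemma aff_not_O: "aff u y \<noteq> mu4_O c" "mu4_O c \<noteq> aff u y"
proof -
  show "aff u y \<noteq> mu4_O c"
  proof
    assume "aff u y = mu4_O c"
    then obtain a where "a \<noteq> 0" "vec4 c 1 0 1 = a *s vec4 (u\<^sup>2) y 1 (y + c * u)"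
      unfolding aff_def mu4_O_def by (subst (asm) pt_eq_iff) (auto simp: vec4_eq_iff)
    then show False by (simp add: vec4_eq_iff)
  qed
  then show "mu4_O c \<noteq> aff u y" by metis
qed

lemma fps_mult_inverse: "fps_nth (g::'a fps) 0 \<noteq> 0 \<Longrightarrow> g * inverse g = 1"
  by (simp add: inverse_mult_eq_1')

text \<open>The normal form of points, carried out over power series with \<open>X2\<close> a unit.
  The tangent condition becomes the order conditions of \<open>achart\<close>.\<close>

lemma mu4_eqs_fps_normal:
  fixes x :: "'a fps ^ 4"
  assumes "mu4_eqs (fps_const c) x" "fps_nth (x $ 2) 0 \<noteq> 0"
    "\<forall>a. fps_vec_nth x 1 \<noteq> a *s fps_vec_nth x 0"
  obtains u y where "achart (fps_nth u 0) (fps_nth y 0) u y" "x = x $ 2 *s cv u 1 y"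
proof -
  define g where "g = x $ 2"
  define i where "i = inverse g"
  have gi: "g * i = 1" using assms(2) by (simp add: g_def i_def fps_mult_inverse)
  define C where "C = fps_const c"
  have Ci: "C * fps_const (inverse c) = 1" using c0 by (simp add: C_def)
  define u where "u = (x $ 1 + x $ 3) * i * fps_const (inverse c)"
  define y where "y = x $ 1 * i"
  have g: "g \<noteq> 0" and C: "C \<noteq> 0" using gi Ci by auto
  have eqs: "(x $ 0 + g)\<^sup>2 = C\<^sup>2 * x $ 1 * x $ 3" "(x $ 1 + x $ 3)\<^sup>2 = C\<^sup>2 * x $ 0 * g"
    using assms(1) by (simp_all add: mu4_eqs_def g_def C_def)
  have "g * y = (g * i) * x $ 1" by (simp add: y_def mult_ac)
  then have 1: "x $ 1 = g * y" using gi by simp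
  have "C * g * u = (C * fps_const (inverse c)) * (g * i) * (x $ 1 + x $ 3)"
    by (simp only: u_def mult_ac)
  then have 13: "x $ 1 + x $ 3 = C * g * u" using gi Ci by simp
  then have 3: "x $ 3 = g * (y + C * u)"
    by (metis 1 ch2_fps(4) distrib_left mult.left_commute mult.assoc add.commute)
  have "C\<^sup>2 * g * (g * u\<^sup>2) = C\<^sup>2 * g * x $ 0"
    using eqs(2) unfolding 13 by (simp add: power2_eq_square mult_ac)
  then have 0: "x $ 0 = g * u\<^sup>2" using g C by simp
  have "g\<^sup>2 * (u\<^sup>2 + 1)\<^sup>2 = g\<^sup>2 * (C\<^sup>2 * y * (y + C * u))"
    using eqs(1) unfolding 0 1 3 by (simp add: power2_eq_square algebra_simps)
  then have eq: "(u\<^sup>2 + 1)\<^sup>2 = C\<^sup>2 * y * (y + C * u)" using g by simp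
  have "fps_const (c\<^sup>2 * d) = C\<^sup>2 * fps_const d" by (simp add: C_def fps_const_power)
  then have Cd: "C\<^sup>2 * fps_const d = 1" by (simp add: c_d)
  have "C\<^sup>2 * (fps_const d * (u ^ 4 + 1)) = C\<^sup>2 * fps_const d * (u\<^sup>2 + 1)\<^sup>2"
    unfolding fourth_power square_add_fps by simp
  also have "\<dots> = C\<^sup>2 * (y\<^sup>2 + C * u * y)" unfolding Cd eq
    by (simp add: power2_eq_square algebra_simps)
  finally have "fps_const d * (u ^ 4 + 1) = y\<^sup>2 + C * u * y" using C by simp
  then have "y\<^sup>2 = C * u * y + fps_const d * (u ^ 4 + 1)" by (rule ch2_move_fps[THEN iffD2])
  then have oc: "on_curve u 1 y" by (simp add: on_curve_def C_def)
  have x: "x = g *s cv u 1 y"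
    by (simp add: vec4_eq_iff cv_def 0 1 3 C_def flip: g_def)
  \<comment> \<open>Without linear terms in \<open>u\<close> and \<open>y\<close>, the linear term
    of \<open>x\<close> would be proportional to its constant term.\<close>
  have nz: "\<not> (fps_nth u 1 = 0 \<and> fps_nth y 1 = 0)"
  proof
    assume z: "fps_nth u 1 = 0 \<and> fps_nth y 1 = 0"
    have "fps_vec_nth x 1 = (fps_nth g 1 * inverse (fps_nth g 0)) *s fps_vec_nth x 0"
      unfolding x using z assms(2) square_nth(1)[of u]
      by (auto simp: fps_vec_nth_def vec4_eq_iff cv_def fps_mult_nth g_def)
    then show False using assms(3) by blast
  qed
  have ch: "achart (fps_nth u 0) (fps_nth y 0) u y"
  proof (cases "fps_nth u 0 = 0")
    case False
    then have "fps_nth u 1 \<noteq> 0" using on_curve_nth(2)[OF oc] nz by auto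
    then show ?thesis using False oc by (simp add: achart_def)
  next
    case True
    \<comment> \<open>At \<open>u = 0\<close> the linear relation removes the linear term of
      \<open>u\<close>, and the quadratic one ties its next coefficient to the square of the linear
      coefficient of \<open>y\<close>: the ramification index is exactly 2.\<close>
    have y0: "fps_nth y 0 \<noteq> 0" using on_curve_nth(1)[OF oc] c0 unfolding True aff_eq_0 by simp
    then have u1: "fps_nth u 1 = 0" using on_curve_nth(2)[OF oc] True by simp
    then have y1: "fps_nth y 1 \<noteq> 0" using nz by simp
    then have "fps_nth u 2 \<noteq> 0" using on_curve_nth(3)[OF oc True u1] by auto
    moreover have "fps_nth u i = 0" if "i < 2" for i
      using that True u1 by (auto simp: less_Suc_eq numeral_2_eq_2)
    ultimately have "subdegree u = 2" by (intro subdegreeI) auto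
    then show ?thesis using True oc y1 by (simp add: achart_def)
  qed
  show thesis using x unfolding g_def by (rule that[OF ch])
qed

lemma local_param_achart:
  assumes "achart u0 y0 u y"
  shows "local_param c (aff u0 y0) (cv u 1 y)"
proof -
  have 0: "fps_nth u 0 = u0" "fps_nth y 0 = y0" "on_curve u 1 y"
    using assms by (simp_all add: achart_def)
  have v0: "fps_vec_nth (cv u 1 y) 0 = vec4 (u0\<^sup>2) y0 1 (y0 + c * u0)"
    using 0 by (simp add: fps_vec_nth_def vec4_eq_iff cv_def power2_eq_square)
  have v1: "fps_vec_nth (cv u 1 y) 1 = vec4 0 (fps_nth y 1) 0 (fps_nth y 1 + c * fps_nth u 1)"
    using square_nth(1)[of u] by (simp add: fps_vec_nth_def vec4_eq_iff cv_def)
  have nz: "\<not> (fps_nth u 1 = 0 \<and> fps_nth y 1 = 0)"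
    using assms by (auto simp: achart_def split: if_splits)
  show ?thesis unfolding local_param_def v0 v1 aff_def
    using mu4_eqs_cv[OF 0(3)] nz c0 by (auto simp: vec4_eq_iff)
qed

lemma local_param_ochart:
  assumes "ochart w y"
  shows "local_param c (mu4_O c) (cv 1 w y)"
proof -
  have 0: "fps_nth w 0 = 0" "fps_nth y 0 = inverse c" "on_curve 1 w y" "fps_nth y 1 \<noteq> 0"
    using assms subdegree_2[of w] by (metis ochart_def)+
  have v0: "fps_vec_nth (cv 1 w y) 0 = vec4 1 (inverse c) 0 (inverse c)"
    using 0 by (simp add: fps_vec_nth_def vec4_eq_iff cv_def power2_eq_square)
  have v1: "fps_nth (cv 1 w y $ 0) 1 = 0" "fps_nth (cv 1 w y $ 1) 1 \<noteq> 0"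
    using 0 by (simp_all add: cv_def)
  have "pt (vec4 1 (inverse c) 0 (inverse c)) = mu4_O c"
    unfolding mu4_O_def using c0
    by (subst pt_eq_iff) (auto simp: vec4_eq_iff intro!: exI[of _ c])
  moreover have "fps_vec_nth (cv 1 w y) 1 \<noteq> a *s fps_vec_nth (cv 1 w y) 0" for a
  proof
    assume e: "fps_vec_nth (cv 1 w y) 1 = a *s fps_vec_nth (cv 1 w y) 0"
    have "fps_vec_nth (cv 1 w y) 1 $ 0 = a" "fps_vec_nth (cv 1 w y) 1 $ 1 = a * inverse c"
      unfolding e v0 by simp_all
    then show False using v1 by (simp add: fps_vec_nth_def)
  qed
  moreover have "vec4 1 (inverse c) 0 (inverse c) \<noteq> 0" by (simp add: vec4_eq_iff)
  ultimately show ?thesis unfolding local_param_def using mu4_eqs_cv[OF 0(3)]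
    by (simp add: v0)
qed

text \<open>\<open>g\<close> is a unit, so rescaling homogeneous coordinates preserves
  orders.\<close>

lemma subdegree_form_eval_scale:
  assumes "fps_nth (g::'a fps) 0 \<noteq> 0"
  shows "subdegree (form_eval fps_const e F (g *s x)) = subdegree (form_eval fps_const e F x)"
proof (cases "form_eval fps_const e F x = 0")
  case False
  have "g \<noteq> 0" "subdegree g = 0" using assms by auto
  then show ?thesis using False by (simp add: form_eval_scale)
qed (simp add: form_eval_scale)

text \<open>
  Whatever local parametrization is chosen in the definition of \<open>form_ord\<close>, it is a unit multiple of
  a chart, so its independence of the choice is not an issue.
\<close>

lemma form_ord_aff:
  assumes "aff_eq u0 y0"
  obtains u y where "achart u0 y0 u y"
    "\<And>e F. form_ord c e F (aff u0 y0) = subdegree (form_eval fps_const e F (cv u 1 y))"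
proof -
  define x where "x = (SOME x. local_param c (aff u0 y0) x)"
  obtain u1 y1 where "achart u0 y0 u1 y1" by (rule achart_exists[OF assms])
  then have lp: "local_param c (aff u0 y0) x" unfolding x_def
    by (rule someI[of "local_param c (aff u0 y0)", OF local_param_achart])
  then have pt0: "fps_vec_nth x 0 \<noteq> 0" "pt (fps_vec_nth x 0) = pt (vec4 (u0\<^sup>2) y0 1 (y0 + c * u0))"
    by (simp_all add: local_param_def aff_def)
  then obtain a where "a \<noteq> 0" "vec4 (u0\<^sup>2) y0 1 (y0 + c * u0) = a *s fps_vec_nth x 0"
    by (subst (asm) pt_eq_iff) (auto simp: vec4_eq_iff)
  then have x2: "fps_nth (x $ 2) 0 \<noteq> 0" by (auto simp: vec4_eq_iff fps_vec_nth_def)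
  obtain u y where uy: "achart (fps_nth u 0) (fps_nth y 0) u y" "x = x $ 2 *s cv u 1 y"
    by (rule mu4_eqs_fps_normal[OF _ x2]) (use lp in \<open>auto simp: local_param_def\<close>)
  have e: "fps_vec_nth x 0 = fps_nth (x $ 2) 0 *s
      vec4 ((fps_nth u 0)\<^sup>2) (fps_nth y 0) 1 (fps_nth y 0 + c * fps_nth u 0)"
    by (subst uy(2)) (simp add: fps_vec_nth_def vec4_eq_iff cv_def power2_eq_square)
  have "aff (fps_nth u 0) (fps_nth y 0) = pt (fps_vec_nth x 0)"
    unfolding aff_def using e x2 pt0(1) by (subst pt_eq_iff) (auto simp: vec4_eq_iff)
  also have "\<dots> = aff u0 y0" using pt0 by (simp add: aff_def)
  finally have "achart u0 y0 u y" using uy(1) by (simp add: aff_inj)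
  moreover have "form_ord c e F (aff u0 y0) = subdegree (form_eval fps_const e F (cv u 1 y))" for e F
    unfolding form_ord_def x_def[symmetric]
    by (subst uy(2), rule subdegree_form_eval_scale[OF x2])
  ultimately show thesis by (rule that)
qed

lemma form_ord_O:
  obtains w y where "ochart w y"
    "\<And>e F. form_ord c e F (mu4_O c) = subdegree (form_eval fps_const e F (cv 1 w y))"
proof -
  define x where "x = (SOME x. local_param c (mu4_O c) x)"
  obtain w1 y1 where "achart 0 (inverse c) w1 y1" using achart_exists aff_eq_0 by metis
  then have "ochart w1 y1" by (simp add: ochart_iff)
  then have lp: "local_param c (mu4_O c) x" unfolding x_def
    by (rule someI[of "local_param c (mu4_O c)", OF local_param_ochart])
  then have pt0: "fps_vec_nth x 0 \<noteq> 0" "pt (fps_vec_nth x 0) = pt (vec4 c 1 0 1)"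
    by (simp_all add: local_param_def mu4_O_def)
  then obtain a where a: "a \<noteq> 0" "vec4 c 1 0 1 = a *s fps_vec_nth x 0"
    by (subst (asm) pt_eq_iff) (auto simp: vec4_eq_iff)
  then have x0: "fps_nth (x $ 0) 0 \<noteq> 0" and x2: "fps_nth (x $ 2) 0 = 0"
    using c0 by (auto simp: vec4_eq_iff fps_vec_nth_def)
  \<comment> \<open>Exchanging \<open>X0\<close> and \<open>X2\<close> preserves both equations and
    moves O into the affine part, where the normal form applies.\<close>
  define x' where "x' = vec4 (x $ 2) (x $ 1) (x $ 0) (x $ 3)"
  have x'2: "x' $ 2 = x $ 0" by (simp add: x'_def)
  obtain w y where wy: "achart (fps_nth w 0) (fps_nth y 0) w y" "x' = x' $ 2 *s cv w 1 y"
  proof (rule mu4_eqs_fps_normal)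
    show "mu4_eqs (fps_const c) x'" using lp
      by (simp add: local_param_def mu4_eqs_def x'_def add.commute mult_ac)
    show "fps_nth (x' $ 2) 0 \<noteq> 0" using x0 by (simp add: x'_def)
    show "\<forall>a. fps_vec_nth x' 1 \<noteq> a *s fps_vec_nth x' 0"
      using lp by (auto simp: local_param_def x'_def vec4_eq_iff fps_vec_nth_def)
  qed
  have "x' $ 0 = x $ 0 * w\<^sup>2" by (subst wy(2)) (simp add: x'2 cv_def)
  then have "fps_nth (x $ 2) 0 = fps_nth (x $ 0 * w\<^sup>2) 0" by (simp add: x'_def)
  then have w0: "fps_nth w 0 = 0" using x0 x2 by (auto simp: power2_eq_square)
  have "on_curve w 1 y" using wy(1) by (simp add: achart_def)
  then have "fps_nth y 0 = inverse c" using on_curve_nth(1) w0 aff_eq_0 by metis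
  then have oc: "ochart w y" using wy(1) w0 by (simp add: ochart_iff)
  have "x = x $ 0 *s cv 1 w y"
    using wy(2) by (simp add: vec4_eq_iff x'_def cv_def mult_ac)
  then have "form_ord c e F (mu4_O c) = subdegree (form_eval fps_const e F (cv 1 w y))" for e F
    unfolding form_ord_def x_def[symmetric]
    using subdegree_form_eval_scale[OF x0] by metis
  with oc show thesis by (rule that)
qed

end

section \<open>Principal divisors\<close>

lemma fps_prod_nth_0: "fps_nth (prod f A) 0 = (\<Prod>i\<in>A. fps_nth (f i) 0)"
  by (induction A rule: infinite_finite_induct) simp_all

lemma form_eval_nth_0:
  "fps_nth (form_eval fps_const e F x) 0 = form_eval id e F (fps_vec_nth x 0)"
  by (simp add: form_eval_def fps_sum_nth fps_prod_nth_0 fps_power_zeroth fps_vec_nth_def)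

context mu4
begin

lemma aff_eq_exists: obtains y where "aff_eq u y"
proof -
  have "\<exists>y. poly [:- (d * (u ^ 4 + 1)), - (c * u), 1:] y = 0"
    by (rule alg_closed_imp_poly_has_root) simp
  then obtain y where "poly [:- (d * (u ^ 4 + 1)), - (c * u), 1:] y = 0" by blast
  then have "aff_eq u y" by (simp add: aff_eq_def power2_eq_square algebra_simps)
  then show thesis by (rule that)
qed

lemma aff_eq_conj: "aff_eq u y \<Longrightarrow> aff_eq u (y + c * u)"
  unfolding aff_eq_def square_add by (simp add: power2_eq_square algebra_simps)

text \<open>A nonconstant polynomial over an algebraically closed field even takes the value
  1.\<close>

lemma poly_nonzero_value:
  assumes "p \<noteq> (0 :: 'a poly)"
  obtains u where "poly p u \<noteq> 0"
proof (cases "degree p = 0")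
  case True
  then obtain k where "p = [:k:]" by (rule degree_eq_zeroE)
  then show ?thesis using that[of 0] assms by simp
next
  case False
  then have "degree (p + [:- 1:]) > 0" by (subst degree_add_eq_left) auto
  then obtain u where "poly (p + [:- 1:]) u = 0" using alg_closed_imp_poly_has_root by blast
  then show ?thesis using that[of u] by auto
qed

text \<open>Constant series satisfy \<open>on_curve\<close> too, so the pair attached to a form also
  computes its values at points.\<close>

lemma form_eval_aff:
  assumes "wf_pair (2 * e) A B"
    "\<And>a b y. on_curve a b y \<Longrightarrow> form_eval fps_const e F (cv a b y) = wev (2 * e) A B a b y"
    "aff_eq u y"
  shows "form_eval id e F (vec4 (u\<^sup>2) y 1 (y + c * u)) = poly A u + y * poly B u"
proof -
  let ?u = "fps_const u" and ?y = "fps_const y"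
  have "on_curve ?u 1 ?y"
    using assms(3) by (simp add: on_curve_def aff_eq_def fps_const_power)
  then have e: "form_eval fps_const e F (cv ?u 1 ?y) = paev A B ?u ?y"
    using assms(1,2) by (simp add: wev_eq_paev)
  have "fps_vec_nth (cv ?u 1 ?y) 0 = vec4 (u\<^sup>2) y 1 (y + c * u)"
    by (simp add: fps_vec_nth_def cv_def vec4_eq_iff fps_const_power)
  then have "form_eval id e F (vec4 (u\<^sup>2) y 1 (y + c * u)) = fps_nth (paev A B ?u ?y) 0"
    unfolding e[symmetric] form_eval_nth_0 by simp
  also have "\<dots> = poly A u + y * poly B u" by (simp add: paev_def)
  finally show ?thesis .
qed

text \<open>Every vector on the cone is a multiple of the constant term of some
  \<open>cv a b y\<close>, so a zero pair means a form vanishing on the curve. Conversely, where the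
  norm is nonzero, \<open>A + y B\<close> is nonzero at the points above.\<close>

lemma form_nonzero_on_iff:
  assumes "wf_pair (2 * e) A B"
    "\<And>a b y. on_curve a b y \<Longrightarrow> form_eval fps_const e F (cv a b y) = wev (2 * e) A B a b y"
  shows "form_nonzero_on c e F \<longleftrightarrow> \<not> (A = 0 \<and> B = 0)"
proof
  assume "form_nonzero_on c e F"
  then obtain x where x: "x \<noteq> 0" "mu4_eqs c x" "form_eval id e F x \<noteq> 0"
    by (auto simp: form_nonzero_on_def)
  then have "pt x \<in> mu4_curve c" by (auto simp: mu4_curve_def)
  then have "\<exists>a b y g. on_curve a b y \<and> x = g *s fps_vec_nth (cv a b y) 0"
  proof (cases rule: mu4_curve_cases)
    case 1
    then obtain a where a: "vec4 c 1 0 1 = a *s x" "a \<noteq> 0"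
      unfolding mu4_O_def using x(1) by (subst (asm) pt_eq_iff) (auto simp: vec4_eq_iff)
    have "on_curve 1 0 (fps_const (inverse c))"
      by (simp add: on_curve_def d_eq fps_const_power)
    moreover have "inverse a *s vec4 c 1 0 1 = x"
      unfolding a(1) using a(2) by (simp add: vec4_eq_iff)
    moreover have "(c * inverse a) *s fps_vec_nth (cv 1 0 (fps_const (inverse c))) 0
        = inverse a *s vec4 c 1 0 1"
      using c0 by (simp add: fps_vec_nth_def cv_def vec4_eq_iff)
    ultimately have "on_curve 1 0 (fps_const (inverse c)) \<and>
        x = (c * inverse a) *s fps_vec_nth (cv 1 0 (fps_const (inverse c))) 0" by metis
    then show ?thesis by blast
  next
    case (2 u y)
    then obtain a where a: "vec4 (u\<^sup>2) y 1 (y + c * u) = a *s x" "a \<noteq> 0"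
      unfolding aff_def using x(1) by (subst (asm) pt_eq_iff) (auto simp: vec4_eq_iff)
    have "on_curve (fps_const u) 1 (fps_const y)"
      using 2(1) by (simp add: on_curve_def aff_eq_def fps_const_power)
    moreover have "inverse a *s vec4 (u\<^sup>2) y 1 (y + c * u) = x"
      unfolding a(1) using a(2) by (simp add: vec4_eq_iff)
    then have "x = inverse a *s fps_vec_nth (cv (fps_const u) 1 (fps_const y)) 0"
      by (auto simp: fps_vec_nth_def cv_def vec4_eq_iff fps_const_power)
    ultimately show ?thesis by blast
  qed
  then obtain a b y g where *: "on_curve a b y" "x = g *s fps_vec_nth (cv a b y) 0" by blast
  show "\<not> (A = 0 \<and> B = 0)"
  proof
    assume "A = 0 \<and> B = 0"
    then have "form_eval fps_const e F (cv a b y) = 0" using assms(2)[OF *(1)] by (simp add: wev_def)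
    then have "form_eval id e F (fps_vec_nth (cv a b y) 0) = 0"
      by (metis form_eval_nth_0 fps_zero_nth)
    then show False using x(3) unfolding *(2) form_eval_scale by simp
  qed
next
  assume "\<not> (A = 0 \<and> B = 0)"
  then have "norm_poly A B \<noteq> 0" using norm_poly_eq_0 by blast
  then obtain u where u: "poly (norm_poly A B) u \<noteq> 0" by (rule poly_nonzero_value)
  obtain y where y: "aff_eq u y" by (rule aff_eq_exists)
  have "poly A u + y * poly B u \<noteq> 0"
  proof
    assume 0: "poly A u + y * poly B u = 0"
    then have A: "poly A u = y * poly B u" by (metis add_eq_0_iff2 ch2(1))
    have "poly (norm_poly A B) u
        = (poly A u)\<^sup>2 + c * u * poly A u * poly B u + d * (u ^ 4 + 1) * (poly B u)\<^sup>2"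
      unfolding norm_poly_def by (simp add: algebra_simps numeral_eq_Suc)
    also have "\<dots> = (y\<^sup>2 + (c * u * y + d * (u ^ 4 + 1))) * (poly B u)\<^sup>2"
      unfolding A by (simp add: algebra_simps power2_eq_square)
    also have "\<dots> = 0" using y unfolding aff_eq_def by (simp only: ch2 mult_zero_left)
    finally show False using u by simp
  qed
  then have "form_eval id e F (vec4 (u\<^sup>2) y 1 (y + c * u)) \<noteq> 0"
    using form_eval_aff[OF assms y] by simp
  moreover have "vec4 (u\<^sup>2) y 1 (y + c * u) \<noteq> 0" by (simp add: vec4_eq_iff)
  ultimately show "form_nonzero_on c e F"
    unfolding form_nonzero_on_def using mu4_eqs_aff[OF y] by blast
qed

text \<open>Ensures that \<open>form_ord\<close> is a true order and not the default value 0 of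
  \<open>subdegree\<close> at the zero series.\<close>

lemma form_nonzero_expansion:
  assumes "form_nonzero_on c e F"
  shows "achart u0 y0 u y \<Longrightarrow> form_eval fps_const e F (cv u 1 y) \<noteq> 0"
    "ochart w y \<Longrightarrow> form_eval fps_const e F (cv 1 w y) \<noteq> 0"
proof -
  obtain A B where AB: "wf_pair (2 * e) A B"
    "\<And>a b y. on_curve a b y \<Longrightarrow> form_eval fps_const e F (cv a b y) = wev (2 * e) A B a b y"
    using form_weighted by blast
  then have nz: "\<not> (A = 0 \<and> B = 0)" using assms form_nonzero_on_iff by blast
  show "form_eval fps_const e F (cv u 1 y) \<noteq> 0" if "achart u0 y0 u y"
    using paev_nonzero[OF that nz] AB that by (simp add: achart_def wev_eq_paev)
  show "form_eval fps_const e F (cv 1 w y) \<noteq> 0" if "ochart w y"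
    using ochart_nonzero[OF that AB(1) nz] AB(2) that by (simp add: ochart_def)
qed

text \<open>Tested on expansions at O, which lie in an integral domain.\<close>

lemma form_nonzero_mult:
  assumes "form_nonzero_on c e F" "form_nonzero_on c e' G"
  shows "form_nonzero_on c (e + e') (form_mult e e' F G)"
proof -
  obtain A B where AB: "wf_pair (2 * (e + e')) A B"
    "\<And>a b y. on_curve a b y \<Longrightarrow>
      form_eval fps_const (e + e') (form_mult e e' F G) (cv a b y) = wev (2 * (e + e')) A B a b y"
    using form_weighted by blast
  obtain w y where wy: "ochart w y" by (rule form_ord_O)
  have "wev (2 * (e + e')) A B 1 w y
      = form_eval fps_const e F (cv 1 w y) * form_eval fps_const e' G (cv 1 w y)"
    unfolding coeff_hom.form_eval_mult[OF coeff_hom_fps_const, symmetric]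
    using wy by (intro AB(2)[symmetric]) (simp add: ochart_def)
  also have "\<dots> \<noteq> 0" using form_nonzero_expansion(2)[OF _ wy] assms by simp
  finally have "\<not> (A = 0 \<and> B = 0)" by (auto simp: wev_def)
  then show ?thesis using form_nonzero_on_iff[OF AB] by blast
qed

lemma form_ord_mult:
  assumes "form_nonzero_on c e F" "form_nonzero_on c e' G" "P \<in> mu4_curve c"
  shows "form_ord c (e + e') (form_mult e e' F G) P = form_ord c e F P + form_ord c e' G P"
  using assms(3)
proof (cases rule: mu4_curve_cases)
  case 1
  obtain w y where *: "ochart w y"
    "\<And>e F. form_ord c e F (mu4_O c) = subdegree (form_eval fps_const e F (cv 1 w y))"
    using form_ord_O by blast
  show ?thesis unfolding 1 *(2) coeff_hom.form_eval_mult[OF coeff_hom_fps_const]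
    by (rule subdegree_mult) (use form_nonzero_expansion(2)[OF _ *(1)] assms in auto)
next
  case (2 u0 y0)
  obtain u y where *: "achart u0 y0 u y"
    "\<And>e F. form_ord c e F (aff u0 y0) = subdegree (form_eval fps_const e F (cv u 1 y))"
    using form_ord_aff[OF 2(1)] by blast
  show ?thesis unfolding 2(2) *(2) coeff_hom.form_eval_mult[OF coeff_hom_fps_const]
    by (rule subdegree_mult) (use form_nonzero_expansion(1)[OF _ *(1)] assms in auto)
qed

lemma principal_add:
  assumes "principal c D" "principal c E"
  shows "principal c (\<lambda>P. D P + E P)"
proof -
  obtain e F G where 1: "form_nonzero_on c e F" "form_nonzero_on c e G"
    "\<forall>P\<in>mu4_curve c. D P = int (form_ord c e F P) - int (form_ord c e G P)"
    using assms(1) by (auto simp: principal_def)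
  obtain e' F' G' where 2: "form_nonzero_on c e' F'" "form_nonzero_on c e' G'"
    "\<forall>P\<in>mu4_curve c. E P = int (form_ord c e' F' P) - int (form_ord c e' G' P)"
    using assms(2) by (auto simp: principal_def)
  show ?thesis unfolding principal_def
    by (rule exI[of _ "e + e'"], rule exI[of _ "form_mult e e' F F'"],
        rule exI[of _ "form_mult e e' G G'"])
      (auto simp: form_nonzero_mult form_ord_mult 1 2)
qed

lemma principal_uminus: "principal c D \<Longrightarrow> principal c (\<lambda>P. - D P)"
  unfolding principal_def by (metis minus_diff_eq)

lemma principal_diff: "principal c D \<Longrightarrow> principal c E \<Longrightarrow> principal c (\<lambda>P. D P - E P)"
  using principal_add[of D "\<lambda>P. - E P"] principal_uminus[of E] by simp

text \<open>One root \<open>a\<close> of \<open>p\<close> is removed at a time. For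
  \<open>a \<noteq> 0\<close>, vanishing at the two conjugate points above \<open>a\<close> gives
  \<open>A(a) = B(a) = 0\<close>. For \<open>a = 0\<close> there is a single point, but the order
  there is at least 2, and the coefficients of degrees 0 and 1 give the same.\<close>

lemma principal_cancel:
  assumes "p \<noteq> 0" "\<not> (A = 0 \<and> B = 0)"
    "\<And>u0 y0. aff_eq u0 y0 \<Longrightarrow>
      \<exists>u y. achart u0 y0 u y \<and> subdegree (aev p u) \<le> subdegree (paev A B u y)"
  shows "p dvd A \<and> p dvd B"
  using assms
proof (induction "degree p" arbitrary: p A B)
  case 0
  then have "is_unit p" using is_unit_iff_degree[of p] by simp
  then show ?case by (simp add: unit_imp_dvd)
next
  case (Suc n)
  obtain a where a: "poly p a = 0" using alg_closed_imp_poly_has_root[of p] Suc.hyps(2) by auto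
  then obtain p1 where p1: "p = [:- a, 1:] * p1" by (auto simp: poly_eq_0_iff_dvd elim: dvdE)
  have p1nz: "p1 \<noteq> 0" using p1 Suc.prems(1) by auto
  have ord: "order a p \<ge> 1" using a Suc.prems(1) by (simp add: order_root Suc_le_eq)
  have low: "fps_nth (paev A B u y) i = 0"
    if "achart a y0 u y" "subdegree (aev p u) \<le> subdegree (paev A B u y)"
      "i < (if a = 0 then 2 else 1)" for u y y0 i
  proof (rule nth_less_subdegree_zero)
    have "i < order a p * (if a = 0 then 2 else 1)" using that(3) ord
      by (auto split: if_splits intro: less_le_trans)
    then show "i < subdegree (paev A B u y)"
      using achart_aev(2)[OF that(1) Suc.prems(1)] that(2) by linarith
  qed
  have AB: "poly A a = 0 \<and> poly B a = 0"
  proof (cases "a = 0")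
    case False
    have *: "poly A a + y0 * poly B a = 0" if y0: "aff_eq a y0" for y0
    proof -
      obtain u y where uy: "achart a y0 u y" "subdegree (aev p u) \<le> subdegree (paev A B u y)"
        using Suc.prems(3)[OF y0] by blast
      have "fps_nth (paev A B u y) 0 = 0" by (rule low[OF uy]) simp
      then show ?thesis using uy(1) by (simp add: paev_def achart_def)
    qed
    obtain y0 where y0: "aff_eq a y0" by (rule aff_eq_exists)
    have "poly A a + y0 * poly B a + c * a * poly B a = 0"
      using *[OF aff_eq_conj[OF y0]] by (simp add: algebra_simps)
    then have "poly B a = 0" using *[OF y0] False c0 by simp
    then show ?thesis using *[OF y0] by simp
  next
    case True
    obtain y0 where y0: "aff_eq a y0" by (rule aff_eq_exists)
    obtain u y where uy: "achart a y0 u y" "subdegree (aev p u) \<le> subdegree (paev A B u y)"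
      using Suc.prems(3)[OF y0] by blast
    have "subdegree u = 2" and y1: "fps_nth y 1 \<noteq> 0" using uy(1) True by (auto simp: achart_def)
    from this(1) have u: "fps_nth u 0 = 0" "fps_nth u 1 = 0" by (rule subdegree_2)+
    have nth1: "fps_nth (aev q u) 1 = 0" for q
      using u by (cases q) (simp add: fps_mult_nth)
    have "fps_nth (paev A B u y) 1 = 0" by (rule low[OF uy]) (simp add: True)
    then have "fps_nth y 1 * poly B 0 = 0" using u nth1
      by (simp add: paev_def fps_mult_nth)
    then have B: "poly B 0 = 0" using y1 by simp
    have "fps_nth (paev A B u y) 0 = 0" by (rule low[OF uy]) (simp add: True)
    then have "poly A 0 = 0" using B u by (simp add: paev_def)
    then show ?thesis using B True by simp
  qed
  obtain A1 where A1: "A = [:- a, 1:] * A1" using AB by (auto simp: poly_eq_0_iff_dvd elim: dvdE)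
  obtain B1 where B1: "B = [:- a, 1:] * B1" using AB by (auto simp: poly_eq_0_iff_dvd elim: dvdE)
  have nz: "\<not> (A1 = 0 \<and> B1 = 0)" using Suc.prems(2) A1 B1 by auto
  have "p1 dvd A1 \<and> p1 dvd B1"
  proof (rule Suc.hyps(1))
    have "degree p = 1 + degree p1" unfolding p1 using p1nz by (subst degree_mult_eq) auto
    then show "n = degree p1" using Suc.hyps(2) by simp
    fix u0 y0 assume "aff_eq u0 y0"
    then obtain u y where uy: "achart u0 y0 u y" "subdegree (aev p u) \<le> subdegree (paev A B u y)"
      using Suc.prems(3) by blast
    define l where "l = aev [:- a, 1:] u"
    have l: "l \<noteq> 0" unfolding l_def by (rule achart_aev(1)[OF uy(1)]) simp
    have "aev p u = l * aev p1 u" "paev A B u y = l * paev A1 B1 u y"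
      unfolding p1 A1 B1 paev_def l_def aev_mult by (simp_all add: algebra_simps del: aev_pCons)
    then have "subdegree (aev p1 u) \<le> subdegree (paev A1 B1 u y)"
      using uy(2) l achart_aev(1)[OF uy(1) p1nz] paev_nonzero[OF uy(1) nz] by simp
    then show "\<exists>u y. achart u0 y0 u y \<and> subdegree (aev p1 u) \<le> subdegree (paev A1 B1 u y)"
      using uy(1) by blast
  qed (fact p1nz nz)+
  then show ?case unfolding p1 A1 B1 by (intro conjI mult_dvd_mono) auto
qed

text \<open>Each unit of weight is traded for a factor \<open>w\<close>, that is, for two orders of
  vanishing at O.\<close>

lemma ochart_descend:
  assumes "ochart w y" "wf_pair (k + n) A B" "\<not> (A = 0 \<and> B = 0)"
    "2 * k \<le> subdegree (wev (k + n) A B 1 w y)"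
  shows "wf_pair n A B"
  using assms(2,4)
proof (induction k)
  case (Suc k)
  have "subdegree w = 2" "w \<noteq> 0" using assms(1) by (auto simp: ochart_def)
  have "fps_nth (wev (Suc (k + n)) A B 1 w y) 0 = 0" "fps_nth (wev (Suc (k + n)) A B 1 w y) 1 = 0"
    using Suc.prems(2) by (auto intro!: nth_less_subdegree_zero)
  note step = ochart_step[OF assms(1) _ this]
  have wf: "wf_pair (k + n) A B" using step Suc.prems(1) by simp
  have "wev (k + n) A B 1 w y \<noteq> 0" by (rule ochart_nonzero[OF assms(1) wf assms(3)])
  then have "2 * k \<le> subdegree (wev (k + n) A B 1 w y)"
    using step(2) Suc.prems \<open>w \<noteq> 0\<close> \<open>subdegree w = 2\<close> by simp
  then show ?case using Suc.IH wf by simp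
qed simp

text \<open>The map \<open>[-1]\<close> in coordinates: exchanging \<open>X1\<close> and
  \<open>X3\<close> sends \<open>y\<close> to \<open>y + c u\<close>. It is identified with
  \<open>mu4_neg\<close> once sums are known to be well defined.\<close>

definition opp :: "('a, 4) proj \<Rightarrow> ('a, 4) proj \<Rightarrow> bool" where
  "opp P Q \<longleftrightarrow> P = mu4_O c \<and> Q = mu4_O c \<or> (\<exists>u y. aff_eq u y \<and> P = aff u y \<and> Q = aff u (y + c * u))"

lemma principal_two:
  assumes "P \<in> mu4_curve c" "Q \<in> mu4_curve c"
    "principal c (\<lambda>T. pt_div P T + pt_div Q T - 2 * pt_div (mu4_O c) T)"
  shows "opp P Q"
proof -
  obtain e F G where FG: "form_nonzero_on c e F" "form_nonzero_on c e G"
    "\<And>T. T \<in> mu4_curve c \<Longrightarrow> pt_div P T + pt_div Q T - 2 * pt_div (mu4_O c) T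
      = int (form_ord c e F T) - int (form_ord c e G T)"
    using assms(3) unfolding principal_def by blast
  obtain A1 B1 where F: "wf_pair (2 * e) A1 B1"
    "\<And>a b y. on_curve a b y \<Longrightarrow> form_eval fps_const e F (cv a b y) = wev (2 * e) A1 B1 a b y"
    using form_weighted by blast
  obtain A2 B2 where G: "wf_pair (2 * e) A2 B2"
    "\<And>a b y. on_curve a b y \<Longrightarrow> form_eval fps_const e G (cv a b y) = wev (2 * e) A2 B2 a b y"
    using form_weighted by blast
  have nz1: "\<not> (A1 = 0 \<and> B1 = 0)" and nz2: "\<not> (A2 = 0 \<and> B2 = 0)"
    using FG form_nonzero_on_iff[OF F] form_nonzero_on_iff[OF G] by blast+
  \<comment> \<open>\<open>(A3, B2)\<close> is the conjugate of \<open>G\<close>. Multiplying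
    \<open>F\<close> and \<open>G\<close> by it leaves \<open>A + y B\<close> over the polynomial
    \<open>p\<close>.\<close>
  define A3 where "A3 = A2 + cX * B2"
  have nz3: "\<not> (A3 = 0 \<and> B2 = 0)" using nz2 by (auto simp: A3_def)
  define p where "p = norm_poly A2 B2"
  define m where "m = 2 * e + 2 * e"
  have p: "p \<noteq> 0" "degree p \<le> m" and wf3: "wf_pair (2 * e) A3 B2"
    and Gp: "\<And>a b y. on_curve a b y \<Longrightarrow>
      wev (2 * e) A2 B2 a b y * wev (2 * e) A3 B2 a b y = hev m p a b"
    using norm_poly_mult[OF G(1)] nz2 norm_poly_eq_0 by (auto simp: p_def m_def A3_def)
  define A where "A = A1 * A3 + dR * (B1 * B2)"
  define B where "B = A1 * B2 + B1 * A3 + cX * (B1 * B2)"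
  have wf: "wf_pair m A B" unfolding A_def B_def m_def by (rule wev_mult(2)[OF F(1) wf3])
  have FA: "wev (2 * e) A1 B1 a b y * wev (2 * e) A3 B2 a b y = wev m A B a b y"
    if "on_curve a b y" for a b y
    unfolding A_def B_def m_def by (rule wev_mult(1)[OF F(1) wf3 that])
  have affine: "\<exists>u y. achart u0 y0 u y \<and> paev A B u y \<noteq> 0 \<and>
      int (subdegree (paev A B u y)) = int (subdegree (aev p u)) + pt_div P (aff u0 y0) + pt_div Q (aff u0 y0)"
    if uy0: "aff_eq u0 y0" for u0 y0
  proof -
    obtain u y where uy: "achart u0 y0 u y"
      "\<And>e F. form_ord c e F (aff u0 y0) = subdegree (form_eval fps_const e F (cv u 1 y))"
      using form_ord_aff[OF uy0] by blast
    have oc: "on_curve u 1 y" using uy(1) by (simp add: achart_def)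
    note pnz = paev_nonzero[OF uy(1) nz1] paev_nonzero[OF uy(1) nz2] paev_nonzero[OF uy(1) nz3]
    have 1: "paev A1 B1 u y * paev A3 B2 u y = paev A B u y"
      using FA[OF oc] F(1) wf3 wf by (simp add: wev_eq_paev)
    have 2: "paev A2 B2 u y * paev A3 B2 u y = aev p u"
      using Gp[OF oc] G(1) wf3 p(2) by (simp add: wev_eq_paev hev_eq_aev)
    have "pt_div P (aff u0 y0) + pt_div Q (aff u0 y0)
        = int (subdegree (paev A1 B1 u y)) - int (subdegree (paev A2 B2 u y))"
      using FG(3)[OF aff_in_curve[OF uy0]] F G oc
      by (simp add: uy(2) wev_eq_paev) (simp add: pt_div_def aff_not_O)
    moreover have "subdegree (paev A B u y) = subdegree (paev A1 B1 u y) + subdegree (paev A3 B2 u y)"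
      unfolding 1[symmetric] using pnz by simp
    moreover have "subdegree (aev p u) = subdegree (paev A2 B2 u y) + subdegree (paev A3 B2 u y)"
      unfolding 2[symmetric] using pnz by simp
    moreover have "paev A B u y \<noteq> 0" unfolding 1[symmetric] using pnz by simp
    ultimately show ?thesis using uy(1) by (intro exI[of _ u] exI[of _ y]) simp
  qed
  obtain w y where wy: "ochart w y"
    "\<And>e F. form_ord c e F (mu4_O c) = subdegree (form_eval fps_const e F (cv 1 w y))"
    using form_ord_O by blast
  have oc: "on_curve 1 w y" using wy(1) by (simp add: ochart_def)
  note wnz = ochart_nonzero[OF wy(1) F(1) nz1] ochart_nonzero[OF wy(1) G(1) nz2]
    ochart_nonzero[OF wy(1) wf3 nz3]
  have wAB: "wev m A B 1 w y \<noteq> 0" unfolding FA[OF oc, symmetric] using wnz by simp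
  then have nz: "\<not> (A = 0 \<and> B = 0)" by (auto simp: wev_def)
  have "subdegree w = 2" "w \<noteq> 0" using wy(1) by (auto simp: ochart_def)
  have "hev (degree p) p 1 w \<noteq> 0" "subdegree (hev (degree p) p 1 w) = 0"
    using hev_nth_infinity(1)[OF subdegree_2[OF \<open>subdegree w = 2\<close>], of "degree p" p] p(1)
    by (metis fps_zero_nth leading_coeff_0_iff, metis leading_coeff_0_iff subdegree_eq_0)
  moreover have "hev m p 1 w = w ^ (m - degree p) * hev (degree p) p 1 w"
    using hev_raise[of p "degree p" "m - degree p" 1 w] p(2) by simp
  ultimately have homp: "subdegree (hev m p 1 w) = 2 * (m - degree p)"
    using \<open>subdegree w = 2\<close> \<open>w \<noteq> 0\<close> by simp
  have "pt_div P (mu4_O c) + pt_div Q (mu4_O c) - 2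
      = int (subdegree (wev (2 * e) A1 B1 1 w y)) - int (subdegree (wev (2 * e) A2 B2 1 w y))"
    using FG(3)[OF O_in_curve] F(2) G(2) oc by (simp add: wy(2)) (simp add: pt_div_def)
  moreover have "0 \<le> pt_div P (mu4_O c)" "0 \<le> pt_div Q (mu4_O c)" by (simp_all add: pt_div_def)
  moreover have "subdegree (wev m A B 1 w y)
      = subdegree (wev (2 * e) A1 B1 1 w y) + subdegree (wev (2 * e) A3 B2 1 w y)"
    unfolding FA[OF oc, symmetric] using wnz by simp
  moreover have "subdegree (hev m p 1 w)
      = subdegree (wev (2 * e) A2 B2 1 w y) + subdegree (wev (2 * e) A3 B2 1 w y)"
    unfolding Gp[OF oc, symmetric] using wnz by simp
  \<comment> \<open>\<open>F / G\<close> has a pole of order at most 2 at O, while \<open>p\<close>,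
    homogenized in degree \<open>m\<close>, vanishes there to order
    \<open>2 * (m - degree p)\<close>.\<close>
  ultimately have infinity: "2 * (m - degree p) \<le> subdegree (wev m A B 1 w y) + 2"
    unfolding homp by linarith
  have wf1: "wf_pair (degree p + 1) A B"
  proof (cases "m = degree p")
    case True
    then show ?thesis using wf by (auto simp: wf_pair_def)
  next
    case False
    \<comment> \<open>One step fewer than \<open>m - degree p\<close>, because the possible pole of
      order 2 uses up one.\<close>
    define k where "k = m - degree p - 1"
    have k: "m = k + (degree p + 1)" using False p(2) by (simp add: k_def)
    show ?thesis
      by (rule ochart_descend[OF wy(1), of k]) (use wf nz infinity in \<open>simp_all add: k\<close>)
  qed
  have "p dvd A \<and> p dvd B"
  proof (rule principal_cancel[OF p(1) nz])
    fix u0 y0 assume "aff_eq u0 y0"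
    from affine[OF this] obtain u y where "achart u0 y0 u y"
      "int (subdegree (paev A B u y)) = int (subdegree (aev p u)) + pt_div P (aff u0 y0) + pt_div Q (aff u0 y0)"
      by blast
    moreover have "0 \<le> pt_div P (aff u0 y0)" "0 \<le> pt_div Q (aff u0 y0)" by (simp_all add: pt_div_def)
    ultimately show "\<exists>u y. achart u0 y0 u y \<and> subdegree (aev p u) \<le> subdegree (paev A B u y)"
      by (intro exI[of _ u] exI[of _ y]) linarith
  qed
  then obtain A' B' where A': "A = p * A'" and B': "B = p * B'" by (auto elim!: dvdE)
  \<comment> \<open>The weight bound gives \<open>degree B + 2 \<le> degree p + 1\<close>, too small
    for a nonzero multiple of \<open>p\<close>.\<close>
  have B0: "B = 0"
  proof (rule ccontr)
    assume "B \<noteq> 0"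
    then have "degree B = degree p + degree B'" using B' p(1) by (auto simp: degree_mult_eq)
    then show False using wf1 \<open>B \<noteq> 0\<close> by (simp add: wf_pair_def)
  qed
  then have "A' \<noteq> 0" using nz A' by auto
  then have "degree A = degree p + degree A'" using A' p(1) by (auto simp: degree_mult_eq)
  then have degA': "degree A' \<le> 1" using wf1 by (simp add: wf_pair_def)
  \<comment> \<open>\<open>F / G\<close> has become the polynomial \<open>A'\<close> in
    \<open>u\<close>, whose roots count with the ramification index.\<close>
  have ord: "int (order u0 A' * (if u0 = 0 then 2 else 1)) = pt_div P (aff u0 y0) + pt_div Q (aff u0 y0)"
    if uy0: "aff_eq u0 y0" for u0 y0
  proof -
    from affine[OF that] obtain u y where *: "achart u0 y0 u y"
      "int (subdegree (paev A B u y)) = int (subdegree (aev p u)) + pt_div P (aff u0 y0) + pt_div Q (aff u0 y0)"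
      by blast
    have "subdegree (paev A B u y) = subdegree (aev p u) + subdegree (aev A' u)"
      unfolding B0 A' paev_def using achart_aev(1)[OF *(1)] p(1) \<open>A' \<noteq> 0\<close> by simp
    then show ?thesis using *(2) achart_aev(2)[OF *(1) \<open>A' \<noteq> 0\<close>] by simp
  qed
  show "opp P Q"
  proof (cases "degree A' = 0")
    case True
    then have "order u0 A' = 0" for u0 using \<open>A' \<noteq> 0\<close> order_degree[of A' u0] by simp
    then have "P \<noteq> aff u0 y0 \<and> Q \<noteq> aff u0 y0" if "aff_eq u0 y0" for u0 y0
      using ord[OF that] by (auto simp: pt_div_def of_bool_def split: if_splits)
    then have "P = mu4_O c" "Q = mu4_O c" using assms(1,2) by (metis mu4_curve_cases)+
    then show ?thesis by (simp add: opp_def)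
  next
    case False
    then obtain r where r: "poly A' r = 0" using alg_closed_imp_poly_has_root by blast
    have "order r A' \<noteq> 0" using r \<open>A' \<noteq> 0\<close> by (simp add: order_root)
    then have o1: "order r A' = 1" using order_degree[OF \<open>A' \<noteq> 0\<close>, of r] degA' by linarith
    obtain y0 where y0: "aff_eq r y0" by (rule aff_eq_exists)
    have 1: "pt_div P (aff r y0) + pt_div Q (aff r y0) = (if r = 0 then 2 else 1)"
      using ord[OF y0] o1 by (simp split: if_splits)
    have 2: "pt_div P (aff r (y0 + c * r)) + pt_div Q (aff r (y0 + c * r)) = (if r = 0 then 2 else 1)"
      using ord[OF aff_eq_conj[OF y0]] o1 by (simp split: if_splits)
    have ne: "r \<noteq> 0 \<Longrightarrow> aff r y0 \<noteq> aff r (y0 + c * r)" using c0 by (simp add: aff_inj)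
    \<comment> \<open>Above the root \<open>r\<close> lie either two distinct simple zeros, which
      must be the two points, or the one double zero at \<open>r = 0\<close>.\<close>
    have "P = aff r y0 \<and> Q = aff r (y0 + c * r) \<or> Q = aff r y0 \<and> P = aff r (y0 + c * r)"
    proof (cases "r = 0")
      case True
      then show ?thesis using 1 by (auto simp: pt_div_def of_bool_def split: if_splits)
    next
      case False
      then show ?thesis using 1 2 ne by (auto simp: pt_div_def of_bool_def split: if_splits)
    qed
    then show ?thesis
    proof
      assume "Q = aff r y0 \<and> P = aff r (y0 + c * r)"
      moreover have "y0 = (y0 + c * r) + c * r" by (simp only: add.assoc ch2 add_0_right)
      ultimately show ?thesis unfolding opp_def using aff_eq_conj[OF y0] by metis
    qed (use y0 in \<open>auto simp: opp_def\<close>)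
  qed
qed

end

section \<open>The group law\<close>

context mu4
begin

section \<open>Divisors of plane sections\<close>

lemma form_eval_linear_cv:
  "form_eval fps_const 1 (linear_form (vec4 a0 a1 a2 a3)) (cv a b y)
    = fps_const a0 * a\<^sup>2 + fps_const a1 * y + fps_const a2 * b\<^sup>2
      + fps_const a3 * (y + fps_const c * a * b)"
  unfolding coeff_hom.form_eval_linear[OF coeff_hom_fps_const] sum_4 by (simp add: cv_def)

lemma form_eval_linear_id:
  "form_eval id 1 (linear_form (vec4 a0 a1 a2 a3)) (vec4 x0 x1 x2 x3)
    = a0 * x0 + a1 * x1 + a2 * x2 + a3 * x3"
  unfolding coeff_hom.form_eval_linear[OF coeff_hom_id] sum_4 by simp

lemma form_nonzero_onI:
  assumes "aff_eq u y" "form_eval id e F (vec4 (u\<^sup>2) y 1 (y + c * u)) \<noteq> 0"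
  shows "form_nonzero_on c e F"
  unfolding form_nonzero_on_def using mu4_eqs_aff[OF assms(1)] assms(2)
  by (intro exI[of _ "vec4 (u\<^sup>2) y 1 (y + c * u)"]) (simp add: vec4_eq_iff)

text \<open>The plane \<open>X2 = 0\<close> meets the curve only at O, with multiplicity 4; it is
  the common denominator below.\<close>

definition X2 :: "(4 \<Rightarrow> nat) \<Rightarrow> 'a" where "X2 = linear_form (vec4 0 0 1 0)"

lemma X2_nonzero: "form_nonzero_on c 1 X2"
proof -
  obtain y where "aff_eq 0 y" by (rule aff_eq_exists)
  then show ?thesis by (rule form_nonzero_onI) (simp only: X2_def form_eval_linear_id, simp)
qed

lemma form_eval_X2: "form_eval fps_const 1 X2 (cv a b y) = b\<^sup>2"
  unfolding X2_def form_eval_linear_cv by simp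

text \<open>\<open>D\<close> is the divisor of the plane section. It is required on every chart,
  since \<open>form_ord\<close> may choose any of them.\<close>

lemma principal_linear:
  assumes "form_nonzero_on c 1 L"
    "\<And>u0 y0 u y. aff_eq u0 y0 \<Longrightarrow> achart u0 y0 u y \<Longrightarrow>
      int (subdegree (form_eval fps_const 1 L (cv u 1 y))) = D (aff u0 y0)"
    "\<And>w y. ochart w y \<Longrightarrow> int (subdegree (form_eval fps_const 1 L (cv 1 w y))) = D (mu4_O c)"
  shows "principal c (\<lambda>T. D T - 4 * pt_div (mu4_O c) T)"
  unfolding principal_def
proof (intro exI conjI ballI)
  fix T assume "T \<in> mu4_curve c"
  then show "D T - 4 * pt_div (mu4_O c) T = int (form_ord c 1 L T) - int (form_ord c 1 X2 T)"
  proof (cases rule: mu4_curve_cases)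
    case 1
    obtain w y where wy: "ochart w y"
      "\<And>e F. form_ord c e F (mu4_O c) = subdegree (form_eval fps_const e F (cv 1 w y))"
      using form_ord_O by blast
    have "subdegree (w\<^sup>2) = 4" using wy(1) by (simp add: ochart_def)
    then show ?thesis unfolding 1 wy(2) form_eval_X2 assms(3)[OF wy(1)] by (simp add: pt_div_def)
  next
    case (2 u0 y0)
    obtain u y where uy: "achart u0 y0 u y"
      "\<And>e F. form_ord c e F (aff u0 y0) = subdegree (form_eval fps_const e F (cv u 1 y))"
      using form_ord_aff[OF 2(1)] by blast
    show ?thesis unfolding 2(2) uy(2) form_eval_X2 assms(2)[OF 2(1) uy(1)]
      by (simp add: pt_div_def aff_not_O)
  qed
qed (fact assms X2_nonzero)+

lemma subdegree_linear:
  assumes "achart u0 y0 u y"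
  shows "u + fps_const a \<noteq> 0"
    "subdegree (u + fps_const a) = (if u0 = a then if u0 = 0 then 2 else 1 else 0)"
proof -
  have u: "fps_nth u 0 = u0" using assms by (simp add: achart_def)
  have m: "u + fps_const a = u - fps_const a" by (simp only: ch2_fps)
  have "u + fps_const a \<noteq> 0 \<and>
    subdegree (u + fps_const a) = (if u0 = a then if u0 = 0 then 2 else 1 else 0)"
  proof (cases "u0 = a")
    case True
    then show ?thesis unfolding m using achart_subdegree[OF assms] by simp
  next
    case False
    then have "fps_nth (u - fps_const a) 0 \<noteq> 0" using u by simp
    then show ?thesis unfolding m using False by (metis subdegree_eq_0 fps_zero_nth)
  qed
  then show "u + fps_const a \<noteq> 0"
    "subdegree (u + fps_const a) = (if u0 = a then if u0 = 0 then 2 else 1 else 0)" by blast+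
qed

text \<open>The plane \<open>(X1 + X3) / c + a X2 = 0\<close> restricts to
  \<open>s (r + a s)\<close>: it cuts out the fibre over \<open>a\<close>, and the factor
  \<open>s\<close> contributes O twice.\<close>

lemma principal_opp:
  assumes "opp P Q"
  shows "principal c (\<lambda>T. pt_div P T + pt_div Q T - 2 * pt_div (mu4_O c) T)"
  using assms unfolding opp_def
proof (elim disjE exE conjE)
  have "principal c (\<lambda>T. 4 * pt_div (mu4_O c) T - 4 * pt_div (mu4_O c) T)"
  proof (rule principal_linear[OF X2_nonzero])
    show "int (subdegree (form_eval fps_const 1 X2 (cv 1 w y))) = 4 * pt_div (mu4_O c) (mu4_O c)"
      if "ochart w y" for w y
      unfolding form_eval_X2 using that by (simp add: ochart_def pt_div_def)
  qed (simp only: form_eval_X2, simp add: pt_div_def aff_not_O)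
  then show "principal c (\<lambda>T. pt_div P T + pt_div Q T - 2 * pt_div (mu4_O c) T)"
    if "P = mu4_O c" "Q = mu4_O c" using that by simp
next
  fix a b assume ab: "aff_eq a b" and PQ: "P = aff a b" "Q = aff a (b + c * a)"
  define L where "L = linear_form (vec4 0 (inverse c) a (inverse c))"
  have ev: "form_eval fps_const 1 L (cv r s y) = s * (r + fps_const a * s)" for r s y
  proof -
    have "form_eval fps_const 1 L (cv r s y) = fps_const (inverse c) * y + fps_const (inverse c) * y
        + fps_const (inverse c * c) * r * s + fps_const a * s\<^sup>2"
      unfolding L_def form_eval_linear_cv by (simp add: algebra_simps flip: fps_const_mult)
    then show ?thesis using c0 by (simp add: ch2_fps power2_eq_square algebra_simps)
  qed
  have nz: "form_nonzero_on c 1 L"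
  proof -
    obtain y where "aff_eq (a + 1) y" by (rule aff_eq_exists)
    moreover have "form_eval id 1 L (vec4 ((a + 1)\<^sup>2) y 1 (y + c * (a + 1))) = 1"
      unfolding L_def form_eval_linear_id using c0 by (simp add: algebra_simps ch2)
    ultimately show ?thesis by (metis form_nonzero_onI zero_neq_one)
  qed
  have "principal c (\<lambda>T. (pt_div P T + pt_div Q T + 2 * pt_div (mu4_O c) T) - 4 * pt_div (mu4_O c) T)"
  proof (rule principal_linear[OF nz])
    fix u0 y0 u y assume uy0: "aff_eq u0 y0" and uy: "achart u0 y0 u y"
    \<comment> \<open>The quadratic equation for \<open>y\<close> above \<open>a\<close> has the
      roots \<open>b\<close> and \<open>b + c * a\<close>.\<close>
    have y: "y0 = b \<or> y0 = b + c * a" if "u0 = a"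
    proof -
      have "(y0 + b) * (y0 + b + c * a) = (y0\<^sup>2 + c * a * y0) + (b\<^sup>2 + c * a * b) + (y0 * b + y0 * b)"
        by (simp add: power2_eq_square algebra_simps)
      also have "y0\<^sup>2 + c * a * y0 = d * (a ^ 4 + 1)"
        using uy0 that by (simp add: aff_eq_def ch2 add_ac)
      also have "b\<^sup>2 + c * a * b = d * (a ^ 4 + 1)" using ab by (simp add: aff_eq_def ch2 add_ac)
      finally have "(y0 + b) * (y0 + b + c * a) = 0" by (simp only: ch2)
      then show ?thesis by (metis add.assoc add_eq_0_iff2 ch2(1) mult_eq_0_iff)
    qed
    have "b = b + c * a \<longleftrightarrow> a = 0" using c0 by simp
    then show "int (subdegree (form_eval fps_const 1 L (cv u 1 y)))
        = pt_div P (aff u0 y0) + pt_div Q (aff u0 y0) + 2 * pt_div (mu4_O c) (aff u0 y0)"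
      unfolding ev PQ using subdegree_linear(2)[OF uy, of a] y c0
      by (auto simp: pt_div_def aff_inj aff_not_O)
  next
    fix w y assume "ochart w y"
    then have w: "subdegree w = 2" "w \<noteq> 0" by (auto simp: ochart_def)
    have "fps_nth (1 + fps_const a * w) 0 = 1" using subdegree_2(1)[OF w(1)] by simp
    then have "1 + fps_const a * w \<noteq> 0" "subdegree (1 + fps_const a * w) = 0"
      by (metis fps_zero_nth zero_neq_one, metis subdegree_eq_0 zero_neq_one)
    then show "int (subdegree (form_eval fps_const 1 L (cv 1 w y)))
        = pt_div P (mu4_O c) + pt_div Q (mu4_O c) + 2 * pt_div (mu4_O c) (mu4_O c)"
      unfolding ev PQ using w by (simp add: pt_div_def aff_not_O)
  qed
  then show "principal c (\<lambda>T. pt_div P T + pt_div Q T - 2 * pt_div (mu4_O c) T)" by simp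
qed

text \<open>
  Writing \<open>y + u\<^sup>2 / c\<close> for \<open>y\<close> turns the curve into \<open>y\<^sup>2 + c u y = u\<^sup>3 + 1 / c\<^sup>2\<close>; the plane sections
  through \<open>O\<close> are the chords of this Weierstrass cubic.
\<close>

lemma principal_chord:
  fixes u1 u2 u3 b e :: 'a
  defines "q \<equiv> \<lambda>u. inverse c * u\<^sup>2 + b * u + e"
  assumes e1: "u1 + u2 + u3 = b\<^sup>2 + c * b" and e2: "u1 * u2 + u1 * u3 + u2 * u3 = c * e"
    and e3: "u1 * u2 * u3 = e\<^sup>2 + d"
  shows "aff_eq u1 (q u1)" "aff_eq u2 (q u2)" "aff_eq u3 (q u3)"
    "principal c (\<lambda>T. pt_div (aff u1 (q u1)) T + pt_div (aff u2 (q u2)) T + pt_div (aff u3 (q u3)) T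
      - 3 * pt_div (mu4_O c) T)"
proof -
  define A where "A = [:e, b, inverse c:]"
  have q: "poly A u = q u" for u by (simp add: A_def q_def power2_eq_square algebra_simps)
  \<comment> \<open>The leading coefficient \<open>inverse c\<close> of \<open>A\<close> cancels the
    term of degree 4, as \<open>d = (inverse c)^2\<close>. The remaining cubic has its coefficients
    prescribed by the three assumptions.\<close>
  have N: "norm_poly A 1 = [:u1, 1:] * [:u2, 1:] * [:u3, 1:]"
  proof -
    have "norm_poly A 1 = [:e\<^sup>2 + d, c * e, b\<^sup>2 + c * b, 1:]"
      unfolding norm_poly_def A_def using c0
      by (simp add: power2_eq_square algebra_simps ch2 d_eq)
    then show ?thesis unfolding e1[symmetric] e2[symmetric] e3[symmetric]
      by (simp add: algebra_simps)
  qed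
  have nval: "(y + q u) * (y + c * u + q u) = (u + u1) * (u + u2) * (u + u3)
      + (y\<^sup>2 + (c * u * y + d * (u ^ 4 + 1)))" for u y
  proof -
    have "poly (norm_poly A 1) u = (q u)\<^sup>2 + c * u * q u + d * (u ^ 4 + 1)"
      unfolding norm_poly_def by (simp add: q algebra_simps numeral_eq_Suc)
    then have "(u + u1) * (u + u2) * (u + u3) = (q u)\<^sup>2 + c * u * q u + d * (u ^ 4 + 1)"
      unfolding N poly_mult by (simp add: add.commute)
    then show ?thesis by (simp add: power2_eq_square algebra_simps ch2)
  qed
  have on: "aff_eq u (q u)" if "u \<in> {u1, u2, u3}" for u
  proof -
    have "(u + u1) * (u + u2) * (u + u3) = 0" using that by (auto simp: ch2)
    moreover have "(q u + q u) * (q u + c * u + q u) = 0" by (simp only: ch2 mult_zero_left)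
    ultimately have "(q u)\<^sup>2 + (c * u * q u + d * (u ^ 4 + 1)) = 0"
      using nval[of "q u" u] by (simp only: add_0_left)
    then show ?thesis unfolding aff_eq_def by (metis add_eq_0_iff2 ch2(1))
  qed
  then show "aff_eq u1 (q u1)" "aff_eq u2 (q u2)" "aff_eq u3 (q u3)" by simp_all
  define i where "i = inverse c"
  \<comment> \<open>The coefficients \<open>b * i\<close> of \<open>X1\<close> and \<open>X3\<close>
    together produce \<open>b r s\<close>, and the extra 1 leaves \<open>y\<close>.\<close>
  define L where "L = linear_form (vec4 i (1 + b * i) e (b * i))"
  have ev: "form_eval fps_const 1 L (cv r s y)
      = fps_const i * r\<^sup>2 + y + fps_const b * r * s + fps_const e * s\<^sup>2" for r s y
  proof -
    have "fps_const (b * i) * (fps_const c * r * s) = fps_const (b * (i * c)) * r * s"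
      by (simp add: mult_ac)
    also have "i * c = 1" using c0 by (simp add: i_def)
    finally have 1: "fps_const (b * i) * (fps_const c * r * s) = fps_const b * r * s" by simp
    have "fps_const (1 + b * i) * y + fps_const (b * i) * y = y"
      by (simp add: algebra_simps ch2_fps flip: fps_const_add)
    then show ?thesis unfolding L_def form_eval_linear_cv distrib_left 1
      by (simp add: add_ac)
  qed
  have ev1: "form_eval fps_const 1 L (cv u 1 y) = paev A 1 u y" for u y
    unfolding ev A_def paev_def by (simp add: i_def power2_eq_square algebra_simps)
  have nz: "form_nonzero_on c 1 L"
  proof -
    have "degree (norm_poly A 1) = 3" unfolding N by (simp add: degree_mult_eq)
    then have "degree (norm_poly A 1 + [:- 1:]) > 0" by (subst degree_add_eq_left) auto
    then obtain u where "poly (norm_poly A 1 + [:- 1:]) u = 0" using alg_closed_imp_poly_has_root by blast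
    then have u: "(u + u1) * (u + u2) * (u + u3) = 1" unfolding N poly_mult poly_add
      by (simp add: add.commute)
    obtain y where y: "aff_eq u y" by (rule aff_eq_exists)
    then have "y\<^sup>2 + (c * u * y + d * (u ^ 4 + 1)) = 0" unfolding aff_eq_def by (simp only: ch2)
    then have "(y + q u) * (y + c * u + q u) = 1" using nval[of y u] u by simp
    then have "y + q u \<noteq> 0" by auto
    moreover have "form_eval id 1 L (vec4 (u\<^sup>2) y 1 (y + c * u)) = y + q u"
      unfolding L_def form_eval_linear_id q_def using c0 by (simp add: i_def algebra_simps ch2)
    ultimately show ?thesis using y by (metis form_nonzero_onI)
  qed
  let ?D = "\<lambda>T. pt_div (aff u1 (q u1)) T + pt_div (aff u2 (q u2)) T + pt_div (aff u3 (q u3)) T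
      + pt_div (mu4_O c) T"
  have "principal c (\<lambda>T. ?D T - 4 * pt_div (mu4_O c) T)"
  proof (rule principal_linear[OF nz])
    fix u0 y0 u y assume uy0: "aff_eq u0 y0" and uy: "achart u0 y0 u y"
    have u0: "fps_nth u 0 = u0" "fps_nth y 0 = y0" "on_curve u 1 y" using uy by (simp_all add: achart_def)
    have nth0: "fps_nth (paev A 1 u y) 0 = q u0 + y0" by (simp add: paev_def u0 q)
    have pt: "pt_div (aff a (q a)) (aff u0 y0) = of_bool (u0 = a \<and> y0 = q u0)" for a
      by (auto simp: pt_div_def aff_inj)
    have "int (subdegree (paev A 1 u y)) = of_bool (u0 = u1 \<and> y0 = q u0)
        + of_bool (u0 = u2 \<and> y0 = q u0) + of_bool (u0 = u3 \<and> y0 = q u0)"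
    proof (cases "y0 = q u0")
      case False
      then have "q u0 + y0 \<noteq> 0" by (metis add_eq_0_iff2 ch2(1))
      then have "subdegree (paev A 1 u y) = 0" using nth0 by (metis subdegree_eq_0)
      then show ?thesis using False by simp
    next
      case y0: True
      show ?thesis
      proof (cases "u0 = 0")
        case False
        \<comment> \<open>Away from ramification the conjugate factor is a unit at the point
          considered, so the order can be read off the cubic.\<close>
        have "wf_pair 2 A 1" by (simp add: wf_pair_def A_def)
        note * = norm_poly_mult[OF this]
        have "paev A 1 u y * paev (A + cX) 1 u y = aev (norm_poly A 1) u"
          using *(1)[OF u0(3)] *(2,3) \<open>wf_pair 2 A 1\<close>
          by (simp add: wev_eq_paev hev_eq_aev del: aev_pCons)
        also have "\<dots> = (u + fps_const u1) * (u + fps_const u2) * (u + fps_const u3)"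
          unfolding N aev_mult by (simp add: add.commute)
        finally have prod: "paev A 1 u y * paev (A + cX) 1 u y
            = (u + fps_const u1) * (u + fps_const u2) * (u + fps_const u3)" .
        have "fps_nth (paev (A + cX) 1 u y) 0 = q u0 + c * u0 + y0"
          by (simp add: paev_def u0 q algebra_simps)
        also have "\<dots> = c * u0" unfolding y0 by (simp add: algebra_simps ch2)
        finally have "fps_nth (paev (A + cX) 1 u y) 0 \<noteq> 0" using False c0 by simp
        then have 1: "paev (A + cX) 1 u y \<noteq> 0" "subdegree (paev (A + cX) 1 u y) = 0"
          by (metis fps_zero_nth, metis subdegree_eq_0)
        have 2: "paev A 1 u y \<noteq> 0" by (rule paev_nonzero[OF uy]) simp
        have "subdegree (paev A 1 u y) = subdegree (paev A 1 u y * paev (A + cX) 1 u y)"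
          using 1 2 by simp
        also have "\<dots> = of_bool (u0 = u1) + of_bool (u0 = u2) + of_bool (u0 = u3)"
          unfolding prod using subdegree_linear[OF uy] False by simp
        finally show ?thesis using y0 by simp
      next
        case True
        \<comment> \<open>At the ramification point the linear term of \<open>y\<close> makes the
          order 1. Exactly one of \<open>u1\<close>, \<open>u2\<close>, \<open>u3\<close> is zero
          there: their product is 0 and their second symmetric function is 1.\<close>
        have su: "subdegree u = 2" and y1: "fps_nth y 1 \<noteq> 0" using uy True by (auto simp: achart_def)
        note u = subdegree_2[OF su]
        have "paev A 1 u y = y + fps_const e + u * (fps_const b + u * fps_const (inverse c))"
          by (simp add: paev_def A_def algebra_simps)
        then have "fps_nth (paev A 1 u y) 1 = fps_nth y 1"
          using u by (simp add: fps_mult_nth)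
        moreover have "fps_nth (paev A 1 u y) 0 = 0" unfolding nth0 y0 by (simp only: ch2)
        ultimately have "subdegree (paev A 1 u y) = 1" using y1 by (intro subdegreeI) auto
        moreover have "of_bool (0 = u1) + of_bool (0 = u2) + of_bool (0 = u3) = (1 :: int)"
        proof -
          have "q 0 = inverse c" using uy0 y0 True aff_eq_0 by simp
          then have e: "e = inverse c" by (simp add: q_def)
          have "u1 * u2 * u3 = 0" unfolding e3 e d_eq by (simp only: ch2)
          moreover have "u1 * u2 + u1 * u3 + u2 * u3 = 1" unfolding e2 e using c0 by simp
          ultimately show ?thesis by auto
        qed
        ultimately show ?thesis using True y0 by simp
      qed
    qed
    then show "int (subdegree (form_eval fps_const 1 L (cv u 1 y))) = ?D (aff u0 y0)"
      unfolding ev1 pt by (simp add: pt_div_def aff_not_O)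
  next
    fix w y assume wy: "ochart w y"
    have sw: "subdegree w = 2" and y: "fps_nth y 0 = inverse c" "fps_nth y 1 \<noteq> 0"
      using wy by (auto simp: ochart_def)
    note w = subdegree_2[OF sw]
    define f where "f = form_eval fps_const 1 L (cv 1 w y)"
    have f: "f = fps_const i + y + w * (fps_const b + w * fps_const e)"
      unfolding f_def ev by (simp add: power2_eq_square algebra_simps)
    have "fps_nth f 0 = 0" unfolding f using w y by (simp add: i_def ch2)
    moreover have "fps_nth f 1 \<noteq> 0" unfolding f using w y by (simp add: fps_mult_nth)
    ultimately have "subdegree f = 1" by (intro subdegreeI) auto
    then show "int (subdegree (form_eval fps_const 1 L (cv 1 w y))) = ?D (mu4_O c)"
      unfolding f_def[symmetric] by (simp add: pt_div_def aff_not_O)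
  qed
  then show "principal c (\<lambda>T. pt_div (aff u1 (q u1)) T + pt_div (aff u2 (q u2)) T
      + pt_div (aff u3 (q u3)) T - 3 * pt_div (mu4_O c) T)"
    by (simp add: algebra_simps)
qed


lemma cd_cancel: "c\<^sup>2 * (d * x) = x"
  using c_d(1) by (simp flip: mult.assoc)

text \<open>The excluded case is that of opposite points, whose third intersection is O. The last
  two conclusions determine \<open>u3\<close> by two quotients, which become the two tuples for a
  difference.\<close>

lemma chord_exists:
  assumes P1: "aff_eq u1 y1" and P2: "aff_eq u2 y2" and ne: "\<not> (u2 = u1 \<and> y2 = y1 + c * u1)"
  obtains u3 y3 where "aff_eq u3 y3"
    "principal c (\<lambda>T. pt_div (aff u1 y1) T + pt_div (aff u2 y2) T + pt_div (aff u3 y3) T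
      - 3 * pt_div (mu4_O c) T)"
    "1 + u1\<^sup>2 * u2\<^sup>2 = u3 * (c * (u2 * y1 + u1 * y2) + c\<^sup>2 * u1 * u2)"
    "c * (u2 * y1 + u1 * y2) = u3 * (u1 + u2)\<^sup>2"
proof -
  define i where "i = inverse c"
  have ci: "c * i = 1" and di: "d = i\<^sup>2" using c0 by (simp_all add: i_def d_eq)
  have y1: "y1\<^sup>2 = c * u1 * y1 + d * (u1 ^ 4 + 1)" and y2: "y2\<^sup>2 = c * u2 * y2 + d * (u2 ^ 4 + 1)"
    using P1 P2 by (simp_all add: aff_eq_def)
  show thesis
  proof (cases "u1 = u2")
    case False
    define t where "t = u1 + u2"
    define z where "z = y1 + y2"
    \<comment> \<open>The slope of the chord, with a correction for the quadratic term of the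
      parabola.\<close>
    define b where "b = z / t + i * t"
    define e where "e = y1 + i * u1\<^sup>2 + b * u1"
    define u3 where "u3 = b\<^sup>2 + c * b + t"
    have t: "t \<noteq> 0" using False unfolding t_def by (metis add_eq_0_iff2 ch2(1))
    have bt: "b * t = z + i * t\<^sup>2" using t by (simp add: b_def field_simps power2_eq_square)
    have q1: "i * u1\<^sup>2 + b * u1 + e = y1"
      unfolding e_def by (simp add: add_ac ch2)
    have "i * u2\<^sup>2 + b * u2 + e = i * t\<^sup>2 + b * t + y1"
      unfolding e_def t_def square_add by (simp add: algebra_simps ch2)
    also have "\<dots> = y2" unfolding bt z_def by (simp add: add_ac ch2)
    finally have q2: "i * u2\<^sup>2 + b * u2 + e = y2" .
    have n: "u ^ 3 + (b\<^sup>2 + c * b) * u\<^sup>2 + c * e * u + (e\<^sup>2 + d) = 0"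
      if "y\<^sup>2 = c * u * y + d * (u ^ 4 + 1)" "i * u\<^sup>2 + b * u + e = y" for u y
    proof -
      have "y\<^sup>2 + (c * u * y + d * (u ^ 4 + 1)) = 0" unfolding that(1) by (simp only: ch2)
      moreover have "y\<^sup>2 = d * u ^ 4 + b\<^sup>2 * u\<^sup>2 + e\<^sup>2"
        unfolding that(2)[symmetric] square_add di by (simp add: power_mult_distrib)
      moreover have "c * u * y = (c * i) * u ^ 3 + c * b * u\<^sup>2 + c * e * u"
        unfolding that(2)[symmetric] by (simp add: algebra_simps power2_eq_square power3_eq_cube)
      ultimately show ?thesis unfolding ci by (simp add: algebra_simps ch2)
    qed
    note n1 = n[OF y1 q1] and n2 = n[OF y2 q2]
    \<comment> \<open>A divided difference of the cubic at its two known roots; its vanishing is the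
      second symmetric relation for \<open>u3\<close>.\<close>
    have "t * (u1\<^sup>2 + u1 * u2 + u2\<^sup>2 + (b\<^sup>2 + c * b) * t + c * e)
        = (u1 ^ 3 + (b\<^sup>2 + c * b) * u1\<^sup>2 + c * e * u1 + (e\<^sup>2 + d))
          + (u2 ^ 3 + (b\<^sup>2 + c * b) * u2\<^sup>2 + c * e * u2 + (e\<^sup>2 + d))"
      unfolding t_def by (simp add: algebra_simps power2_eq_square power3_eq_cube ch2)
    then have "t * (u1\<^sup>2 + u1 * u2 + u2\<^sup>2 + (b\<^sup>2 + c * b) * t + c * e) = 0"
      unfolding n1 n2 by simp
    then have E2: "c * e = u1\<^sup>2 + u1 * u2 + u2\<^sup>2 + (b\<^sup>2 + c * b) * t"
      using t by (metis add_eq_0_iff2 ch2(1) mult_eq_0_iff)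
    have E3: "e\<^sup>2 + d = u1 ^ 3 + (b\<^sup>2 + c * b) * u1\<^sup>2 + c * e * u1"
      using n1 by (metis add_eq_0_iff2 ch2(1))
    have e1: "u1 + u2 + u3 = b\<^sup>2 + c * b" unfolding u3_def t_def by (simp add: add_ac ch2)
    have e2: "u1 * u2 + u1 * u3 + u2 * u3 = c * e"
      unfolding E2 u3_def t_def by (simp add: algebra_simps power2_eq_square ch2)
    have e3: "u1 * u2 * u3 = e\<^sup>2 + d"
      unfolding E3 E2 u3_def t_def
      by (simp add: algebra_simps power2_eq_square power3_eq_cube ch2)
    note chord = principal_chord[OF e1 e2 e3, folded i_def, unfolded q1 q2]
    have "u3 * t\<^sup>2 = (b * t)\<^sup>2 + c * t * (b * t) + t ^ 3"
      unfolding u3_def by (simp add: algebra_simps power2_eq_square power3_eq_cube)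
    also have "\<dots> = z\<^sup>2 + d * t ^ 4 + c * t * z + (c * i) * t ^ 3 + t ^ 3"
      unfolding bt square_add di by (simp add: algebra_simps power2_eq_square power3_eq_cube numeral_eq_Suc)
    also have "\<dots> = z\<^sup>2 + d * t ^ 4 + c * t * z" unfolding ci by (simp add: add_ac ch2)
    also have "\<dots> = (c * u1 * y1 + d * (u1 ^ 4 + 1)) + (c * u2 * y2 + d * (u2 ^ 4 + 1))
        + d * (u1 ^ 4 + u2 ^ 4) + c * (u1 + u2) * (y1 + y2)"
    proof -
      have "t ^ 4 = u1 ^ 4 + u2 ^ 4" unfolding t_def fourth_power square_add ..
      moreover have "z\<^sup>2 = (c * u1 * y1 + d * (u1 ^ 4 + 1)) + (c * u2 * y2 + d * (u2 ^ 4 + 1))"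
        unfolding z_def square_add y1 y2 ..
      ultimately show ?thesis by (simp add: t_def z_def)
    qed
    also have "\<dots> = c * (u2 * y1 + u1 * y2)" by (simp add: algebra_simps ch2)
    finally have R2: "c * (u2 * y1 + u1 * y2) = u3 * t\<^sup>2" by simp
    \<comment> \<open>After multiplication by \<open>t^2\<close>, the relation \<open>R2\<close>
      eliminates \<open>u3\<close>, and the curve equations of the two points do the rest.\<close>
    have "t\<^sup>2 * (u3 * (c * (u2 * y1 + u1 * y2) + c\<^sup>2 * u1 * u2))
        = (c * (u2 * y1 + u1 * y2)) * (c * (u2 * y1 + u1 * y2) + c\<^sup>2 * u1 * u2)"
      unfolding R2 by (simp add: mult_ac)
    also have "\<dots> = c\<^sup>2 * (u2\<^sup>2 * y1\<^sup>2) + c\<^sup>2 * (u1\<^sup>2 * y2\<^sup>2)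
        + (c * (u2 * y1 + u1 * y2)) * (c\<^sup>2 * u1 * u2)"
      by (simp add: algebra_simps power2_eq_square ch2)
    also have "\<dots> = u2\<^sup>2 * (c\<^sup>2 * (d * (u1 ^ 4 + 1))) + u1\<^sup>2 * (c\<^sup>2 * (d * (u2 ^ 4 + 1)))"
      unfolding y1 y2 by (simp add: algebra_simps power2_eq_square ch2)
    also have "\<dots> = t\<^sup>2 * (1 + u1\<^sup>2 * u2\<^sup>2)"
      unfolding cd_cancel t_def square_add by (simp add: algebra_simps power2_eq_square numeral_eq_Suc)
    finally have "u3 * (c * (u2 * y1 + u1 * y2) + c\<^sup>2 * u1 * u2) = 1 + u1\<^sup>2 * u2\<^sup>2"
      using t by simp
    then show ?thesis using that[OF chord(3,4)] R2 by (simp add: t_def)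
  next
    case True
    have "(y1 + y2) * (y1 + y2 + c * u1) = (y1\<^sup>2 + c * u1 * y1) + (y2\<^sup>2 + c * u1 * y2) + (y1 * y2 + y1 * y2)"
      by (simp add: power2_eq_square algebra_simps)
    also have "y1\<^sup>2 + c * u1 * y1 = d * (u1 ^ 4 + 1)" using y1 by (simp add: ch2 add_ac)
    also have "y2\<^sup>2 + c * u1 * y2 = d * (u1 ^ 4 + 1)" using y2 True by (simp add: ch2 add_ac)
    finally have "(y1 + y2) * (y1 + y2 + c * u1) = 0" by (simp only: ch2)
    moreover have "y1 + y2 + c * u1 \<noteq> 0"
      using ne True by (metis add.assoc add.commute add_eq_0_iff2 ch2(1))
    ultimately have y12: "y2 = y1" by (metis add_eq_0_iff2 ch2(1) mult_eq_0_iff)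
    then have u1: "u1 \<noteq> 0" using ne True by auto
    \<comment> \<open>Tangent case: differentiating the curve equation gives
      \<open>u y' = y\<close>, hence this slope.\<close>
    define b where "b = y1 / u1"
    define e where "e = i * u1\<^sup>2"
    define u3 where "u3 = b\<^sup>2 + c * b"
    have bu: "b * u1 = y1" using u1 by (simp add: b_def)
    have ce: "c * e = u1\<^sup>2" unfolding e_def using ci by (simp flip: mult.assoc)
    have q1: "i * u1\<^sup>2 + b * u1 + e = y1" unfolding bu e_def by (simp add: add_ac ch2)
    have "u3 * u1\<^sup>2 = (b * u1)\<^sup>2 + c * u1 * (b * u1)"
      unfolding u3_def by (simp add: algebra_simps power2_eq_square)
    also have "\<dots> = d * (u1 ^ 4 + 1)" unfolding bu y1 by (simp add: add_ac ch2)
    finally have u3: "u3 * u1\<^sup>2 = d * (u1 ^ 4 + 1)" .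
    have e1: "u1 + u1 + u3 = b\<^sup>2 + c * b" by (simp add: u3_def ch2)
    have e2: "u1 * u1 + u1 * u3 + u1 * u3 = c * e"
      unfolding ce by (simp add: power2_eq_square add_ac ch2)
    have "u1 * u1 * u3 = u3 * u1\<^sup>2" by (simp add: power2_eq_square mult_ac)
    also have "\<dots> = e\<^sup>2 + d" unfolding u3 e_def di by (simp add: power_mult_distrib distrib_left)
    finally have e3: "u1 * u1 * u3 = e\<^sup>2 + d" .
    note chord = principal_chord[OF e1 e2 e3, folded i_def, unfolded q1]
    have "u3 * (c * (u1 * y1 + u1 * y1) + c\<^sup>2 * u1 * u1) = c\<^sup>2 * (u3 * u1\<^sup>2)"
      by (simp add: ch2 power2_eq_square mult_ac)
    also have "\<dots> = 1 + u1\<^sup>2 * u1\<^sup>2" unfolding u3 cd_cancel by (simp flip: power_add)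
    finally show ?thesis
      using that[OF chord(3)] chord(4) unfolding y12 True[symmetric] by (simp add: ch2)
  qed
qed

section \<open>Coordinates of a difference\<close>

definition nrep :: "('a, 4) proj \<Rightarrow> 'a ^ 4 \<Rightarrow> bool" where
  "nrep P x \<longleftrightarrow> P = mu4_O c \<and> x = vec4 c 1 0 1 \<or>
    (\<exists>u y. aff_eq u y \<and> P = aff u y \<and> x = vec4 (u\<^sup>2) y 1 (y + c * u))"

text \<open>\<open>krel R v\<close> says that \<open>v\<close> is zero or a coordinate vector of \<open>kummer c R\<close>.\<close>

definition krel :: "('a, 4) proj \<Rightarrow> 'a ^ 2 \<Rightarrow> bool" where
  "krel R v \<longleftrightarrow> (R = mu4_O c \<longrightarrow> v $ 1 = 0) \<and> (\<forall>u y. R = aff u y \<longrightarrow> v $ 0 = u * v $ 1)"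

text \<open>With \<open>diff2\<close>, the tuples for the second component of
  \<open>kummer_lambda\<close>, as bilinear maps. Putting O for \<open>s\<close> yields those of the
  first component.\<close>

definition diff1 :: "'a ^ 4 \<Rightarrow> 'a ^ 4 \<Rightarrow> 'a ^ 2" where
  "diff1 s x = vec2 (s $ 0 * x $ 0 + s $ 2 * x $ 2) (s $ 3 * x $ 1 + s $ 1 * x $ 3)"

definition diff2 :: "'a ^ 4 \<Rightarrow> 'a ^ 4 \<Rightarrow> 'a ^ 2" where
  "diff2 s x = vec2 (s $ 1 * x $ 1 + s $ 3 * x $ 3) (s $ 2 * x $ 0 + s $ 0 * x $ 2)"

lemma opp_sym: "opp P Q \<Longrightarrow> opp Q P"
  unfolding opp_def
proof (elim disjE exE conjE)
  fix u y assume uy: "aff_eq u y" "P = aff u y" "Q = aff u (y + c * u)"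
  have "y = (y + c * u) + c * u" by (simp only: add.assoc ch2 add_0_right)
  then show "Q = mu4_O c \<and> P = mu4_O c \<or> (\<exists>u y. aff_eq u y \<and> Q = aff u y \<and> P = aff u (y + c * u))"
    using aff_eq_conj[OF uy(1)] uy(2,3) by metis
qed blast

lemma opp_unique: "opp P Q \<Longrightarrow> opp P Q' \<Longrightarrow> Q = Q'"
  unfolding opp_def by (auto simp: aff_inj aff_not_O)

lemma opp_exists:
  assumes "P \<in> mu4_curve c"
  obtains Q where "opp P Q"
  using assms by (cases rule: mu4_curve_cases) (auto simp: opp_def)

lemma opp_in_curve: "opp P Q \<Longrightarrow> Q \<in> mu4_curve c" "opp P Q \<Longrightarrow> P \<in> mu4_curve c"
  unfolding opp_def using O_in_curve aff_in_curve aff_eq_conj by blast+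

lemma principal_0: "principal c (\<lambda>T. 0)"
  using principal_diff[OF principal_opp principal_opp, of "mu4_O c" "mu4_O c" "mu4_O c" "mu4_O c"]
  by (simp add: opp_def)

text \<open>The chord through Q and the opposite \<open>N\<close> of S meets the curve again in the
  opposite of the difference, which has the same \<open>u\<close>. Subtracting the divisors of the
  two opposite pairs from that of the chord gives the relation. The cases where Q, S or the
  difference is O are separate.\<close>

lemma difference:
  assumes "nrep Q x" "nrep S s"
  shows "\<exists>R. R \<in> mu4_curve c \<and>
    principal c (\<lambda>T. pt_div Q T + pt_div (mu4_O c) T - pt_div R T - pt_div S T) \<and>
    (diff1 s x \<noteq> 0 \<or> diff2 s x \<noteq> 0) \<and> krel R (diff1 s x) \<and> krel R (diff2 s x)"
proof -
  have Q: "Q \<in> mu4_curve c" using assms(1) aff_in_curve O_in_curve by (auto simp: nrep_def)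
  show ?thesis
    using assms(2) unfolding nrep_def
  proof (elim disjE exE conjE)
    assume S: "S = mu4_O c" and s: "s = vec4 c 1 0 1"
    have "(diff1 s x \<noteq> 0 \<or> diff2 s x \<noteq> 0) \<and> krel Q (diff1 s x) \<and> krel Q (diff2 s x)"
      using assms(1) c0 unfolding nrep_def
      by (auto simp: krel_def diff1_def diff2_def s vec2_eq_iff aff_inj aff_not_O ch2
          power2_eq_square algebra_simps)
    then show ?thesis using Q principal_0 by (intro exI[of _ Q]) (simp add: S)
  next
    fix \<sigma> \<eta> assume \<sigma>: "aff_eq \<sigma> \<eta>" and S: "S = aff \<sigma> \<eta>"
      and s: "s = vec4 (\<sigma>\<^sup>2) \<eta> 1 (\<eta> + c * \<sigma>)"
    define N where "N = aff \<sigma> (\<eta> + c * \<sigma>)"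
    have oppS: "opp S N" using \<sigma> S by (auto simp: opp_def N_def)
    show ?thesis using assms(1) unfolding nrep_def
    proof (elim disjE exE conjE)
      assume Q: "Q = mu4_O c" and x: "x = vec4 c 1 0 1"
      have "(diff1 s x \<noteq> 0 \<or> diff2 s x \<noteq> 0) \<and> krel N (diff1 s x) \<and> krel N (diff2 s x)"
        using c0 by (auto simp: krel_def diff1_def diff2_def s x N_def vec2_eq_iff aff_inj aff_not_O
            ch2 power2_eq_square algebra_simps)
      then show ?thesis using principal_uminus[OF principal_opp[OF oppS]] opp_in_curve(1)[OF oppS]
        by (intro exI[of _ N]) (simp add: Q algebra_simps)
    next
      fix u y assume uy: "aff_eq u y" and Q: "Q = aff u y" and x: "x = vec4 (u\<^sup>2) y 1 (y + c * u)"
      show ?thesis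
      proof (cases "Q = S")
        case True
        then have eq: "u = \<sigma>" "y = \<eta>" using Q S by (auto simp: aff_inj)
        have "diff1 s x = vec2 (1 + \<sigma> ^ 4) 0" "diff2 s x = vec2 (c\<^sup>2 * \<sigma>\<^sup>2) 0"
          unfolding diff1_def diff2_def s x eq
          by (simp_all add: vec2_eq_iff algebra_simps power2_eq_square numeral_eq_Suc ch2)
        moreover have "1 + \<sigma> ^ 4 \<noteq> 0 \<or> c\<^sup>2 * \<sigma>\<^sup>2 \<noteq> 0" using c0 by auto
        ultimately have "(diff1 s x \<noteq> 0 \<or> diff2 s x \<noteq> 0) \<and> krel (mu4_O c) (diff1 s x) \<and>
            krel (mu4_O c) (diff2 s x)"
          by (auto simp: krel_def aff_not_O vec2_eq_iff)
        then show ?thesis using O_in_curve principal_0 by (intro exI[of _ "mu4_O c"]) (simp add: True)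
      next
        case False
        have "\<not> (\<sigma> = u \<and> \<eta> + c * \<sigma> = y + c * u)" using False Q S by auto
        then obtain u3 y3 where P3: "aff_eq u3 y3"
          "principal c (\<lambda>T. pt_div (aff u y) T + pt_div N T + pt_div (aff u3 y3) T
            - 3 * pt_div (mu4_O c) T)"
          "1 + u\<^sup>2 * \<sigma>\<^sup>2 = u3 * (c * (\<sigma> * y + u * (\<eta> + c * \<sigma>)) + c\<^sup>2 * u * \<sigma>)"
          "c * (\<sigma> * y + u * (\<eta> + c * \<sigma>)) = u3 * (u + \<sigma>)\<^sup>2"
          unfolding N_def by (rule chord_exists[OF uy aff_eq_conj[OF \<sigma>]])
        define R where "R = aff u3 (y3 + c * u3)"
        have oppR: "opp (aff u3 y3) R" using P3(1) by (auto simp: opp_def R_def)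
        have "principal c (\<lambda>T. (pt_div (aff u y) T + pt_div N T + pt_div (aff u3 y3) T
              - 3 * pt_div (mu4_O c) T) - (pt_div S T + pt_div N T - 2 * pt_div (mu4_O c) T)
            - (pt_div (aff u3 y3) T + pt_div R T - 2 * pt_div (mu4_O c) T))"
          by (intro principal_diff P3(2) principal_opp oppS oppR)
        then have pr: "principal c (\<lambda>T. pt_div Q T + pt_div (mu4_O c) T - pt_div R T - pt_div S T)"
          by (simp add: Q algebra_simps)
        have f0: "diff1 s x $ 0 = 1 + u\<^sup>2 * \<sigma>\<^sup>2" by (simp add: diff1_def s x algebra_simps)
        have f1: "diff1 s x $ 1 = c * (\<sigma> * y + u * (\<eta> + c * \<sigma>)) + c\<^sup>2 * u * \<sigma>"
          by (simp add: diff1_def s x algebra_simps power2_eq_square ch2)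
        have g0: "diff2 s x $ 0 = c * (\<sigma> * y + u * (\<eta> + c * \<sigma>))"
          by (simp add: diff2_def s x algebra_simps power2_eq_square ch2)
        have g1: "diff2 s x $ 1 = (u + \<sigma>)\<^sup>2" by (simp add: diff2_def s x square_add)
        have "krel R (diff1 s x)" "krel R (diff2 s x)"
          unfolding krel_def R_def f0 f1 g0 g1 using P3(3,4) by (auto simp: aff_inj aff_not_O)
        moreover have "diff1 s x \<noteq> 0 \<or> diff2 s x \<noteq> 0"
        \<comment> \<open>If both tuples vanished, then \<open>u = \<sigma> = 0\<close>, and the
          first entry would be 1.\<close>
        proof (rule ccontr)
          assume "\<not> ?thesis"
          then have z: "diff1 s x $ 0 = 0" "diff1 s x $ 1 = 0" "diff2 s x $ 0 = 0" "diff2 s x $ 1 = 0"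
            by simp_all
          have "u = \<sigma>" using z(4) unfolding g1 by (metis add_eq_0_iff2 ch2(1) power2_eq_square mult_eq_0_iff)
          moreover have "c\<^sup>2 * u * \<sigma> = 0" using z(2,3) unfolding f1 g0 by simp
          ultimately show False using z(1) c0 unfolding f0 by simp
        qed
        moreover have "R \<in> mu4_curve c" using opp_in_curve(1)[OF oppR] .
        ultimately show ?thesis using pr by blast
      qed
    qed
  qed
qed

section \<open>The group law in terms of divisors\<close>

lemma nrep_exists:
  assumes "P \<in> mu4_curve c"
  obtains x where "nrep P x"
  using assms by (cases rule: mu4_curve_cases) (auto simp: nrep_def)

text \<open>Adding the divisor of \<open>Q\<close> and its opposite reduces the claim to
  \<open>principal_two\<close>.\<close>

lemma principal_unique:
  assumes "P \<in> mu4_curve c" "Q \<in> mu4_curve c" "principal c (\<lambda>T. pt_div P T - pt_div Q T)"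
  shows "P = Q"
proof -
  obtain N where N: "opp Q N" using assms(2) by (rule opp_exists)
  have "principal c (\<lambda>T. (pt_div P T - pt_div Q T)
      + (pt_div Q T + pt_div N T - 2 * pt_div (mu4_O c) T))"
    by (intro principal_add assms(3) principal_opp N)
  then have "principal c (\<lambda>T. pt_div P T + pt_div N T - 2 * pt_div (mu4_O c) T)"
    by (simp add: algebra_simps)
  then have "opp P N" using principal_two assms(1) opp_in_curve(1)[OF N] by blast
  then show ?thesis using opp_unique[OF opp_sym opp_sym] N by blast
qed

text \<open>The sum is the difference of \<open>P\<close> and the opposite of
  \<open>Q\<close>.\<close>

lemma principal_sum_exists:
  assumes "P \<in> mu4_curve c" "Q \<in> mu4_curve c"
  obtains R where "R \<in> mu4_curve c"
    "principal c (\<lambda>T. pt_div P T + pt_div Q T - (pt_div R T + pt_div (mu4_O c) T))"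
proof -
  obtain N where N: "opp Q N" using assms(2) by (rule opp_exists)
  obtain x s where "nrep P x" "nrep N s" using assms(1) opp_in_curve(1)[OF N] by (metis nrep_exists)
  then obtain R where R: "R \<in> mu4_curve c"
    "principal c (\<lambda>T. pt_div P T + pt_div (mu4_O c) T - pt_div R T - pt_div N T)"
    using difference by blast
  have "principal c (\<lambda>T. (pt_div P T + pt_div (mu4_O c) T - pt_div R T - pt_div N T)
      + (pt_div Q T + pt_div N T - 2 * pt_div (mu4_O c) T))"
    by (intro principal_add R(2) principal_opp N)
  then show thesis using that R(1) by (simp add: algebra_simps)
qed

lemma mu4_add_iff:
  assumes "P \<in> mu4_curve c" "Q \<in> mu4_curve c" "R \<in> mu4_curve c"
  shows "mu4_add c P Q = R \<longleftrightarrow>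
    principal c (\<lambda>T. pt_div P T + pt_div Q T - (pt_div R T + pt_div (mu4_O c) T))"
proof -
  let ?p = "\<lambda>R. principal c (\<lambda>T. pt_div P T + pt_div Q T - (pt_div R T + pt_div (mu4_O c) T))"
  have uniq: "R = R'" if "?p R" "?p R'" "R \<in> mu4_curve c" "R' \<in> mu4_curve c" for R R'
    using principal_unique[OF that(3,4)] principal_diff[OF that(2,1)] by (simp add: algebra_simps)
  obtain R0 where R0: "R0 \<in> mu4_curve c" "?p R0" using principal_sum_exists[OF assms(1,2)] by blast
  have "mu4_add c P Q = R0" unfolding mu4_add_def using R0 uniq by (intro the_equality) auto
  then show ?thesis using R0 uniq assms(3) by blast
qed

lemma mu4_neg_eq:
  assumes "opp P N"
  shows "mu4_neg c P = N"
  unfolding mu4_neg_def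
proof (rule the_equality)
  note in_curve = opp_in_curve[OF assms]
  show "N \<in> mu4_curve c \<and> mu4_add c P N = mu4_O c"
    using principal_opp[OF assms] in_curve O_in_curve by (simp add: mu4_add_iff)
  fix R assume "R \<in> mu4_curve c \<and> mu4_add c P R = mu4_O c"
  then have R: "R \<in> mu4_curve c" and "mu4_add c P R = mu4_O c" by blast+
  then have "principal c (\<lambda>T. pt_div P T + pt_div R T - 2 * pt_div (mu4_O c) T)"
    using mu4_add_iff[OF in_curve(2) R O_in_curve] by simp
  then have "opp P R" using principal_two in_curve(2) R by blast
  then show "R = N" using opp_unique assms by blast
qed

text \<open>The divisor relation is symmetric in \<open>R\<close> and \<open>S\<close>;
  \<open>Delta_eq\<close> rests on this.\<close>

lemma mu4_diff_iff:
  assumes "Q \<in> mu4_curve c" "R \<in> mu4_curve c" "S \<in> mu4_curve c"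
  shows "mu4_diff c Q R = S \<longleftrightarrow>
    principal c (\<lambda>T. pt_div Q T + pt_div (mu4_O c) T - pt_div R T - pt_div S T)"
proof -
  obtain N where N: "opp R N" using assms(2) by (rule opp_exists)
  have *: "mu4_diff c Q R = S \<longleftrightarrow>
      principal c (\<lambda>T. pt_div Q T + pt_div N T - (pt_div S T + pt_div (mu4_O c) T))"
    unfolding mu4_diff_def mu4_neg_eq[OF N] using assms opp_in_curve(1)[OF N] by (simp add: mu4_add_iff)
  show ?thesis
  proof
    assume "mu4_diff c Q R = S"
    then have "principal c (\<lambda>T. (pt_div Q T + pt_div N T - (pt_div S T + pt_div (mu4_O c) T))
        - (pt_div R T + pt_div N T - 2 * pt_div (mu4_O c) T))"
      unfolding * by (rule principal_diff[OF _ principal_opp[OF N]])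
    then show "principal c (\<lambda>T. pt_div Q T + pt_div (mu4_O c) T - pt_div R T - pt_div S T)"
      by (simp add: algebra_simps)
  next
    assume "principal c (\<lambda>T. pt_div Q T + pt_div (mu4_O c) T - pt_div R T - pt_div S T)"
    then have "principal c (\<lambda>T. (pt_div Q T + pt_div (mu4_O c) T - pt_div R T - pt_div S T)
        + (pt_div R T + pt_div N T - 2 * pt_div (mu4_O c) T))"
      by (intro principal_add principal_opp N)
    then show "mu4_diff c Q R = S" unfolding * by (simp add: algebra_simps)
  qed
qed

lemma mu4_diff_nrep:
  assumes "nrep Q x" "nrep S s"
  shows "mu4_diff c Q S \<in> mu4_curve c" "diff1 s x \<noteq> 0 \<or> diff2 s x \<noteq> 0"
    "krel (mu4_diff c Q S) (diff1 s x)" "krel (mu4_diff c Q S) (diff2 s x)"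
proof -
  obtain R where R: "R \<in> mu4_curve c"
    "principal c (\<lambda>T. pt_div Q T + pt_div (mu4_O c) T - pt_div R T - pt_div S T)"
    "diff1 s x \<noteq> 0 \<or> diff2 s x \<noteq> 0" "krel R (diff1 s x)" "krel R (diff2 s x)"
    using difference[OF assms] by blast
  have "Q \<in> mu4_curve c" "S \<in> mu4_curve c"
    using assms O_in_curve aff_in_curve by (auto simp: nrep_def)
  then have "mu4_diff c Q S = R" using R(1,2) by (simp add: mu4_diff_iff algebra_simps)
  then show "mu4_diff c Q S \<in> mu4_curve c" "diff1 s x \<noteq> 0 \<or> diff2 s x \<noteq> 0"
    "krel (mu4_diff c Q S) (diff1 s x)" "krel (mu4_diff c Q S) (diff2 s x)" using R by auto
qed

lemma Delta_eq:
  assumes "S \<in> mu4_curve c"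
  shows "Delta c S = (\<lambda>Q. (Q, mu4_diff c Q S)) ` mu4_curve c"
proof -
  obtain s where s: "nrep S s" using assms by (rule nrep_exists)
  have "mu4_diff c Q S \<in> mu4_curve c" if "Q \<in> mu4_curve c" for Q
    using mu4_diff_nrep(1)[OF _ s] that by (metis nrep_exists)
  moreover have "mu4_diff c Q R = S \<longleftrightarrow> mu4_diff c Q S = R"
    if "Q \<in> mu4_curve c" "R \<in> mu4_curve c" for Q R
    using that assms by (simp add: mu4_diff_iff algebra_simps)
  ultimately have "(Q, R) \<in> Delta c S \<longleftrightarrow> Q \<in> mu4_curve c \<and> R = mu4_diff c Q S" for Q R
    by (simp only: Delta_def mem_Collect_eq prod.case) metis
  then show ?thesis by (auto simp: image_iff)
qed

lemma two_torsion_opp: "opp S S \<Longrightarrow> two_torsion c S"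
  unfolding two_torsion_def using principal_opp[of S S] opp_in_curve[of S S] O_in_curve
  by (simp add: mu4_add_iff)

end

section \<open>The Kummer curve\<close>

lemma pt_scale: "x \<noteq> 0 \<Longrightarrow> a \<noteq> 0 \<Longrightarrow> pt (a *s x) = pt (x :: 'a::field ^ 'n::finite)"
  by (subst pt_eq_iff) (auto intro!: exI[of _ "inverse a"] simp: vec_eq_iff)

lemma rep_proj_pt:
  fixes x :: "'a::field ^ 'n::finite"
  assumes "x \<noteq> 0"
  obtains a where "a \<noteq> 0" "rep_proj (pt x) = a *s x"
proof -
  have "proj_rel x x" using assms unfolding proj_rel_def by (intro conjI exI[of _ 1]) simp_all
  then have "proj_rel (rep_proj (pt x)) x" by (rule Quotient_rep_abs[OF Quotient_proj])
  then obtain a where a: "a \<noteq> 0" "x = a *s rep_proj (pt x)" by (auto simp: proj_rel_def)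
  have "inverse a *s (a *s rep_proj (pt x)) = rep_proj (pt x)" using a(1) by (simp add: vec_eq_iff)
  then show thesis using that[of "inverse a"] a by simp
qed

lemma pt_vec2_eq_iff:
  fixes v w :: "'a::field ^ 2"
  assumes "v \<noteq> 0" "w \<noteq> 0"
  shows "pt v = pt w \<longleftrightarrow> v $ 0 * w $ 1 = v $ 1 * w $ 0"
proof
  assume "pt v = pt w"
  then obtain a where "w = a *s v" using assms by (auto simp: pt_eq_iff)
  then show "v $ 0 * w $ 1 = v $ 1 * w $ 0" by simp
next
  assume eq: "v $ 0 * w $ 1 = v $ 1 * w $ 0"
  show "pt v = pt w"
  proof (cases "v $ 0 = 0")
    case True
    then have "v $ 1 \<noteq> 0" "w $ 0 = 0" using assms(1) eq by (auto simp: vec2_eq_iff)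
    moreover from this have "w $ 1 \<noteq> 0" using assms(2) by (auto simp: vec2_eq_iff)
    ultimately show ?thesis using assms True
      by (subst pt_eq_iff) (auto simp: vec2_eq_iff intro!: exI[of _ "w $ 1 / v $ 1"])
  next
    case False
    then have "w $ 1 = w $ 0 / v $ 0 * v $ 1" using eq by (simp add: field_simps)
    moreover from this have "w $ 0 \<noteq> 0" using assms(2) by (auto simp: vec2_eq_iff)
    ultimately show ?thesis using assms False
      by (subst pt_eq_iff) (auto simp: vec2_eq_iff intro!: exI[of _ "w $ 0 / v $ 0"])
  qed
qed

lemma mu4_curve_eqs:
  assumes "x \<noteq> 0" "pt x \<in> mu4_curve c"
  shows "mu4_eqs c x"
proof -
  obtain z where z: "z \<noteq> 0" "mu4_eqs c z" "pt x = pt z" using assms(2) by (auto simp: mu4_curve_def)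
  then obtain a where "x = a *s z" using assms(1) by (metis pt_eq_iff)
  moreover have "(a * z $ 0 + a * z $ 2)\<^sup>2 = a\<^sup>2 * (z $ 0 + z $ 2)\<^sup>2"
    "(a * z $ 1 + a * z $ 3)\<^sup>2 = a\<^sup>2 * (z $ 1 + z $ 3)\<^sup>2"
    by (simp_all add: power2_eq_square algebra_simps)
  ultimately show ?thesis using z(2) by (simp add: mu4_eqs_def power2_eq_square mult_ac)
qed

context mu4
begin

lemma kummer_O: "kummer c (mu4_O c) = pt (vec2 1 0)"
proof -
  have "vec4 c 1 0 1 \<noteq> (0 :: 'a ^ 4)" by (simp add: vec4_eq_iff)
  then obtain a where a: "a \<noteq> 0" "rep_proj (mu4_O c) = a *s vec4 c 1 0 1"
    unfolding mu4_O_def by (rule rep_proj_pt)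
  then have "kummer c (mu4_O c) = pt (vec2 (c * (a * c)) 0)"
    using c0 by (simp add: kummer_def vec2_eq_iff ch2)
  also have "\<dots> = pt (vec2 1 0)" using a c0 by (subst pt_vec2_eq_iff) (auto simp: vec2_eq_iff)
  finally show ?thesis .
qed

text \<open>At \<open>u = 0\<close> the first tuple of \<open>kummer\<close> vanishes and the second
  takes over.\<close>

lemma kummer_aff: "kummer c (aff u y) = pt (vec2 u 1)"
proof -
  have "vec4 (u\<^sup>2) y 1 (y + c * u) \<noteq> 0" by (simp add: vec4_eq_iff)
  then obtain a where a: "a \<noteq> 0" "rep_proj (aff u y) = a *s vec4 (u\<^sup>2) y 1 (y + c * u)"
    unfolding aff_def by (rule rep_proj_pt)
  have "a * y + a * (y + c * u) = a * c * u" by (simp add: algebra_simps ch2)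
  then have "kummer c (aff u y) = pt (if u \<noteq> 0 then vec2 (c * (a * u\<^sup>2)) (a * c * u) else vec2 0 (c * a))"
    using a c0 by (simp add: kummer_def vec2_eq_iff Let_def two)
  also have "\<dots> = pt (vec2 u 1)"
    using a c0 by (subst pt_vec2_eq_iff) (auto simp: vec2_eq_iff power2_eq_square)
  finally show ?thesis .
qed

lemma kummer_krel:
  assumes "R \<in> mu4_curve c" "v \<noteq> 0" "krel R v"
  shows "kummer c R = pt v"
  using assms(1)
proof (cases rule: mu4_curve_cases)
  case 1
  then show ?thesis using assms(2,3) unfolding 1 kummer_O
    by (subst pt_vec2_eq_iff) (auto simp: krel_def vec2_eq_iff)
next
  case (2 u y)
  then show ?thesis using assms(2,3) unfolding 2(2) kummer_aff
    by (subst pt_vec2_eq_iff) (auto simp: krel_def vec2_eq_iff)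
qed

text \<open>Valid for \<open>v = 0\<close> as well, so both tuples yield linear relations without a
  case distinction.\<close>

lemma krel_cross:
  assumes "R \<in> mu4_curve c" "V \<noteq> 0" "kummer c R = pt V" "krel R v"
  shows "v $ 0 * V $ 1 = v $ 1 * V $ 0"
proof (cases "v = 0")
  case False
  then show ?thesis using kummer_krel[OF assms(1) False assms(4)] assms(2,3) pt_vec2_eq_iff by metis
qed simp

lemma nrep_iff:
  assumes "x \<noteq> 0" "mu4_eqs c x"
  obtains a x' where "a \<noteq> 0" "x = a *s x'" "nrep (pt x) x'"
proof -
  have "pt x \<in> mu4_curve c" using assms by (auto simp: mu4_curve_def)
  then obtain x' where x': "nrep (pt x) x'" by (rule nrep_exists)
  then have "pt x = pt x'" unfolding nrep_def mu4_O_def aff_def by auto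
  moreover have "x' \<noteq> 0" using x' by (auto simp: nrep_def vec4_eq_iff)
  ultimately obtain a where "a \<noteq> 0" "x = a *s x'" using assms(1) by (metis pt_eq_iff)
  then show thesis using x' by (rule that)
qed

lemma diff_scale: "diff1 (a *s s) (b *s x) = (a * b) *s diff1 s x"
  "diff2 (a *s s) (b *s x) = (a * b) *s diff2 s x"
  by (simp_all add: diff1_def diff2_def vec2_eq_iff algebra_simps)

lemma krel_scale: "krel R v \<Longrightarrow> krel R (a *s v)"
  by (auto simp: krel_def)

lemma mu4_diff_coords:
  assumes "x \<noteq> 0" "mu4_eqs c x" "s \<noteq> 0" "mu4_eqs c s"
  shows "mu4_diff c (pt x) (pt s) \<in> mu4_curve c" "diff1 s x \<noteq> 0 \<or> diff2 s x \<noteq> 0"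
    "krel (mu4_diff c (pt x) (pt s)) (diff1 s x)" "krel (mu4_diff c (pt x) (pt s)) (diff2 s x)"
proof -
  obtain a x' where x: "a \<noteq> 0" "x = a *s x'" "nrep (pt x) x'" using nrep_iff[OF assms(1,2)] .
  obtain b s' where s: "b \<noteq> 0" "s = b *s s'" "nrep (pt s) s'" using nrep_iff[OF assms(3,4)] .
  note * = mu4_diff_nrep[OF x(3) s(3)]
  show "mu4_diff c (pt x) (pt s) \<in> mu4_curve c" by (rule *)
  have d: "diff1 s x = (b * a) *s diff1 s' x'" "diff2 s x = (b * a) *s diff2 s' x'"
    using x(2) s(2) diff_scale by metis+
  show "krel (mu4_diff c (pt x) (pt s)) (diff1 s x)" "krel (mu4_diff c (pt x) (pt s)) (diff2 s x)"
    unfolding d by (intro krel_scale *)+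
  show "diff1 s x \<noteq> 0 \<or> diff2 s x \<noteq> 0"
    using *(2) x(1) s(1) unfolding d by (auto simp: vec2_eq_iff)
qed

section \<open>The equation of the Kummer-oriented curve\<close>

definition oriented_eq :: "'a ^ 4 \<Rightarrow> 'a ^ 2 \<Rightarrow> 'a ^ 2 \<Rightarrow> bool" where
  "oriented_eq s U V \<longleftrightarrow>
    s $ 0 * (U $ 0 * V $ 1 + U $ 1 * V $ 0)\<^sup>2 + s $ 2 * (U $ 0 * V $ 0 + U $ 1 * V $ 1)\<^sup>2
      = c * (s $ 1 + s $ 3) * U $ 0 * U $ 1 * V $ 0 * V $ 1"

lemma oriented_eq_scale:
  assumes "a \<noteq> 0" "b \<noteq> 0"
  shows "oriented_eq s (a *s U) (b *s V) \<longleftrightarrow> oriented_eq s U V"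
proof -
  have h1: "s $ 0 * (a * U $ 0 * (b * V $ 1) + a * U $ 1 * (b * V $ 0))\<^sup>2
      + s $ 2 * (a * U $ 0 * (b * V $ 0) + a * U $ 1 * (b * V $ 1))\<^sup>2
      = (a * b)\<^sup>2 * (s $ 0 * (U $ 0 * V $ 1 + U $ 1 * V $ 0)\<^sup>2 + s $ 2 * (U $ 0 * V $ 0 + U $ 1 * V $ 1)\<^sup>2)"
    by (simp add: power2_eq_square algebra_simps)
  have h2: "c * (s $ 1 + s $ 3) * (a * U $ 0) * (a * U $ 1) * (b * V $ 0) * (b * V $ 1)
      = (a * b)\<^sup>2 * (c * (s $ 1 + s $ 3) * U $ 0 * U $ 1 * V $ 0 * V $ 1)"
    by (simp add: power2_eq_square mult_ac)
  have "(a * b)\<^sup>2 \<noteq> 0" using assms by simp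
  then show ?thesis unfolding oriented_eq_def vector_smult_component h1 h2
    by (simp only: mult_cancel_left simp_thms)
qed

text \<open>
  Over \<open>U = (u : 1)\<close> the equation is a quadratic form in \<open>V\<close>; by the next identity its two zeros
  are the points given by the two tuples for the two points \<open>Q\<close> above \<open>U\<close>.
\<close>

lemma oriented_key:
  assumes s: "mu4_eqs c s" and uy: "aff_eq u y"
  shows "((s $ 1 + s $ 3) * y + c * s $ 1 * u) * ((s $ 1 + s $ 3) * y + c * s $ 3 * u)
      = (s $ 0 * u\<^sup>2 + s $ 2) * (s $ 2 * u\<^sup>2 + s $ 0)"
proof -
  have s1: "(s $ 0 + s $ 2)\<^sup>2 = c\<^sup>2 * s $ 1 * s $ 3" and s2: "(s $ 1 + s $ 3)\<^sup>2 = c\<^sup>2 * s $ 0 * s $ 2"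
    using s by (simp_all add: mu4_eqs_def)
  have y: "y\<^sup>2 + c * u * y = d * (u ^ 4 + 1)" using uy by (simp add: aff_eq_def add_ac ch2)
  have "((s $ 1 + s $ 3) * y + c * s $ 1 * u) * ((s $ 1 + s $ 3) * y + c * s $ 3 * u)
      = (s $ 1 + s $ 3)\<^sup>2 * (y\<^sup>2 + c * u * y) + (c\<^sup>2 * s $ 1 * s $ 3) * u\<^sup>2"
    by (simp add: power2_eq_square algebra_simps ch2)
  also have "\<dots> = s $ 0 * s $ 2 * (c\<^sup>2 * (d * (u ^ 4 + 1))) + (s $ 0 + s $ 2)\<^sup>2 * u\<^sup>2"
    unfolding y s1 s2 by (simp add: mult_ac)
  also have "\<dots> = (s $ 0 * u\<^sup>2 + s $ 2) * (s $ 2 * u\<^sup>2 + s $ 0)"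
    unfolding cd_cancel square_add by (simp add: power2_eq_square algebra_simps numeral_eq_Suc)
  finally show ?thesis .
qed

lemma oriented_eq_aff:
  "oriented_eq s (vec2 u 1) V \<longleftrightarrow>
    (s $ 0 * u\<^sup>2 + s $ 2) * (V $ 1)\<^sup>2 + (s $ 2 * u\<^sup>2 + s $ 0) * (V $ 0)\<^sup>2
      = c * (s $ 1 + s $ 3) * u * V $ 0 * V $ 1"
  unfolding oriented_eq_def square_add by (simp add: power_mult_distrib algebra_simps)

lemma oriented_eq_infinity:
  "oriented_eq s (vec2 1 0) V \<longleftrightarrow> s $ 0 * (V $ 1)\<^sup>2 + s $ 2 * (V $ 0)\<^sup>2 = 0"
  unfolding oriented_eq_def by simp

lemma diff_aff:
  assumes "x = vec4 (u\<^sup>2) y 1 (y + c * u)"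
  shows "diff1 s x = vec2 (s $ 0 * u\<^sup>2 + s $ 2) ((s $ 1 + s $ 3) * y + c * s $ 1 * u)"
    "diff2 s x = vec2 ((s $ 1 + s $ 3) * y + c * s $ 3 * u) (s $ 2 * u\<^sup>2 + s $ 0)"
  unfolding assms by (simp_all add: diff1_def diff2_def vec2_eq_iff algebra_simps)

lemma diff_O:
  "diff1 s (vec4 c 1 0 1) = vec2 (s $ 0 * c) (s $ 1 + s $ 3)"
  "diff2 s (vec4 c 1 0 1) = vec2 (s $ 1 + s $ 3) (s $ 2 * c)"
  by (simp_all add: diff1_def diff2_def vec2_eq_iff algebra_simps)

text \<open>Each tuple gives a relation linear in \<open>V\<close>. Multiplying by the entries of
  \<open>V\<close> and adding, the entries that involve \<open>y\<close> enter only through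
  \<open>f1 + g0\<close>, in which \<open>y\<close> cancels.\<close>

lemma oriented_eq_difference:
  assumes s: "s \<noteq> 0" "mu4_eqs c s" and Q: "Q \<in> mu4_curve c" and "U \<noteq> 0" "V \<noteq> 0"
    "kummer c Q = pt U" "kummer c (mu4_diff c Q (pt s)) = pt V"
  shows "oriented_eq s U V"
proof -
  have key: "oriented_eq s (vec2 u 1) V" if "aff_eq u y" "Q = aff u y" for u y
  proof -
    let ?p = "s $ 1 + s $ 3"
    define x where "x = vec4 (u\<^sup>2) y 1 (y + c * u)"
    have x: "x \<noteq> 0" "mu4_eqs c x" "Q = pt x"
      using that mu4_eqs_aff by (simp_all add: x_def aff_def vec4_eq_iff)
    note D = mu4_diff_coords[OF x(1,2) s, folded x(3)]
    define f0 f1 g0 g1 where "f0 = s $ 0 * u\<^sup>2 + s $ 2" and "f1 = ?p * y + c * s $ 1 * u"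
      and "g0 = ?p * y + c * s $ 3 * u" and "g1 = s $ 2 * u\<^sup>2 + s $ 0"
    note defs = f0_def f1_def g0_def g1_def
    have fg: "diff1 s x = vec2 f0 f1" "diff2 s x = vec2 g0 g1"
      unfolding diff_aff[OF x_def] defs by simp_all
    have 1: "f0 * V $ 1 = f1 * V $ 0" and 2: "g0 * V $ 1 = g1 * V $ 0"
      using krel_cross[OF D(1) \<open>V \<noteq> 0\<close> assms(7)] D(3,4) unfolding fg by fastforce+
    have "f0 * (V $ 1)\<^sup>2 + g1 * (V $ 0)\<^sup>2 = (f0 * V $ 1) * V $ 1 + (g1 * V $ 0) * V $ 0"
      by (simp add: power2_eq_square)
    also have "\<dots> = (f1 + g0) * V $ 0 * V $ 1" unfolding 1 2[symmetric] by (simp add: algebra_simps)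
    also have "f1 + g0 = c * ?p * u" by (simp add: defs algebra_simps ch2)
    finally show ?thesis unfolding oriented_eq_aff defs .
  qed
  show ?thesis using Q
  proof (cases rule: mu4_curve_cases)
    case 1
    have x: "vec4 c 1 0 1 \<noteq> 0" "mu4_eqs c (vec4 c 1 0 1)"
      by (simp_all add: vec4_eq_iff mu4_eqs_def ch2)
    note D = mu4_diff_coords[OF x s, folded mu4_O_def 1(1)]
    let ?p = "s $ 1 + s $ 3"
    have 2: "s $ 0 * c * V $ 1 = ?p * V $ 0" "?p * V $ 1 = s $ 2 * c * V $ 0"
      using krel_cross[OF D(1) \<open>V \<noteq> 0\<close> assms(7)] D(3,4) unfolding diff_O by fastforce+
    have "c * (s $ 0 * (V $ 1)\<^sup>2 + s $ 2 * (V $ 0)\<^sup>2)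
        = (s $ 0 * c * V $ 1) * V $ 1 + (s $ 2 * c * V $ 0) * V $ 0"
      by (simp add: algebra_simps power2_eq_square)
    also have "\<dots> = 0" unfolding 2(1) 2(2)[symmetric] by (simp add: mult_ac ch2)
    finally have "oriented_eq s (vec2 1 0) V" using c0 unfolding oriented_eq_infinity by simp
    moreover have "pt (vec2 1 0) = pt U" using assms(6) 1 kummer_O by simp
    then obtain a where "a \<noteq> 0" "U = a *s vec2 1 0"
      using \<open>U \<noteq> 0\<close> by (subst (asm) pt_eq_iff) (auto simp: vec2_eq_iff)
    ultimately show ?thesis using oriented_eq_scale[of a 1 s "vec2 1 0" V] by simp
  next
    case (2 u y)
    have "pt (vec2 u 1) = pt U" using assms(6) 2 kummer_aff by simp
    then obtain a where "a \<noteq> 0" "U = a *s vec2 u 1"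
      using \<open>U \<noteq> 0\<close> by (subst (asm) pt_eq_iff) (auto simp: vec2_eq_iff)
    then show ?thesis using oriented_eq_scale[of a 1 s "vec2 u 1" V] key[OF 2] by simp
  qed
qed

end

section \<open>Points above a solution of the equation, and the inverse map\<close>

definition lambda_inv1 :: "'a::field \<Rightarrow> 'a ^ 4 \<Rightarrow> 'a ^ 2 \<Rightarrow> 'a ^ 2 \<Rightarrow> 'a ^ 4" where
  "lambda_inv1 c s U V = vec4
     ((s $ 1 + s $ 3) * (U $ 0)\<^sup>2 * V $ 0)
     ((s $ 0 * (U $ 0)\<^sup>2 + s $ 2 * (U $ 1)\<^sup>2) * V $ 1 + c * s $ 1 * U $ 0 * U $ 1 * V $ 0)
     ((s $ 1 + s $ 3) * (U $ 1)\<^sup>2 * V $ 0)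
     ((s $ 0 * (U $ 0)\<^sup>2 + s $ 2 * (U $ 1)\<^sup>2) * V $ 1 + c * s $ 3 * U $ 0 * U $ 1 * V $ 0)"

definition lambda_inv2 :: "'a::field \<Rightarrow> 'a ^ 4 \<Rightarrow> 'a ^ 2 \<Rightarrow> 'a ^ 2 \<Rightarrow> 'a ^ 4" where
  "lambda_inv2 c s U V = vec4
     ((s $ 1 + s $ 3) * (U $ 0)\<^sup>2 * V $ 1)
     ((s $ 2 * (U $ 0)\<^sup>2 + s $ 0 * (U $ 1)\<^sup>2) * V $ 0 + c * s $ 3 * U $ 0 * U $ 1 * V $ 1)
     ((s $ 1 + s $ 3) * (U $ 1)\<^sup>2 * V $ 1)
     ((s $ 2 * (U $ 0)\<^sup>2 + s $ 0 * (U $ 1)\<^sup>2) * V $ 0 + c * s $ 1 * U $ 0 * U $ 1 * V $ 1)"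

context mu4
begin

lemma kummer_eq_pt:
  assumes "Q \<in> mu4_curve c" "U \<noteq> 0" "kummer c Q = pt U"
  obtains a where "Q = mu4_O c" "a \<noteq> 0" "U = a *s vec2 1 0"
    | a u y where "aff_eq u y" "Q = aff u y" "a \<noteq> 0" "U = a *s vec2 u 1"
  using assms(1)
proof (cases rule: mu4_curve_cases)
  case 1
  then have "pt (vec2 1 0) = pt U" using assms(3) kummer_O by simp
  then obtain a where "a \<noteq> 0" "U = a *s vec2 1 0"
    using assms(2) by (subst (asm) pt_eq_iff) (auto simp: vec2_eq_iff)
  then show thesis using 1 that(1) by blast
next
  case (2 u y)
  then have "pt (vec2 u 1) = pt U" using assms(3) kummer_aff by simp
  then obtain a where "a \<noteq> 0" "U = a *s vec2 u 1"
    using assms(2) by (subst (asm) pt_eq_iff) (auto simp: vec2_eq_iff)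
  then show thesis using 2 that(2) by blast
qed

lemma kummer_difference_eqI:
  assumes s: "s \<noteq> 0" "mu4_eqs c s" and x: "x \<noteq> 0" "mu4_eqs c x" and "V \<noteq> 0"
    and "w = diff1 s x \<or> w = diff2 s x" "w \<noteq> 0" "w $ 0 * V $ 1 = w $ 1 * V $ 0"
  shows "kummer c (mu4_diff c (pt x) (pt s)) = pt V"
proof -
  note D = mu4_diff_coords[OF x s]
  have "kummer c (mu4_diff c (pt x) (pt s)) = pt w"
    using D assms(6,7) by (intro kummer_krel) auto
  then show ?thesis using assms(5,7,8) pt_vec2_eq_iff by metis
qed

lemma oriented_eq_surj:
  assumes s: "s \<noteq> 0" "mu4_eqs c s" and UV: "U \<noteq> 0" "V \<noteq> 0" "oriented_eq s U V"
  obtains Q where "Q \<in> mu4_curve c" "kummer c Q = pt U" "kummer c (mu4_diff c Q (pt s)) = pt V"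
proof (cases "U $ 1 = 0")
  case True
  define a where "a = U $ 0"
  have U: "U = a *s vec2 1 0" and a: "a \<noteq> 0" using True UV(1) by (auto simp: a_def vec2_eq_iff)
  have "oriented_eq s (vec2 1 0) V"
    using UV(3) oriented_eq_scale[of a 1 s "vec2 1 0" V] a by (simp add: U)
  then have eq: "s $ 0 * (V $ 1)\<^sup>2 = s $ 2 * (V $ 0)\<^sup>2"
    unfolding oriented_eq_infinity by (metis add_eq_0_iff2 ch2(1))
  have x: "vec4 c 1 0 1 \<noteq> 0" "mu4_eqs c (vec4 c 1 0 1)"
    by (simp_all add: vec4_eq_iff mu4_eqs_def ch2)
  have s2: "(s $ 1 + s $ 3)\<^sup>2 = c\<^sup>2 * s $ 0 * s $ 2" using s(2) by (simp add: mu4_eqs_def)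
  \<comment> \<open>Both linear relations follow by comparing squares, which is enough in
    characteristic 2.\<close>
  have "(s $ 0 * c * V $ 1)\<^sup>2 = c\<^sup>2 * s $ 0 * (s $ 0 * (V $ 1)\<^sup>2)"
    by (simp add: power2_eq_square mult_ac)
  also have "\<dots> = ((s $ 1 + s $ 3) * V $ 0)\<^sup>2" unfolding eq power_mult_distrib s2 by (simp add: mult_ac)
  finally have 1: "s $ 0 * c * V $ 1 = (s $ 1 + s $ 3) * V $ 0" unfolding square_eq_iff .
  have "((s $ 1 + s $ 3) * V $ 1)\<^sup>2 = c\<^sup>2 * s $ 2 * (s $ 0 * (V $ 1)\<^sup>2)"
    unfolding power_mult_distrib s2 by (simp add: mult_ac)
  also have "\<dots> = (s $ 2 * c * V $ 0)\<^sup>2" unfolding eq by (simp add: power2_eq_square mult_ac)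
  finally have 2: "(s $ 1 + s $ 3) * V $ 1 = s $ 2 * c * V $ 0" unfolding square_eq_iff .
  obtain w where w: "w = diff1 s (vec4 c 1 0 1) \<or> w = diff2 s (vec4 c 1 0 1)" "w \<noteq> 0"
    using mu4_diff_coords(2)[OF x s] by blast
  have "w $ 0 * V $ 1 = w $ 1 * V $ 0" using w(1) 1 2 unfolding diff_O by auto
  then have "kummer c (mu4_diff c (mu4_O c) (pt s)) = pt V"
    using kummer_difference_eqI[OF s x UV(2) w] by (simp add: mu4_O_def)
  moreover have "kummer c (mu4_O c) = pt U"
    unfolding kummer_O U using a by (intro pt_scale[symmetric]) (simp_all add: vec2_eq_iff)
  ultimately show thesis using that O_in_curve by blast
next
  case False
  define a where "a = U $ 1"
  define u where "u = U $ 0 / a"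
  have U: "U = a *s vec2 u 1" and a: "a \<noteq> 0" using False by (auto simp: a_def u_def vec2_eq_iff)
  have eq: "oriented_eq s (vec2 u 1) V"
    using UV(3) oriented_eq_scale[of a 1 s "vec2 u 1" V] a by (simp add: U)
  obtain y where y: "aff_eq u y" by (rule aff_eq_exists)
  let ?p = "s $ 1 + s $ 3"
  define f0 f1 g0 g1 where "f0 = s $ 0 * u\<^sup>2 + s $ 2" and "f1 = ?p * y + c * s $ 1 * u"
    and "g0 = ?p * y + c * s $ 3 * u" and "g1 = s $ 2 * u\<^sup>2 + s $ 0"
  note defs = f0_def f1_def g0_def g1_def
  have key: "f1 * g0 = f0 * g1" using oriented_key[OF s(2) y] by (simp add: defs)
  have "f1 + g0 = c * ?p * u" by (simp add: defs algebra_simps ch2)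
  then have E: "f0 * (V $ 1)\<^sup>2 + g1 * (V $ 0)\<^sup>2 = (f1 + g0) * V $ 0 * V $ 1"
    using eq unfolding oriented_eq_aff defs by simp
  define x where "x y = vec4 (u\<^sup>2) y 1 (y + c * u)" for y
  have fg: "diff1 s (x y) = vec2 f0 f1" "diff2 s (x y) = vec2 g0 g1"
    unfolding diff_aff[OF x_def] defs by simp_all
  \<comment> \<open>For the conjugate point \<open>f1\<close> and \<open>g0\<close> trade
    places.\<close>
  have fg': "diff1 s (x (y + c * u)) = vec2 f0 g0" "diff2 s (x (y + c * u)) = vec2 f1 g1"
    unfolding diff_aff[OF x_def] defs by (simp_all add: vec2_eq_iff algebra_simps ch2)
  have x: "x y \<noteq> 0" "mu4_eqs c (x y)" if "aff_eq u y" for y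
    using mu4_eqs_aff[OF that] by (simp_all add: x_def vec4_eq_iff)
  have ptx: "pt (x y) = aff u y" for y by (simp add: x_def aff_def)
  note result = that
  have main: thesis if "aff_eq u y'" "w = diff1 s (x y') \<or> w = diff2 s (x y')" "w \<noteq> 0"
      "w $ 0 * V $ 1 = w $ 1 * V $ 0" for y' w
  proof -
    have "kummer c (mu4_diff c (aff u y') (pt s)) = pt V"
      using kummer_difference_eqI[OF s x[OF that(1)] UV(2) that(2-4)] by (simp add: ptx)
    moreover have "kummer c (aff u y') = pt U"
      unfolding kummer_aff U using a by (intro pt_scale[symmetric]) (simp_all add: vec2_eq_iff)
    ultimately show thesis using result aff_in_curve[OF that(1)] by blast
  qed
  note y' = aff_eq_conj[OF y]
  have nz: "f0 \<noteq> 0 \<or> f1 \<noteq> 0 \<or> g0 \<noteq> 0 \<or> g1 \<noteq> 0"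
    using mu4_diff_coords(2)[OF x[OF y] s] unfolding fg by (auto simp: vec2_eq_iff)
  consider "f0 \<noteq> 0" | "g1 \<noteq> 0" | "f0 = 0" "g1 = 0" by blast
  then show thesis
  proof cases
    case 1
    \<comment> \<open>By \<open>key\<close>, the quadratic form times \<open>f0\<close> splits into
      two linear factors, one for each point above \<open>U\<close>.\<close>
    have "(f0 * V $ 1 + f1 * V $ 0) * (f0 * V $ 1 + g0 * V $ 0)
        = f0 * (f0 * (V $ 1)\<^sup>2) + f0 * ((f1 + g0) * V $ 0 * V $ 1) + (f1 * g0) * (V $ 0)\<^sup>2"
      by (simp add: algebra_simps power2_eq_square)
    also have "\<dots> = 0" unfolding key E[symmetric] by (simp add: algebra_simps ch2)
    finally have "f0 * V $ 1 = f1 * V $ 0 \<or> f0 * V $ 1 = g0 * V $ 0"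
      by (metis add_eq_0_iff2 ch2(1) mult_eq_0_iff)
    then show thesis
      using main[OF y, of "vec2 f0 f1"] main[OF y', of "vec2 f0 g0"] 1 fg fg'
      by (auto simp: vec2_eq_iff)
  next
    case 2
    have "(g1 * V $ 0 + f1 * V $ 1) * (g1 * V $ 0 + g0 * V $ 1)
        = g1 * (g1 * (V $ 0)\<^sup>2) + g1 * ((f1 + g0) * V $ 0 * V $ 1) + (f1 * g0) * (V $ 1)\<^sup>2"
      by (simp add: algebra_simps power2_eq_square)
    also have "\<dots> = 0" unfolding key E[symmetric] by (simp add: algebra_simps ch2)
    finally have "f1 * V $ 1 = g1 * V $ 0 \<or> g0 * V $ 1 = g1 * V $ 0"
      by (metis add_eq_0_iff2 ch2(1) mult_eq_0_iff)
    then show thesis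
      using main[OF y, of "vec2 g0 g1"] main[OF y', of "vec2 f1 g1"] 2 fg fg'
      by (auto simp: vec2_eq_iff)
  next
    case 3
    \<comment> \<open>Exactly one of \<open>f1\<close>, \<open>g0\<close> is nonzero now, and the
      form is a multiple of the product of the entries of \<open>V\<close>; each of its two zeros
      belongs to one of the conjugate points.\<close>
    have "f1 * g0 = 0" using key 3 by simp
    moreover have "f1 + g0 = 0 \<or> V $ 0 = 0 \<or> V $ 1 = 0" using E 3 by auto
    ultimately consider "f1 \<noteq> 0" "V $ 0 = 0" | "f1 \<noteq> 0" "V $ 1 = 0"
      | "g0 \<noteq> 0" "V $ 0 = 0" | "g0 \<noteq> 0" "V $ 1 = 0"
      using nz 3 by fastforce
    then show thesis
    proof cases
      case 1
      then show thesis using main[OF y, of "vec2 f0 f1"] 3 fg by (auto simp: vec2_eq_iff)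
    next
      case 2
      then show thesis using main[OF y', of "vec2 f1 g1"] 3 fg' by (auto simp: vec2_eq_iff)
    next
      case third: 3
      then show thesis using main[OF y', of "vec2 f0 g0"] 3 fg' by (auto simp: vec2_eq_iff)
    next
      case 4
      then show thesis using main[OF y, of "vec2 g0 g1"] 3 fg by (auto simp: vec2_eq_iff)
    qed
  qed
qed

lemma kummer_in_P1:
  assumes "Q \<in> mu4_curve c"
  obtains U where "U \<noteq> 0" "kummer c Q = pt U"
  using assms
proof (cases rule: mu4_curve_cases)
  case 1
  then show thesis using that[of "vec2 1 0"] kummer_O by (simp add: vec2_eq_iff)
next
  case (2 u y)
  then show thesis using that[of "vec2 u 1"] kummer_aff by (simp add: vec2_eq_iff)
qed

lemma kummer_oriented_curve_image:
  assumes "S \<in> mu4_curve c"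
  shows "kummer_oriented_curve c S = kummer_lambda c S ` mu4_curve c"
  unfolding kummer_oriented_curve_def Delta_eq[OF assms] image_image
  by (simp add: kummer_lambda_def)

lemma mu4_diff_in_curve:
  assumes "Q \<in> mu4_curve c" "S \<in> mu4_curve c"
  shows "mu4_diff c Q S \<in> mu4_curve c"
  using assms mu4_diff_nrep(1) by (metis nrep_exists)

lemma kummer_oriented_curve_eq:
  assumes s: "s \<noteq> 0" "mu4_eqs c s"
  shows "kummer_oriented_curve c (pt s) = {(pt U, pt V) | U V. U \<noteq> 0 \<and> V \<noteq> 0 \<and> oriented_eq s U V}"
proof -
  have S: "pt s \<in> mu4_curve c" using s by (auto simp: mu4_curve_def)
  show ?thesis unfolding kummer_oriented_curve_image[OF S]
  proof (rule equalityI; rule subsetI)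
    fix z assume "z \<in> kummer_lambda c (pt s) ` mu4_curve c"
    then obtain Q where Q: "Q \<in> mu4_curve c" "z = (kummer c Q, kummer c (mu4_diff c Q (pt s)))"
      by (auto simp: kummer_lambda_def)
    obtain U where U: "U \<noteq> 0" "kummer c Q = pt U" using kummer_in_P1[OF Q(1)] .
    obtain V where V: "V \<noteq> 0" "kummer c (mu4_diff c Q (pt s)) = pt V"
      using kummer_in_P1[OF mu4_diff_in_curve[OF Q(1) S]] .
    have "oriented_eq s U V" by (rule oriented_eq_difference[OF s Q(1) U(1) V(1) U(2) V(2)])
    then show "z \<in> {(pt U, pt V) | U V. U \<noteq> 0 \<and> V \<noteq> 0 \<and> oriented_eq s U V}"
      using Q(2) U V by auto
  next
    fix z assume "z \<in> {(pt U, pt V) | U V. U \<noteq> 0 \<and> V \<noteq> 0 \<and> oriented_eq s U V}"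
    then obtain U V where UV: "U \<noteq> 0" "V \<noteq> 0" "oriented_eq s U V" and z: "z = (pt U, pt V)" by blast
    obtain Q where "Q \<in> mu4_curve c" "kummer c Q = pt U" "kummer c (mu4_diff c Q (pt s)) = pt V"
      using oriented_eq_surj[OF s UV] .
    then show "z \<in> kummer_lambda c (pt s) ` mu4_curve c"
      unfolding z by (auto simp: kummer_lambda_def intro!: image_eqI[of _ _ Q])
  qed
qed

text \<open>\<open>[-1]\<close> exchanges \<open>X1\<close> and \<open>X3\<close>, so equality of
  these coordinates makes the point its own opposite.\<close>

lemma two_torsionI:
  assumes "s \<noteq> 0" "mu4_eqs c s" "s $ 1 + s $ 3 = 0"
  shows "two_torsion c (pt s)"
proof -
  obtain a x where x: "a \<noteq> 0" "s = a *s x" "nrep (pt s) x" using nrep_iff[OF assms(1,2)] .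
  have "a * (x $ 1 + x $ 3) = 0" using assms(3) x(2) by (simp add: distrib_left)
  then have 0: "x $ 1 + x $ 3 = 0" using x(1) by simp
  have "opp (pt s) (pt s)" using x(3) unfolding nrep_def
  proof (elim disjE exE conjE)
    fix u y assume *: "aff_eq u y" "pt s = aff u y" "x = vec4 (u\<^sup>2) y 1 (y + c * u)"
    have "c * u = 0" using 0 unfolding *(3) by (simp add: ch2)
    then show ?thesis using * unfolding opp_def by (intro disjI2 exI[of _ u] exI[of _ y]) auto
  qed (simp add: opp_def)
  then show ?thesis by (rule two_torsion_opp)
qed

text \<open>The tuples equal \<open>k V0\<close> and \<open>k V1\<close> times coordinates of
  \<open>Q\<close>, where \<open>V0\<close>, \<open>V1\<close> are the entries of \<open>V\<close>.
  The factor \<open>k\<close> contains \<open>s1 + s3\<close>, which is why that sum must be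
  nonzero.\<close>

lemma lambda_inverse:
  assumes s: "s \<noteq> 0" "mu4_eqs c s" "s $ 1 + s $ 3 \<noteq> 0"
    and Q: "Q \<in> mu4_curve c" and UV: "U \<noteq> 0" "V \<noteq> 0" "kummer_lambda c (pt s) Q = (pt U, pt V)"
  shows "lambda_inv1 c s U V \<noteq> 0 \<or> lambda_inv2 c s U V \<noteq> 0"
    "lambda_inv1 c s U V \<noteq> 0 \<Longrightarrow> pt (lambda_inv1 c s U V) = Q"
    "lambda_inv2 c s U V \<noteq> 0 \<Longrightarrow> pt (lambda_inv2 c s U V) = Q"
proof -
  let ?p = "s $ 1 + s $ 3"
  have kU: "kummer c Q = pt U" and kV: "kummer c (mu4_diff c Q (pt s)) = pt V"
    using UV(3) by (simp_all add: kummer_lambda_def)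
  have "\<exists>x k. x \<noteq> 0 \<and> pt x = Q \<and> k \<noteq> 0 \<and>
      lambda_inv1 c s U V = (k * V $ 0) *s x \<and> lambda_inv2 c s U V = (k * V $ 1) *s x"
    using Q UV(1) kU
  proof (cases rule: kummer_eq_pt)
    case (1 a)
    have x: "vec4 c 1 0 1 \<noteq> 0" "mu4_eqs c (vec4 c 1 0 1)"
      by (simp_all add: vec4_eq_iff mu4_eqs_def ch2)
    note D = mu4_diff_coords[OF x s(1,2), folded mu4_O_def 1(1)]
    have *: "s $ 0 * c * V $ 1 = ?p * V $ 0" "?p * V $ 1 = s $ 2 * c * V $ 0"
      using krel_cross[OF D(1) UV(2) kV] D(3,4) unfolding diff_O by fastforce+
    \<comment> \<open>Found by comparing first coordinates, where O has the entry
      \<open>c\<close>.\<close>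
    define k where "k = a\<^sup>2 * ?p / c"
    have kc: "k * c = a\<^sup>2 * ?p" using c0 by (simp add: k_def)
    have "c * (k * V $ 0) = a\<^sup>2 * (?p * V $ 0)" using kc by (simp add: mult_ac)
    also have "\<dots> = c * (a\<^sup>2 * s $ 0 * V $ 1)" unfolding *(1)[symmetric] by (simp add: mult_ac)
    finally have k0: "c * (k * V $ 0) = c * (a\<^sup>2 * s $ 0 * V $ 1)" .
    have "c * (k * V $ 1) = a\<^sup>2 * (?p * V $ 1)" using kc by (simp add: mult_ac)
    also have "\<dots> = c * (a\<^sup>2 * s $ 2 * V $ 0)" unfolding *(2) by (simp add: mult_ac)
    finally have "c * (k * V $ 1) = c * (a\<^sup>2 * s $ 2 * V $ 0)" .
    with k0 have k: "a\<^sup>2 * s $ 0 * V $ 1 = k * V $ 0" "a\<^sup>2 * s $ 2 * V $ 0 = k * V $ 1"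
      using c0 by simp_all
    have "lambda_inv1 c s U V = (k * V $ 0) *s vec4 c 1 0 1"
      "lambda_inv2 c s U V = (k * V $ 1) *s vec4 c 1 0 1"
      unfolding lambda_inv1_def lambda_inv2_def 1(3) using k kc
      by (simp_all add: vec4_eq_iff power_mult_distrib mult_ac)
    moreover have "k \<noteq> 0" using 1(2) s(3) c0 by (simp add: k_def)
    ultimately show ?thesis using x(1) 1(1) unfolding mu4_O_def by blast
  next
    case (2 a u y)
    define x where "x = vec4 (u\<^sup>2) y 1 (y + c * u)"
    have x: "x \<noteq> 0" "mu4_eqs c x" "Q = pt x"
      using 2 mu4_eqs_aff by (simp_all add: x_def aff_def vec4_eq_iff)
    note D = mu4_diff_coords[OF x(1,2) s(1,2), folded x(3)]
    have *: "(s $ 0 * u\<^sup>2 + s $ 2) * V $ 1 = (?p * y + c * s $ 1 * u) * V $ 0"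
      "(?p * y + c * s $ 3 * u) * V $ 1 = (s $ 2 * u\<^sup>2 + s $ 0) * V $ 0"
      using krel_cross[OF D(1) UV(2) kV] D(3,4) unfolding diff_aff[OF x_def] by fastforce+
    have "lambda_inv1 c s U V = a\<^sup>2 *s vec4 (?p * u\<^sup>2 * V $ 0)
        ((s $ 0 * u\<^sup>2 + s $ 2) * V $ 1 + c * s $ 1 * u * V $ 0) (?p * V $ 0)
        ((s $ 0 * u\<^sup>2 + s $ 2) * V $ 1 + c * s $ 3 * u * V $ 0)"
      unfolding lambda_inv1_def 2(4) by (simp add: vec4_eq_iff power2_eq_square algebra_simps)
    \<comment> \<open>The first relation trades the part with \<open>V $ 1\<close> for one with
      \<open>V $ 0\<close>; the terms with \<open>c * s $ 1 * u\<close> then cancel in the second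
      entry.\<close>
    also have "\<dots> = (a\<^sup>2 * ?p * V $ 0) *s x"
      unfolding * x_def by (simp add: vec4_eq_iff algebra_simps ch2)
    finally have 3: "lambda_inv1 c s U V = (a\<^sup>2 * ?p * V $ 0) *s x" .
    have "lambda_inv2 c s U V = a\<^sup>2 *s vec4 (?p * u\<^sup>2 * V $ 1)
        ((s $ 2 * u\<^sup>2 + s $ 0) * V $ 0 + c * s $ 3 * u * V $ 1) (?p * V $ 1)
        ((s $ 2 * u\<^sup>2 + s $ 0) * V $ 0 + c * s $ 1 * u * V $ 1)"
      unfolding lambda_inv2_def 2(4) by (simp add: vec4_eq_iff power2_eq_square algebra_simps)
    also have "\<dots> = (a\<^sup>2 * ?p * V $ 1) *s x"
      unfolding *(2)[symmetric] x_def by (simp add: vec4_eq_iff algebra_simps ch2)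
    finally have "lambda_inv2 c s U V = (a\<^sup>2 * ?p * V $ 1) *s x" .
    moreover have "a\<^sup>2 * ?p \<noteq> 0" using 2(3) s(3) by simp
    ultimately show ?thesis using 3 x by blast
  qed
  then obtain x k where x: "x \<noteq> 0" "pt x = Q" "k \<noteq> 0"
    "lambda_inv1 c s U V = (k * V $ 0) *s x" "lambda_inv2 c s U V = (k * V $ 1) *s x" by blast
  have nz: "z *s x \<noteq> 0 \<longleftrightarrow> z \<noteq> 0" for z using x(1) by (auto simp: vec_eq_iff)
  show "lambda_inv1 c s U V \<noteq> 0 \<or> lambda_inv2 c s U V \<noteq> 0"
    unfolding x(4,5) nz using x(3) UV(2) by (auto simp: vec2_eq_iff)
  show "lambda_inv1 c s U V \<noteq> 0 \<Longrightarrow> pt (lambda_inv1 c s U V) = Q"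
    "lambda_inv2 c s U V \<noteq> 0 \<Longrightarrow> pt (lambda_inv2 c s U V) = Q"
    unfolding x(4,5) nz x(2)[symmetric] using x(1) by (simp_all add: pt_scale)
qed

text \<open>Injectivity comes from the tuples, which recover a point from its image.\<close>

lemma lambda_bij:
  assumes s: "s \<noteq> 0" "mu4_eqs c s" "s $ 1 + s $ 3 \<noteq> 0"
  shows "bij_betw (kummer_lambda c (pt s)) (mu4_curve c) (kummer_oriented_curve c (pt s))"
    "bi_given_by (kummer_oriented_curve c (pt s)) (inv_into (mu4_curve c) (kummer_lambda c (pt s)))
      {lambda_inv1 c s, lambda_inv2 c s}"
proof -
  have S: "pt s \<in> mu4_curve c" using s by (auto simp: mu4_curve_def)
  have inj: "inj_on (kummer_lambda c (pt s)) (mu4_curve c)"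
  proof (rule inj_onI)
    fix P Q assume PQ: "P \<in> mu4_curve c" "Q \<in> mu4_curve c"
      "kummer_lambda c (pt s) P = kummer_lambda c (pt s) Q"
    obtain U where U: "U \<noteq> 0" "kummer c P = pt U" using kummer_in_P1[OF PQ(1)] .
    obtain V where V: "V \<noteq> 0" "kummer c (mu4_diff c P (pt s)) = pt V"
      using kummer_in_P1[OF mu4_diff_in_curve[OF PQ(1) S]] .
    have "kummer_lambda c (pt s) P = (pt U, pt V)" using U V by (simp add: kummer_lambda_def)
    then show "P = Q"
      using lambda_inverse[OF s PQ(1) U(1) V(1)] lambda_inverse[OF s PQ(2) U(1) V(1)] PQ(3) by metis
  qed
  then show "bij_betw (kummer_lambda c (pt s)) (mu4_curve c) (kummer_oriented_curve c (pt s))"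
    by (simp add: bij_betw_def kummer_oriented_curve_image[OF S])
  show "bi_given_by (kummer_oriented_curve c (pt s)) (inv_into (mu4_curve c) (kummer_lambda c (pt s)))
      {lambda_inv1 c s, lambda_inv2 c s}"
    unfolding bi_given_by_def
  proof (intro allI impI)
    fix U V :: "'a ^ 2" assume *: "U \<noteq> 0 \<and> V \<noteq> 0 \<and> (pt U, pt V) \<in> kummer_oriented_curve c (pt s)"
    then obtain Q where Q: "Q \<in> mu4_curve c" "kummer_lambda c (pt s) Q = (pt U, pt V)"
      unfolding kummer_oriented_curve_image[OF S] by auto
    have "inv_into (mu4_curve c) (kummer_lambda c (pt s)) (pt U, pt V) = Q"
      using inv_into_f_f[OF inj Q(1)] Q(2) by simp
    then show "(\<exists>t\<in>{lambda_inv1 c s, lambda_inv2 c s}. t U V \<noteq> 0) \<and>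
        (\<forall>t\<in>{lambda_inv1 c s, lambda_inv2 c s}. t U V \<noteq> 0 \<longrightarrow>
          inv_into (mu4_curve c) (kummer_lambda c (pt s)) (pt U, pt V) = pt (t U V))"
      using lambda_inverse[OF s Q(1) _ _ Q(2)] * by auto
  qed
qed

lemma lambda_given_by:
  assumes s: "s \<noteq> 0" "mu4_eqs c s"
  shows "given_by (mu4_curve c) (fst \<circ> kummer_lambda c (pt s))
      {\<lambda>x. vec2 (c * x $ 0) (x $ 1 + x $ 3), \<lambda>x. vec2 (x $ 1 + x $ 3) (c * x $ 2)}" (is ?fst)
    "given_by (mu4_curve c) (snd \<circ> kummer_lambda c (pt s)) {diff1 s, diff2 s}" (is ?snd)
proof -
  \<comment> \<open>As Q - O = Q, the first component is handled by the difference tuples with O in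
    place of S.\<close>
  have diff: "diff1 (vec4 c 1 0 1) x = vec2 (c * x $ 0) (x $ 1 + x $ 3)"
    "diff2 (vec4 c 1 0 1) x = vec2 (x $ 1 + x $ 3) (c * x $ 2)" for x
    by (simp_all add: diff1_def diff2_def)
  have nrep: "krel Q (diff1 (vec4 c 1 0 1) x) \<and> krel Q (diff2 (vec4 c 1 0 1) x) \<and>
      (diff1 (vec4 c 1 0 1) x \<noteq> 0 \<or> diff2 (vec4 c 1 0 1) x \<noteq> 0)" if "nrep Q x" for Q x
    using that c0 unfolding nrep_def
    by (auto simp: krel_def diff vec2_eq_iff aff_inj aff_not_O ch2 power2_eq_square algebra_simps)
  have nr: "krel (pt x) (diff1 (vec4 c 1 0 1) x) \<and> krel (pt x) (diff2 (vec4 c 1 0 1) x) \<and>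
      (diff1 (vec4 c 1 0 1) x \<noteq> 0 \<or> diff2 (vec4 c 1 0 1) x \<noteq> 0)" if x: "x \<noteq> 0" "mu4_eqs c x" for x
  proof -
    obtain a x' where x': "a \<noteq> 0" "x = a *s x'" "nrep (pt x) x'" using nrep_iff[OF x] .
    have e: "diff1 (vec4 c 1 0 1) x = a *s diff1 (vec4 c 1 0 1) x'"
      "diff2 (vec4 c 1 0 1) x = a *s diff2 (vec4 c 1 0 1) x'"
      using diff_scale[of 1 "vec4 c 1 0 1" a x'] x'(2) by simp_all
    show ?thesis unfolding e using nrep[OF x'(3)] x'(1) by (auto simp: vec2_eq_iff intro: krel_scale)
  qed
  show ?fst unfolding given_by_def
  proof (intro allI impI)
    fix x assume "x \<noteq> 0 \<and> pt x \<in> mu4_curve c"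
    then have x: "x \<noteq> 0" "pt x \<in> mu4_curve c" "mu4_eqs c x" using mu4_curve_eqs by blast+
    show "(\<exists>t\<in>{\<lambda>x. vec2 (c * x $ 0) (x $ 1 + x $ 3), \<lambda>x. vec2 (x $ 1 + x $ 3) (c * x $ 2)}. t x \<noteq> 0) \<and>
      (\<forall>t\<in>{\<lambda>x. vec2 (c * x $ 0) (x $ 1 + x $ 3), \<lambda>x. vec2 (x $ 1 + x $ 3) (c * x $ 2)}. t x \<noteq> 0 \<longrightarrow>
        (fst \<circ> kummer_lambda c (pt s)) (pt x) = pt (t x))"
      using nr[OF x(1,3)] kummer_krel[OF x(2)] by (auto simp: diff kummer_lambda_def)
  qed
  show ?snd unfolding given_by_def
  proof (intro allI impI)
    fix x assume "x \<noteq> 0 \<and> pt x \<in> mu4_curve c"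
    then have x: "x \<noteq> 0" "mu4_eqs c x" using mu4_curve_eqs by blast+
    show "(\<exists>t\<in>{diff1 s, diff2 s}. t x \<noteq> 0) \<and> (\<forall>t\<in>{diff1 s, diff2 s}. t x \<noteq> 0 \<longrightarrow>
        (snd \<circ> kummer_lambda c (pt s)) (pt x) = pt (t x))"
      using mu4_diff_coords[OF x s] kummer_krel by (auto simp: kummer_lambda_def)
  qed
qed

end

section \<open>Rationality of the tuples\<close>

lemma form_tuple_linear:
  fixes a b :: "'k::field ^ 4"
  shows "form_tuple (\<lambda>x :: 'k alg_closure ^ 4. vec2
      (to_ac (a $ 0) * x $ 0 + to_ac (a $ 1) * x $ 1 + to_ac (a $ 2) * x $ 2 + to_ac (a $ 3) * x $ 3)
      (to_ac (b $ 0) * x $ 0 + to_ac (b $ 1) * x $ 1 + to_ac (b $ 2) * x $ 2 + to_ac (b $ 3) * x $ 3))"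
  unfolding form_tuple_def
proof (intro exI ext)
  fix x :: "'k alg_closure ^ 4"
  show "vec2
      (to_ac (a $ 0) * x $ 0 + to_ac (a $ 1) * x $ 1 + to_ac (a $ 2) * x $ 2 + to_ac (a $ 3) * x $ 3)
      (to_ac (b $ 0) * x $ 0 + to_ac (b $ 1) * x $ 1 + to_ac (b $ 2) * x $ 2 + to_ac (b $ 3) * x $ 3)
    = (\<chi> j. form_eval to_ac 1 (if j = 0 then linear_form a else linear_form b) x)"
    by (simp only: vec2_eq_iff vec2_nth vec_lambda_beta one_neq_zero if_True if_False simp_thms
        coeff_hom.form_eval_linear[OF coeff_hom_to_ac] sum_4)
qed

lemma quadratic_form_exists:
  fixes a b e :: "'k::field"
  shows "\<exists>F. \<forall>x :: 'k alg_closure ^ 2. form_eval to_ac 2 F x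
    = to_ac a * (x $ 0)\<^sup>2 + to_ac b * x $ 0 * x $ 1 + to_ac e * (x $ 1)\<^sup>2"
proof (intro exI allI)
  interpret coeff_hom "to_ac :: 'k \<Rightarrow> 'k alg_closure" by (rule coeff_hom_to_ac)
  fix x :: "'k alg_closure ^ 2"
  \<comment> \<open>The quadratic form is written as
    \<open>(a x0 + b x1) x0 + (e x1) x1\<close>.\<close>
  let ?F = "form_mult 1 1 (linear_form (vec2 a b)) (linear_form (vec2 1 0))"
  let ?G = "form_mult 1 1 (linear_form (vec2 0 e)) (linear_form (vec2 0 1))"
  have "form_eval to_ac (1 + 1) (\<lambda>m. ?F m + ?G m) x
      = to_ac a * (x $ 0)\<^sup>2 + to_ac b * x $ 0 * x $ 1 + to_ac e * (x $ 1)\<^sup>2"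
    unfolding form_eval_add form_eval_mult form_eval_linear sum_2
    by (simp add: power2_eq_square algebra_simps)
  then show "form_eval to_ac 2 (\<lambda>m. ?F m + ?G m) x
      = to_ac a * (x $ 0)\<^sup>2 + to_ac b * x $ 0 * x $ 1 + to_ac e * (x $ 1)\<^sup>2"
    by (simp only: one_add_one)
qed

text \<open>Every entry of the inverse tuples has bidegree \<open>(2, 1)\<close> and hence this
  shape.\<close>

lemma biform_exists:
  fixes a b e a' b' e' :: "'k::field"
  shows "\<exists>F. \<forall>(x :: 'k alg_closure ^ 2) (z :: 'k alg_closure ^ 2). biform_eval to_ac 2 1 F x z
    = (to_ac a * (x $ 0)\<^sup>2 + to_ac b * x $ 0 * x $ 1 + to_ac e * (x $ 1)\<^sup>2) * z $ 0
      + (to_ac a' * (x $ 0)\<^sup>2 + to_ac b' * x $ 0 * x $ 1 + to_ac e' * (x $ 1)\<^sup>2) * z $ 1"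
proof -
  interpret coeff_hom "to_ac :: 'k \<Rightarrow> 'k alg_closure" by (rule coeff_hom_to_ac)
  obtain F where F: "\<And>x :: 'k alg_closure ^ 2. form_eval to_ac 2 F x
      = to_ac a * (x $ 0)\<^sup>2 + to_ac b * x $ 0 * x $ 1 + to_ac e * (x $ 1)\<^sup>2"
    using quadratic_form_exists by blast
  obtain G where G: "\<And>x :: 'k alg_closure ^ 2. form_eval to_ac 2 G x
      = to_ac a' * (x $ 0)\<^sup>2 + to_ac b' * x $ 0 * x $ 1 + to_ac e' * (x $ 1)\<^sup>2"
    using quadratic_form_exists by blast
  show ?thesis
    by (rule exI[of _ "\<lambda>m m'. F m * linear_form (vec2 1 0) m' + G m * linear_form (vec2 0 1) m'"])
      (simp only: biform_eval_add biform_eval_mult F G form_eval_linear sum_2, simp)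
qed

lemma biform_tupleI:
  assumes "\<And>j. \<exists>F. \<forall>x z. biform_eval to_ac d e F x z = t x z $ j"
  shows "biform_tuple t"
proof -
  obtain F where "\<And>j x z. biform_eval to_ac d e (F j) x z = t x z $ j" using assms by metis
  then have "t = (\<lambda>u v. \<chi> j. biform_eval to_ac d e (F j) u v)" by (simp add: fun_eq_iff vec_eq_iff)
  then show ?thesis unfolding biform_tuple_def by blast
qed

lemma biform_tuple_lambda_inv:
  fixes c :: "'k::field"
  shows "biform_tuple (lambda_inv1 (to_ac c) (ac_vec s))" "biform_tuple (lambda_inv2 (to_ac c) (ac_vec s))"
proof -
  let ?p = "s $ 1 + s $ 3"
  show "biform_tuple (lambda_inv1 (to_ac c) (ac_vec s))"
  proof (rule biform_tupleI)
    fix j :: 4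
    have "j \<in> {0, 1, 2, 3}" using UNIV_4 by auto
    then consider "j = 0" | "j = 1" | "j = 2" | "j = 3" by blast
    then show "\<exists>F. \<forall>x z. biform_eval to_ac 2 1 F x z = lambda_inv1 (to_ac c) (ac_vec s) x z $ j"
    proof cases
      case 1
      show ?thesis by (rule ex_forward[OF biform_exists[of ?p 0 0 0 0 0]])
        (simp add: 1 lambda_inv1_def ac_vec_def algebra_simps)
    next
      case 2
      show ?thesis by (rule ex_forward[OF biform_exists[of 0 "c * s $ 1" 0 "s $ 0" 0 "s $ 2"]])
        (simp add: 2 lambda_inv1_def ac_vec_def algebra_simps)
    next
      case 3
      show ?thesis by (rule ex_forward[OF biform_exists[of 0 0 ?p 0 0 0]])
        (simp add: 3 lambda_inv1_def ac_vec_def algebra_simps)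
    next
      case 4
      show ?thesis by (rule ex_forward[OF biform_exists[of 0 "c * s $ 3" 0 "s $ 0" 0 "s $ 2"]])
        (simp add: 4 lambda_inv1_def ac_vec_def algebra_simps)
    qed
  qed
  show "biform_tuple (lambda_inv2 (to_ac c) (ac_vec s))"
  proof (rule biform_tupleI)
    fix j :: 4
    have "j \<in> {0, 1, 2, 3}" using UNIV_4 by auto
    then consider "j = 0" | "j = 1" | "j = 2" | "j = 3" by blast
    then show "\<exists>F. \<forall>x z. biform_eval to_ac 2 1 F x z = lambda_inv2 (to_ac c) (ac_vec s) x z $ j"
    proof cases
      case 1
      show ?thesis by (rule ex_forward[OF biform_exists[of 0 0 0 ?p 0 0]])
        (simp add: 1 lambda_inv2_def ac_vec_def algebra_simps)
    next
      case 2
      show ?thesis by (rule ex_forward[OF biform_exists[of "s $ 2" 0 "s $ 0" 0 "c * s $ 3" 0]])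
        (simp add: 2 lambda_inv2_def ac_vec_def algebra_simps)
    next
      case 3
      show ?thesis by (rule ex_forward[OF biform_exists[of 0 0 0 0 0 ?p]])
        (simp add: 3 lambda_inv2_def ac_vec_def algebra_simps)
    next
      case 4
      show ?thesis by (rule ex_forward[OF biform_exists[of "s $ 2" 0 "s $ 0" 0 "c * s $ 1" 0]])
        (simp add: 4 lambda_inv2_def ac_vec_def algebra_simps)
    qed
  qed
qed

text \<open>For \<open>c = 0\<close> both gradients vanish at
  \<open>(1 : 0 : 1 : 0)\<close>.\<close>

lemma mu4_nonsingular_nonzero:
  assumes "(2 :: 'a::field) = 0" "mu4_nonsingular (c :: 'a)"
  shows "c \<noteq> 0"
proof
  assume c: "c = 0"
  have x: "vec4 1 0 1 0 \<noteq> (0 :: 'a ^ 4)" "mu4_eqs c (vec4 1 0 1 0)"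
    using assms(1) by (simp_all add: vec4_eq_iff mu4_eqs_def c)
  have "(1::'a) = 0 \<and> (0::'a) = 0"
    by (rule assms(2)[unfolded mu4_nonsingular_def, rule_format, OF conjI[OF x]])
      (simp add: vec4_eq_iff c assms(1))
  then show False by simp
qed

theorem theorem24:
  fixes c :: "'k::field" and s :: "'k ^ 4"
  assumes "CHAR('k) = 2"
    and "mu4_nonsingular (to_ac c)"
    and "s \<noteq> 0" and "pt s \<in> mu4_curve c"
  shows
    "let c' = to_ac c; S = pt (ac_vec s); C = mu4_curve c';
         K = kummer_oriented_curve c' S; lam = kummer_lambda c' S;
         s0 = to_ac (s $ 0); s1 = to_ac (s $ 1); s2 = to_ac (s $ 2); s3 = to_ac (s $ 3)
     in
       K = {(pt U, pt V) | U V. U \<noteq> 0 \<and> V \<noteq> 0 \<and>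
              s0 * (U $ 0 * V $ 1 + U $ 1 * V $ 0)\<^sup>2 + s2 * (U $ 0 * V $ 0 + U $ 1 * V $ 1)\<^sup>2
                = c' * (s1 + s3) * U $ 0 * U $ 1 * V $ 0 * V $ 1} \<and>
       (\<not> two_torsion c' S \<longrightarrow>
          is_isomorphism C K lam \<and>
          given_by C (fst \<circ> lam)
            {\<lambda>x. vec2 (c' * x $ 0) (x $ 1 + x $ 3),
             \<lambda>x. vec2 (x $ 1 + x $ 3) (c' * x $ 2)} \<and>
          given_by C (snd \<circ> lam)
            {\<lambda>x. vec2 (s0 * x $ 0 + s2 * x $ 2) (s3 * x $ 1 + s1 * x $ 3),
             \<lambda>x. vec2 (s1 * x $ 1 + s3 * x $ 3) (s2 * x $ 0 + s0 * x $ 2)} \<and>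
          bi_given_by K (inv_into C lam)
            {\<lambda>U V. vec4
               ((s1 + s3) * (U $ 0)\<^sup>2 * V $ 0)
               ((s0 * (U $ 0)\<^sup>2 + s2 * (U $ 1)\<^sup>2) * V $ 1 + c' * s1 * U $ 0 * U $ 1 * V $ 0)
               ((s1 + s3) * (U $ 1)\<^sup>2 * V $ 0)
               ((s0 * (U $ 0)\<^sup>2 + s2 * (U $ 1)\<^sup>2) * V $ 1 + c' * s3 * U $ 0 * U $ 1 * V $ 0),
             \<lambda>U V. vec4
               ((s1 + s3) * (U $ 0)\<^sup>2 * V $ 1)
               ((s2 * (U $ 0)\<^sup>2 + s0 * (U $ 1)\<^sup>2) * V $ 0 + c' * s3 * U $ 0 * U $ 1 * V $ 1)
               ((s1 + s3) * (U $ 1)\<^sup>2 * V $ 1)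
               ((s2 * (U $ 0)\<^sup>2 + s0 * (U $ 1)\<^sup>2) * V $ 0 + c' * s1 * U $ 0 * U $ 1 * V $ 1)})"
proof -
  define c' where "c' = to_ac c"
  define \<sigma> where "\<sigma> = ac_vec s"
  have "of_nat CHAR('k) = (0 :: 'k)" by simp
  then have "(2 :: 'k) = 0" unfolding assms(1) by simp
  then have two: "(2 :: 'k alg_closure) = 0" by (metis to_ac_0 to_ac_numeral)
  \<comment> \<open>The geometry takes place over the algebraic closure; nonsingularity supplies
    \<open>c' \<noteq> 0\<close>.\<close>
  interpret mu4 c'
    using two mu4_nonsingular_nonzero[OF two] assms(2) unfolding c'_def by unfold_locales blast+
  have nth: "\<sigma> $ i = to_ac (s $ i)" for i by (simp add: \<sigma>_def ac_vec_def)
  have "mu4_eqs c s" using mu4_curve_eqs assms(3,4) by blast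
  then have "mu4_eqs c' \<sigma>"
    unfolding mu4_eqs_def c'_def nth
    by (simp only: to_ac_add[symmetric] to_ac_mult[symmetric] to_ac_power[symmetric])
  moreover have "\<sigma> \<noteq> 0" using assms(3) by (auto simp: vec_eq_iff nth)
  ultimately have s: "\<sigma> \<noteq> 0" "mu4_eqs c' \<sigma>" by blast+
  have p: "\<sigma> $ 1 + \<sigma> $ 3 \<noteq> 0" if "\<not> two_torsion c' (pt \<sigma>)" using two_torsionI[OF s] that by blast
  have tuple: "form_tuple (\<lambda>x :: 'k alg_closure ^ 4. vec2 (c' * x $ 0) (x $ 1 + x $ 3))"
    "form_tuple (\<lambda>x :: 'k alg_closure ^ 4. vec2 (x $ 1 + x $ 3) (c' * x $ 2))"
    "form_tuple (diff1 \<sigma>)" "form_tuple (diff2 \<sigma>)"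
    using form_tuple_linear[of "vec4 c 0 0 0" "vec4 0 1 0 1"] form_tuple_linear[of "vec4 0 1 0 1" "vec4 0 0 c 0"]
      form_tuple_linear[of "vec4 (s $ 0) 0 (s $ 2) 0" "vec4 0 (s $ 3) 0 (s $ 1)"]
      form_tuple_linear[of "vec4 0 (s $ 1) 0 (s $ 3)" "vec4 (s $ 2) 0 (s $ 0) 0"]
    by (simp_all add: c'_def diff1_def[abs_def] diff2_def[abs_def] nth)
  have lam1: "is_morphism (mu4_curve c') (fst \<circ> kummer_lambda c' (pt \<sigma>))"
    unfolding is_morphism_def
    by (rule exI, rule conjI[OF _ lambda_given_by(1)[OF s]]) (auto intro: tuple)
  have lam2: "is_morphism (mu4_curve c') (snd \<circ> kummer_lambda c' (pt \<sigma>))"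
    unfolding is_morphism_def
    by (rule exI, rule conjI[OF _ lambda_given_by(2)[OF s]]) (auto intro: tuple)
  have inv: "is_bi_morphism (kummer_oriented_curve c' (pt \<sigma>))
      (inv_into (mu4_curve c') (kummer_lambda c' (pt \<sigma>)))" if "\<not> two_torsion c' (pt \<sigma>)"
    unfolding is_bi_morphism_def
    by (rule exI, rule conjI[OF _ lambda_bij(2)[OF s p[OF that]]])
      (use biform_tuple_lambda_inv[of c s] in \<open>auto simp: c'_def \<sigma>_def\<close>)
  show ?thesis
    unfolding Let_def c'_def[symmetric] \<sigma>_def[symmetric] nth[symmetric]
  proof (intro conjI impI)
    assume nt: "\<not> two_torsion c' (pt \<sigma>)"
    show "is_isomorphism (mu4_curve c') (kummer_oriented_curve c' (pt \<sigma>)) (kummer_lambda c' (pt \<sigma>))"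
      unfolding is_isomorphism_def using lambda_bij(1)[OF s p[OF nt]] lam1 lam2 inv[OF nt] by blast
    note lambda_bij(2)[OF s p[OF nt], unfolded lambda_inv1_def[abs_def] lambda_inv2_def[abs_def]]
    then show "bi_given_by (kummer_oriented_curve c' (pt \<sigma>))
        (inv_into (mu4_curve c') (kummer_lambda c' (pt \<sigma>)))
        {\<lambda>U V. vec4
           ((\<sigma> $ 1 + \<sigma> $ 3) * (U $ 0)\<^sup>2 * V $ 0)
           ((\<sigma> $ 0 * (U $ 0)\<^sup>2 + \<sigma> $ 2 * (U $ 1)\<^sup>2) * V $ 1 + c' * \<sigma> $ 1 * U $ 0 * U $ 1 * V $ 0)
           ((\<sigma> $ 1 + \<sigma> $ 3) * (U $ 1)\<^sup>2 * V $ 0)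
           ((\<sigma> $ 0 * (U $ 0)\<^sup>2 + \<sigma> $ 2 * (U $ 1)\<^sup>2) * V $ 1 + c' * \<sigma> $ 3 * U $ 0 * U $ 1 * V $ 0),
         \<lambda>U V. vec4
           ((\<sigma> $ 1 + \<sigma> $ 3) * (U $ 0)\<^sup>2 * V $ 1)
           ((\<sigma> $ 2 * (U $ 0)\<^sup>2 + \<sigma> $ 0 * (U $ 1)\<^sup>2) * V $ 0 + c' * \<sigma> $ 3 * U $ 0 * U $ 1 * V $ 1)
           ((\<sigma> $ 1 + \<sigma> $ 3) * (U $ 1)\<^sup>2 * V $ 1)
           ((\<sigma> $ 2 * (U $ 0)\<^sup>2 + \<sigma> $ 0 * (U $ 1)\<^sup>2) * V $ 0 + c' * \<sigma> $ 1 * U $ 0 * U $ 1 * V $ 1)}" .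
  qed (rule kummer_oriented_curve_eq[OF s, unfolded oriented_eq_def] lambda_given_by(1)[OF s]
      lambda_given_by(2)[OF s, unfolded diff1_def[abs_def] diff2_def[abs_def]])+
qed

end
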